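(* Let $U$, $\gamma$, $I$ be the small-amplitude $2\pi$-periodic wave profile and its parameters described in the context, parameterized by the amplitude $a$, and let $\delta^2\Lambda_{c,\gamma}$ be the quadratic form defined in the context. There exist $\gamma_0\in\left(1,\frac{\pi^2}{9}\right)$ and $C>0$ such that $$\delta^2\Lambda_{c,\gamma}\ \ge\ C\,\|v\|_{H^2_{\rm per}}^2$$ for every $\gamma\in(1,\gamma_0)$ and every $v\in H^2_{\rm per,zero}$ such that $\langle U',v\rangle_{L^2_{\rm per}}=0$, if $c\in(c_-,c_+)$, where $c_\pm$ are given by the asymptotic expansion $$c_{\pm}=\frac12\pm\frac{\sqrt3\,a}{2}+\mathcal O(a^2)\quad\text{as } a\to0,$$ and where $a$ determines $\gamma$ and $I$ through the expansions $\gamma=1+\frac16a^2+\mathcal O(a^4)$ and $I=\frac12a^2+\mathcal O(a^4)$.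
   Context: **Periodic wave.** Consider the reduced Ostrovsky equation $(u_t+uu_x)_x=u$. Its (normalized) travelling wave profiles $U(z)$ satisfy $$\frac{d}{dz}\left[(\gamma-U)\frac{dU}{dz}\right]+U=0 ,$$ and along solutions the quantity $I=\frac12(\gamma-U)^2(U')^2+\frac{\gamma}{2}U^2-\frac13U^3$ is constant. For $\gamma>1$ close to $1$, $U$ is the smooth, even, $2\pi$-periodic (hence zero-mean) solution parameterized by the small amplitude parameter $a$: $$U(z)=a\cos z+\tfrac13a^2\cos 2z+\tfrac{3}{16}a^3\cos3z+\mathcal O(a^4),\quad \gamma=1+\tfrac16a^2+\mathcal O(a^4),\quad I=\tfrac12a^2+\mathcal O(a^4)\quad\text{as }a\to0.$$ For these waves $U(z)<\gamma$ and $1-3U''(z)>0$ for all $z$, and $\gamma^3-6I>0$. **Function spaces.** The perturbations $v$ are $2\pi N$-periodic, where $N$ is a positive integer. $L^2_{\rm per}$ and $H^s_{\rm per}$ denote the corresponding spaces of $2\pi N$-periodic functions, with inner products and norms over one period; the subscript "zero" restricts to zero-mean functions. $\partial_z^{-1}v$ denotes the zero-mean antiderivative of a zero-mean periodic function $v$. **Quadratic form.** For $c\in\mathbb R$ and $v\in H^2_{\rm per,zero}$, $$\delta^2\Lambda_{c,\gamma}=\int\left[(\partial_z^{-1}v)^2-(\gamma-U)v^2-\frac{c\,v^2}{(\gamma^3-6I)^{2/3}}+\frac{c\,v_{zz}^2}{(1-3U'')^{5/3}}\right]dz ,$$ with the integral over one period of $v$. This is the quadratic part in $v$ of $\Lambda_{c,\gamma}(U+v)-\Lambda_{c,\gamma}(U)$,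 where $\Lambda_{c,\gamma}=S_\gamma-cR_\Gamma$, $S_\gamma(u)=\int[(\partial_z^{-1}u)^2+\frac13u^3-\gamma u^2]\,dz$, $R_\Gamma(u)=\int[(1-3u_{zz})^{1/3}-\Gamma u^2]\,dz$, and $\Gamma=-(\gamma^3-6I)^{-2/3}$.
   Formalization: The constant C may depend on γ (equivalently on a) and on N, but not on c or v: a C uniform over all γ in (1,γ0) cannot exist, since for c = 1/2 and v = cos z the quadratic form tends to 0 as a→0 while the H² norm of v stays fixed. *)

theory Defs
  imports "HOL-Analysis.Analysis" "HOL-Library.Landau_Symbols"
begin

section \<open>Periodic Lebesgue and Sobolev spaces\<close>

text \<open>
  Functions of period \<open>L\<close> are functions on the whole real line. Elements of
  \<^term>\<open>L2_per\<close> are not identified when they agree almost everywhere; every quantity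
  below is an integral and does not see the difference.
\<close>

definition per_integral :: "real \<Rightarrow> (real \<Rightarrow> real) \<Rightarrow> real" where
  "per_integral L f = set_lebesgue_integral lebesgue {0..L} f"

definition L2_per :: "real \<Rightarrow> (real \<Rightarrow> real) set" where
  "L2_per L = {f. f \<in> borel_measurable lebesgue \<and> (\<forall>x. f (x + L) = f x) \<and>
                  set_integrable lebesgue {0..L} (\<lambda>x. (f x)\<^sup>2)}"

definition L2_inner :: "real \<Rightarrow> (real \<Rightarrow> real) \<Rightarrow> (real \<Rightarrow> real) \<Rightarrow> real" where
  "L2_inner L f g = per_integral L (\<lambda>x. f x * g x)"

text \<open>
  \<open>g\<close> is the \<open>L\<^sup>2\<close> derivative of the (absolutely continuous) function \<open>f\<close>. Elements of
  the Sobolev spaces are represented by their continuous representatives, for which this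
  is the usual notion of weak derivative. The derivative \<open>g\<close> is determined almost everywhere.
\<close>

definition has_L2_deriv :: "real \<Rightarrow> (real \<Rightarrow> real) \<Rightarrow> (real \<Rightarrow> real) \<Rightarrow> bool" where
  "has_L2_deriv L f g \<longleftrightarrow> f \<in> L2_per L \<and> g \<in> L2_per L \<and>
     (\<forall>x y. x \<le> y \<longrightarrow> f y - f x = set_lebesgue_integral lebesgue {x..y} g)"

definition H1_per :: "real \<Rightarrow> (real \<Rightarrow> real) set" where
  "H1_per L = {f. \<exists>g. has_L2_deriv L f g}"

definition H2_per :: "real \<Rightarrow> (real \<Rightarrow> real) set" where
  "H2_per L = {f. \<exists>g \<in> H1_per L. has_L2_deriv L f g}"

text \<open>
  If \<open>f\<close> has a derivative in \<^term>\<open>H1_per L\<close>, that continuous representative is the one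
  chosen, so that the second derivative of an element of \<^term>\<open>H2_per L\<close> is
  \<^term>\<open>L2_deriv L (L2_deriv L f)\<close>.
\<close>

definition L2_deriv :: "real \<Rightarrow> (real \<Rightarrow> real) \<Rightarrow> (real \<Rightarrow> real)" where
  "L2_deriv L f = (SOME g. has_L2_deriv L f g \<and> (f \<in> H2_per L \<longrightarrow> g \<in> H1_per L))"

definition H2_per_zero :: "real \<Rightarrow> (real \<Rightarrow> real) set" where
  "H2_per_zero L = {f \<in> H2_per L. per_integral L f = 0}"

definition H2_norm :: "real \<Rightarrow> (real \<Rightarrow> real) \<Rightarrow> real" where
  "H2_norm L f = sqrt (per_integral L (\<lambda>x. (f x)\<^sup>2 + (L2_deriv L f x)\<^sup>2
                                          + (L2_deriv L (L2_deriv L f) x)\<^sup>2))"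

text \<open>The zero-mean antiderivative of a zero-mean periodic function.\<close>

definition zero_mean_antideriv :: "real \<Rightarrow> (real \<Rightarrow> real) \<Rightarrow> (real \<Rightarrow> real)" where
  "zero_mean_antideriv L v = (THE w. has_L2_deriv L w v \<and> per_integral L w = 0)"


section \<open>Periodic waves of the reduced Ostrovsky equation\<close>

definition ostrovsky_wave :: "real \<Rightarrow> real \<Rightarrow> (real \<Rightarrow> real) \<Rightarrow> bool" where
  "ostrovsky_wave \<gamma> I U \<longleftrightarrow>
     (\<forall>k z. (deriv ^^ k) U differentiable (at z)) \<and>
     (\<forall>z. U (- z) = U z) \<and>
     (\<forall>z. U (z + 2 * pi) = U z) \<and>
     (\<forall>z. deriv (\<lambda>x. (\<gamma> - U x) * deriv U x) z + U z = 0) \<and>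
     (\<forall>z. I = 1/2 * (\<gamma> - U z)\<^sup>2 * (deriv U z)\<^sup>2 + \<gamma>/2 * (U z)\<^sup>2 - 1/3 * (U z)^3) \<and>
     (\<forall>z. U z < \<gamma>) \<and>
     (\<forall>z. 1 - 3 * deriv (deriv U) z > 0) \<and>
     \<gamma>^3 - 6 * I > 0"

text \<open>
  The family of small-amplitude waves, parameterized by the amplitude \<open>a \<in> (0, a0)\<close>.
  The amplitude is taken positive; the sign change of \<open>a\<close> is a translation of the wave by
  half a period. The speed \<open>\<gamma>\<close> increases with \<open>a\<close> and takes each value in \<open>(1, \<gamma>1)\<close>
  once, so a property of all waves with speed in \<open>(1, \<gamma>0)\<close>, where \<open>\<gamma>0 \<le> \<gamma>1\<close>, is a property
  of all \<open>a \<in> (0, a0)\<close> with \<open>\<gamma> a \<in> (1, \<gamma>0)\<close>. The remainder in the expansion of \<open>U\<close> is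
  uniform in \<open>z\<close>.
\<close>

definition small_amplitude_waves ::
  "real \<Rightarrow> real \<Rightarrow> (real \<Rightarrow> real \<Rightarrow> real) \<Rightarrow> (real \<Rightarrow> real) \<Rightarrow> (real \<Rightarrow> real) \<Rightarrow> bool" where
  "small_amplitude_waves a0 \<gamma>1 U \<gamma> I \<longleftrightarrow>
     0 < a0 \<and> 1 < \<gamma>1 \<and>
     (\<forall>a\<in>{0<..<a0}. ostrovsky_wave (\<gamma> a) (I a) (U a)) \<and>
     strict_mono_on {0<..<a0} \<gamma> \<and> \<gamma> ` {0<..<a0} = {1<..<\<gamma>1} \<and>
     (\<exists>K. \<forall>\<^sub>F a in at_right 0. \<forall>z.
        \<bar>U a z - (a * cos z + 1/3 * a^2 * cos (2 * z) + 3/16 * a^3 * cos (3 * z))\<bar> \<le> K * a^4) \<and>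
     (\<lambda>a. \<gamma> a - (1 + 1/6 * a^2)) \<in> O[at_right 0](\<lambda>a. a^4) \<and>
     (\<lambda>a. I a - 1/2 * a^2) \<in> O[at_right 0](\<lambda>a. a^4)"


section \<open>The second variation\<close>

definition second_variation ::
  "real \<Rightarrow> real \<Rightarrow> real \<Rightarrow> (real \<Rightarrow> real) \<Rightarrow> real \<Rightarrow> (real \<Rightarrow> real) \<Rightarrow> real" where
  "second_variation c \<gamma> I U L v =
     per_integral L (\<lambda>z. (zero_mean_antideriv L v z)\<^sup>2 - (\<gamma> - U z) * (v z)\<^sup>2
        - c * (v z)\<^sup>2 / (\<gamma>^3 - 6 * I) powr (2/3)
        + c * (L2_deriv L (L2_deriv L v) z)\<^sup>2 / (1 - 3 * deriv (deriv U) z) powr (5/3))"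

end

theory Submission
  imports Defs
begin

text \<open>
  Write \<open>h = \<gamma> - U\<close>, \<open>W = \<partial>\<^sub>z\<^sup>-\<^sup>1 v\<close> and \<open>f = (h v)' + W\<close>. By the wave equation \<open>f\<close> vanishes for
  \<open>v = U'\<close>, which lies in the kernel of the form. Put \<open>b = h (U v - U' W) / a\<close>, so that \<open>b' = (U/a) f\<close>.
  Up to exact derivatives the whole integrand is a quadratic form in \<open>(f', f, b)\<close> alone, for every \<open>c\<close>:
  the relation \<open>1 - 3 U'' = J / h\<^sup>3\<close>, \<open>J = \<gamma>\<^sup>3 - 6 I\<close>, turns \<open>h\<^sup>5 v''\<^sup>2 - J v\<^sup>2\<close> into
  \<open>h (h f' - 2 h' f)\<^sup>2 + 2 h (\<gamma> - 3 h'\<^sup>2) f\<^sup>2 + 2 a\<^sup>2 b\<^sup>2 / h - 2 \<gamma>\<^sup>2 W f\<close>, and \<open>W f\<close> is reduced to \<open>f b\<close> and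
  \<open>b\<^sup>2\<close> by means of an approximate second solution \<open>sin z + (a/3) sin 2z\<close> of \<open>(h Y')' + Y = 0\<close>.

  For small \<open>a\<close> and \<open>\<epsilon> \<approx> 1 - 2c\<close> the result is, to leading order,
  \<open>f'\<^sup>2/2 + f\<^sup>2 + 2 \<epsilon> sin z b f + a\<^sup>2 b\<^sup>2\<close>. Completing squares with \<open>f + (2\<epsilon>/3) sin z b\<close> leaves
  \<open>(a\<^sup>2 - \<epsilon>\<^sup>2/3) b\<^sup>2\<close>, which is positive if \<open>\<bar>c - 1/2\<bar> < \<surd>3 a / 2\<close>; the margin of order
  \<open>a\<^sup>2\<close> in \<open>c\<^sub>\<plusminus>\<close> absorbs all remainders. No remainder involves \<open>W\<close> itself, so nothing is lost along
  the kernel, and the estimate is pointwise in \<open>z\<close>, hence independent of the period \<open>2 \<pi> N\<close>. Finally \<open>W\<close> is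
  recovered from \<open>f\<close> and \<open>b\<close> by variation of constants up to a multiple of \<open>U\<close>, which the
  orthogonality condition controls.
\<close>

section \<open>Calculus on one period\<close>

text \<open>On a uniform partition into n pieces the bounds telescope in \<open>m\<close>, while the
  factor \<open>y - x\<close> contributes \<open>L / n\<close>; the total increment therefore tends
  to 0. This stands in for the product rule when one factor is only a primitive of an integrable
  function.\<close>

lemma eq_endpoints_if_small_increments:
  fixes \<Phi> m :: "real \<Rightarrow> real"
  assumes "0 \<le> L"
    and inc: "\<And>x y. 0 \<le> x \<Longrightarrow> x \<le> y \<Longrightarrow> y \<le> L \<Longrightarrow> \<bar>\<Phi> y - \<Phi> x\<bar> \<le> K * (y - x) * (m y - m x)"
  shows "\<Phi> L = \<Phi> 0"
proof -
  have bound: "\<bar>\<Phi> L - \<Phi> 0\<bar> \<le> K * (m L - m 0) * L * inverse (real (Suc n))" for n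
  proof -
    let ?N = "Suc n"
    define x where "x i = L * real i / real ?N" for i
    have x0: "x 0 = 0" and xN: "x ?N = L" by (auto simp: x_def simp del: of_nat_Suc)
    have step: "\<bar>\<Phi> (x (Suc i)) - \<Phi> (x i)\<bar> \<le> K * (L / real ?N) * (m (x (Suc i)) - m (x i))"
      if "i < ?N" for i
    proof -
      have "x (Suc i) - x i = L / real ?N"
        by (simp add: x_def diff_divide_distrib[symmetric] right_diff_distrib[symmetric] del: of_nat_Suc)
      moreover have "0 \<le> x i" "x i \<le> x (Suc i)" using \<open>0 \<le> L\<close>
        by (auto simp: x_def intro!: divide_right_mono mult_left_mono)
      moreover have "x (Suc i) \<le> L"
      proof -
        have "L * real (Suc i) \<le> L * real ?N" using that \<open>0 \<le> L\<close> by (intro mult_left_mono) auto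
        then show ?thesis by (simp add: x_def divide_simps)
      qed
      ultimately show ?thesis using inc[of "x i" "x (Suc i)"] by simp
    qed
    have "\<bar>\<Phi> L - \<Phi> 0\<bar> = \<bar>\<Sum>i<?N. \<Phi> (x (Suc i)) - \<Phi> (x i)\<bar>"
      using sum_lessThan_telescope[of "\<lambda>i. \<Phi> (x i)" ?N] x0 xN by (simp del: sum.lessThan_Suc)
    also have "\<dots> \<le> (\<Sum>i<?N. K * (L / real ?N) * (m (x (Suc i)) - m (x i)))"
      using step by (intro order_trans[OF sum_abs] sum_mono) auto
    also have "\<dots> = K * (L / real ?N) * (m L - m 0)"
      using sum_lessThan_telescope[of "\<lambda>i. m (x i)" ?N] x0 xN
      by (simp only: sum_distrib_left[symmetric])
    finally show ?thesis by (simp add: field_simps)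
  qed
  have "(\<lambda>n. K * (m L - m 0) * L * inverse (real (Suc n))) \<longlonglongrightarrow> K * (m L - m 0) * L * 0"
    by (intro tendsto_mult tendsto_const LIMSEQ_inverse_real_of_nat)
  then have "\<bar>\<Phi> L - \<Phi> 0\<bar> \<le> K * (m L - m 0) * L * 0"
    using bound by (intro LIMSEQ_le_const) auto
  then show ?thesis by simp
qed

lemma absolutely_integrable_mult_continuous:
  fixes g G :: "real \<Rightarrow> real"
  assumes "g absolutely_integrable_on {a..b}" "continuous_on {a..b} G"
  shows "(\<lambda>x. g x * G x) absolutely_integrable_on {a..b}"
proof -
  have "(\<lambda>x. G x * g x) absolutely_integrable_on {a..b}"
  proof (rule absolutely_integrable_bounded_measurable_product_real)
    show "G \<in> borel_measurable (lebesgue_on {a..b})"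
      using assms(2) by (intro continuous_imp_measurable_on_sets_lebesgue) auto
    show "bounded (G ` {a..b})"
      using assms(2) compact_continuous_image compact_imp_bounded by blast
  qed (use assms in auto)
  then show ?thesis by (simp add: mult.commute)
qed

text \<open>Since \<open>g\<close> is merely integrable, \<open>w\<close> need not be differentiable
  everywhere and the fundamental theorem does not apply to \<open>w * G\<close>. Instead, the
  increments of \<open>w * G\<close> minus its running integral are of second order, because both
  \<open>w\<close> and \<open>G\<close> vary little on a short interval. The continuity statement is
  also used alone, with \<open>G = 0\<close>.\<close>

lemma integral_by_parts_indefinite:
  fixes g w G G' :: "real \<Rightarrow> real"
  assumes "0 \<le> L"
    and g: "g absolutely_integrable_on {0..L}"
    and w: "\<And>x y. 0 \<le> x \<Longrightarrow> x \<le> y \<Longrightarrow> y \<le> L \<Longrightarrow> w y - w x = integral {x..y} g"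
    and G: "\<And>x. x \<in> {0..L} \<Longrightarrow> (G has_real_derivative G' x) (at x within {0..L})"
    and G': "continuous_on {0..L} G'"
  shows "continuous_on {0..L} w"
    and "integral {0..L} (\<lambda>x. g x * G x + w x * G' x) = w L * G L - w 0 * G 0"
proof -
  have gi: "g integrable_on {x..y}" "(\<lambda>t. \<bar>g t\<bar>) integrable_on {x..y}"
      "g absolutely_integrable_on {x..y}"
    if "0 \<le> x" "y \<le> L" for x y
  proof -
    show "g absolutely_integrable_on {x..y}"
      using g by (rule absolutely_integrable_on_subinterval) (use that in auto)
    then show "g integrable_on {x..y}" "(\<lambda>t. \<bar>g t\<bar>) integrable_on {x..y}"
      by (auto simp: absolutely_integrable_on_def)
  qed
  have "continuous_on {0..L} (\<lambda>x. w 0 + integral {0..x} g)"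
    using gi \<open>0 \<le> L\<close> by (intro continuous_intros indefinite_integral_continuous_1) auto
  moreover have "w x = w 0 + integral {0..x} g" if "x \<in> {0..L}" for x
    using w[of 0 x] that by auto
  ultimately show cw: "continuous_on {0..L} w"
    by (metis (no_types, lifting) continuous_on_cong)
  have cG: "continuous_on {0..L} G"
    using G by (meson DERIV_continuous continuous_on_eq_continuous_within)
  obtain M where M: "\<And>x. x \<in> {0..L} \<Longrightarrow> \<bar>G' x\<bar> \<le> M" and "0 \<le> M"
  proof -
    have "bounded (G' ` {0..L})" using G' compact_continuous_image compact_imp_bounded by blast
    then obtain M where "\<And>x. x \<in> {0..L} \<Longrightarrow> \<bar>G' x\<bar> \<le> M" by (metis (no_types, lifting) bounded_iff image_eqI real_norm_def)
    then show ?thesis using that[of M] \<open>0 \<le> L\<close> by (metis abs_ge_zero atLeastAtMost_iff order_refl order_trans)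
  qed
  have lip: "\<bar>G y - G x\<bar> \<le> M * (y - x)" if "0 \<le> x" "x \<le> y" "y \<le> L" for x y
  proof -
    have "norm (G y - G x) \<le> M * norm (y - x)"
      by (rule field_differentiable_bound[of "{0..L}"]) (use G M that in auto)
    then show ?thesis using that by simp
  qed
  \<comment> \<open>\<open>m\<close> bounds the variation of \<open>w\<close>, while
    \<open>G\<close> is Lipschitz with constant \<open>M\<close>; the error on an interval is
    bounded by a product of the two.\<close>
  define m where "m x = integral {0..x} (\<lambda>t. \<bar>g t\<bar>)" for x
  have m: "m y - m x = integral {x..y} (\<lambda>t. \<bar>g t\<bar>)" if "0 \<le> x" "x \<le> y" "y \<le> L" for x y
    using Henstock_Kurzweil_Integration.integral_combine[of 0 x y "\<lambda>t. \<bar>g t\<bar>"] gi[of 0 y] that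
    by (simp add: m_def)
  let ?H = "\<lambda>x. g x * G x + w x * G' x"
  have Hi: "?H absolutely_integrable_on {0..L}"
    by (intro set_integral_add(1) absolutely_integrable_mult_continuous g cG
        absolutely_integrable_continuous_real continuous_intros cw G')
  have Hi': "?H integrable_on {x..y}" if "0 \<le> x" "y \<le> L" for x y
    using integrable_on_subinterval[OF set_lebesgue_integral_eq_integral(1)[OF Hi]] that by auto
  define \<Phi> where "\<Phi> x = w x * G x - integral {0..x} ?H" for x
  have "\<Phi> L = \<Phi> 0"
  proof (rule eq_endpoints_if_small_increments[OF \<open>0 \<le> L\<close>])
    fix x y assume xy: "0 \<le> x" "x \<le> y" "y \<le> L"
    have sub: "{x..y} \<subseteq> {0..L}" using xy by auto
    have G'x: "integral {x..y} G' = G y - G x"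
    proof (rule integral_unique, rule fundamental_theorem_of_calculus)
      fix t assume "t \<in> {x..y}"
      then show "(G has_vector_derivative G' t) (at t within {x..y})"
        using G[of t] sub has_field_derivative_subset has_real_derivative_iff_has_vector_derivative by blast
    qed (use xy in auto)
    have i1: "(\<lambda>t. g t * G y) integrable_on {x..y}" 
      using gi xy by (intro integrable_on_mult_left) auto
    have cG': "continuous_on {x..y} G'" "continuous_on {x..y} w" "continuous_on {x..y} G"
      using G' cw cG sub continuous_on_subset by blast+
    have i2: "(\<lambda>t. w x * G' t) integrable_on {x..y}"
      by (intro integrable_continuous_real continuous_intros cG')
    have "\<Phi> y - \<Phi> x = w y * G y - w x * G x - integral {x..y} ?H"
      using Henstock_Kurzweil_Integration.integral_combine[of 0 x y ?H] Hi'[of 0 y] xy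
      by (simp add: \<Phi>_def)
    \<comment> \<open>Freezing \<open>G\<close> at \<open>y\<close> and \<open>w\<close> at
      \<open>x\<close> turns the increment into an exact integral, so that only
      \<open>G y - G t\<close> and \<open>w x - w t\<close> remain in the difference with
      \<open>?H\<close>.\<close>
    also have "w y * G y - w x * G x = (w y - w x) * G y + w x * (G y - G x)"
      by (simp add: algebra_simps)
    also have "\<dots> = integral {x..y} (\<lambda>t. g t * G y) + integral {x..y} (\<lambda>t. w x * G' t)"
      using w[OF xy] G'x by simp
    also have "\<dots> = integral {x..y} (\<lambda>t. g t * G y + w x * G' t)"
      using i1 i2 by (simp add: Henstock_Kurzweil_Integration.integral_add)
    also have "\<dots> - integral {x..y} ?H = integral {x..y} (\<lambda>t. (g t * G y + w x * G' t) - ?H t)"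
      by (rule Henstock_Kurzweil_Integration.integral_diff[symmetric, OF integrable_add[OF i1 i2] Hi'[OF xy(1,3)]])
    finally have eq: "\<Phi> y - \<Phi> x = integral {x..y} (\<lambda>t. (g t * G y + w x * G' t) - ?H t)" .
    have wt: "\<bar>w x - w t\<bar> \<le> m y - m x" if "t \<in> {x..y}" for t
    proof -
      have "\<bar>w t - w x\<bar> = \<bar>integral {x..t} g\<bar>" using w[of x t] that xy by simp
      also have "\<dots> \<le> integral {x..t} (\<lambda>t. \<bar>g t\<bar>)"
        using that xy gi[of x t] by (intro integral_norm_bound_integral[where 'a=real, unfolded real_norm_def]) auto
      also have "\<dots> \<le> integral {x..y} (\<lambda>t. \<bar>g t\<bar>)"
        using that xy by (intro integral_subset_le gi) auto
      finally show ?thesis using m xy by (simp add: abs_minus_commute)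
    qed
    have "\<bar>\<Phi> y - \<Phi> x\<bar> \<le> integral {x..y} (\<lambda>t. \<bar>g t\<bar> * (M * (y - x)) + (m y - m x) * M)"
      unfolding eq
    proof (rule integral_norm_bound_integral[where 'a = real, unfolded real_norm_def])
      show "(\<lambda>t. (g t * G y + w x * G' t) - ?H t) integrable_on {x..y}"
        using integrable_diff[OF integrable_add[OF i1 i2] Hi'[OF xy(1,3)]] .
      show "(\<lambda>t. \<bar>g t\<bar> * (M * (y - x)) + (m y - m x) * M) integrable_on {x..y}"
        using gi xy by (intro integrable_add integrable_on_mult_left) auto
      fix t assume t: "t \<in> {x..y}"
      have "\<bar>(g t * G y + w x * G' t) - ?H t\<bar> = \<bar>g t * (G y - G t) + (w x - w t) * G' t\<bar>"
        by (simp add: algebra_simps)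
      also have "\<dots> \<le> \<bar>g t\<bar> * \<bar>G y - G t\<bar> + \<bar>w x - w t\<bar> * \<bar>G' t\<bar>"
        by (metis abs_mult abs_triangle_ineq)
      also have "\<dots> \<le> \<bar>g t\<bar> * (M * (y - x)) + (m y - m x) * M"
      proof (intro add_mono mult_mono)
        show "\<bar>G y - G t\<bar> \<le> M * (y - x)"
          using lip[of t y] mult_left_mono[of "y - t" "y - x" M] t xy \<open>0 \<le> M\<close> by auto
        show "0 \<le> m y - m x" using wt[OF t] by linarith
      qed (use M t sub wt in auto)
      finally show "\<bar>(g t * G y + w x * G' t) - ?H t\<bar> \<le> \<dots>" .
    qed
    also have "\<dots> = integral {x..y} (\<lambda>t. \<bar>g t\<bar> * (M * (y - x))) + integral {x..y} (\<lambda>t. (m y - m x) * M)"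
      by (rule Henstock_Kurzweil_Integration.integral_add) (use gi xy in \<open>auto intro!: integrable_on_mult_left\<close>)
    also have "integral {x..y} (\<lambda>t. \<bar>g t\<bar> * (M * (y - x))) = (m y - m x) * (M * (y - x))"
      using m[OF xy] by simp
    also have "integral {x..y} (\<lambda>t. (m y - m x) * M) = (y - x) * ((m y - m x) * M)"
      using xy by simp
    also have "(m y - m x) * (M * (y - x)) + (y - x) * ((m y - m x) * M) = 2 * M * (y - x) * (m y - m x)"
      by (simp add: algebra_simps)
    finally show "\<bar>\<Phi> y - \<Phi> x\<bar> \<le> 2 * M * (y - x) * (m y - m x)" .
  qed
  then show "integral {0..L} ?H = w L * G L - w 0 * G 0"
    by (simp add: \<Phi>_def)
qed

section \<open>Sobolev functions on the circle\<close>

text \<open>Square integrability on a bounded interval gives integrability, and then the Lebesgue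
  integrals of the definition are gauge integrals. The equality at the endpoints is the form in
  which periodicity enters the integrations by parts.\<close>

lemma has_L2_derivD:
  assumes d: "has_L2_deriv L f g" and L: "0 < L"
  shows "g absolutely_integrable_on {0..L}" "(\<lambda>z. (g z)\<^sup>2) absolutely_integrable_on {0..L}"
    and "\<And>x y. 0 \<le> x \<Longrightarrow> x \<le> y \<Longrightarrow> y \<le> L \<Longrightarrow> f y - f x = integral {x..y} g"
    and "f L = f 0" and "continuous_on {0..L} f"
    and "\<And>z. continuous_on {0..L} g \<Longrightarrow> z \<in> {0..L} \<Longrightarrow> (f has_real_derivative g z) (at z within {0..L})"
proof -
  have g: "g \<in> borel_measurable lebesgue" "(\<lambda>z. (g z)\<^sup>2) absolutely_integrable_on {0..L}"
    and f: "\<And>x. f (x + L) = f x"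
    and inc: "\<And>x y. x \<le> y \<Longrightarrow> f y - f x = set_lebesgue_integral lebesgue {x..y} g"
    using d by (auto simp: has_L2_deriv_def L2_per_def)
  show "(\<lambda>z. (g z)\<^sup>2) absolutely_integrable_on {0..L}" by fact
  show gi: "g absolutely_integrable_on {0..L}"
  proof (rule measurable_bounded_by_integrable_imp_absolutely_integrable)
    show "g \<in> borel_measurable (lebesgue_on {0..L})"
      using g(1) by (rule measurable_restrict_space1)
    show "(\<lambda>z. 1 + (g z)\<^sup>2) integrable_on {0..L}"
      using set_lebesgue_integral_eq_integral(1)[OF g(2)] by (intro integrable_add) auto
    \<comment> \<open>The integrable majorant comes from \<open>(|g| - 1)^2 >= 0\<close>.\<close>
    show "norm (g z) \<le> 1 + (g z)\<^sup>2" for z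
      using zero_le_power2[of "\<bar>g z\<bar> - 1"] by (simp add: power2_diff) 
  qed auto
  show inc': "f y - f x = integral {x..y} g" if "0 \<le> x" "x \<le> y" "y \<le> L" for x y
  proof -
    have "g absolutely_integrable_on {x..y}"
      using gi by (rule absolutely_integrable_on_subinterval) (use that in auto)
    then show ?thesis using inc[OF that(2)] set_lebesgue_integral_eq_integral(2) by metis
  qed
  show "f L = f 0" using f[of 0] by simp
  show "continuous_on {0..L} f"
    by (rule integral_by_parts_indefinite(1)[of L g f "\<lambda>_. 0" "\<lambda>_. 0"]) (use L gi inc' in auto)
  fix z assume gc: "continuous_on {0..L} g" and z: "z \<in> {0..L}"
  have "((\<lambda>x. f 0 + integral {0..x} g) has_real_derivative 0 + g z) (at z within {0..L})"
    by (intro DERIV_add DERIV_const integral_has_real_derivative gc z)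
  then show "(f has_real_derivative g z) (at z within {0..L})"
    by (rule has_field_derivative_transform_within[OF _ zero_less_one z, THEN DERIV_cong])
      (auto simp: inc'[of 0, symmetric])
qed

lemma per_integral_eq:
  "f absolutely_integrable_on {0..L} \<Longrightarrow> per_integral L f = integral {0..L} f"
  unfolding per_integral_def by (rule set_lebesgue_integral_eq_integral(2))

section \<open>Second derivatives and zero-mean antiderivatives of periodic functions\<close>

lemma continuous_periodic_L2:
  assumes "continuous_on UNIV f" "\<And>x. f (x + L) = f x"
  shows "f \<in> L2_per L"
proof -
  have "f \<in> borel_measurable lebesgue"
    by (intro measurable_completion) (use borel_measurable_continuous_onI[OF assms(1)] in simp)
  moreover have "set_integrable lebesgue {0..L} (\<lambda>x. (f x)\<^sup>2)"
    by (intro absolutely_integrable_continuous_real continuous_intros continuous_on_subset[OF assms(1)]) auto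
  ultimately show ?thesis using assms(2) by (simp add: L2_per_def)
qed

text \<open>The implication inside the choice made by \<open>L2_deriv\<close> forces a
  representative in \<open>H1_per\<close> whenever one exists. Hence the choice can be applied a
  second time and the iterated derivative is meaningful.\<close>

lemma L2_deriv_props:
  assumes "v \<in> H2_per L"
  shows "has_L2_deriv L v (L2_deriv L v)" and "has_L2_deriv L (L2_deriv L v) (L2_deriv L (L2_deriv L v))"
proof -
  have *: "has_L2_deriv L f (L2_deriv L f) \<and> (f \<in> H2_per L \<longrightarrow> L2_deriv L f \<in> H1_per L)"
    if "f \<in> H1_per L" for f
  proof -
    have "\<exists>g. has_L2_deriv L f g \<and> (f \<in> H2_per L \<longrightarrow> g \<in> H1_per L)"
      using that unfolding H1_per_def H2_per_def by blast
    then show ?thesis unfolding L2_deriv_def by (rule someI_ex)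
  qed
  have "v \<in> H1_per L" using assms unfolding H1_per_def H2_per_def by blast
  from *[OF this] assms have H1: "L2_deriv L v \<in> H1_per L"
    and "has_L2_deriv L v (L2_deriv L v)" by auto
  then show "has_L2_deriv L v (L2_deriv L v)" by blast
  from *[OF H1] show "has_L2_deriv L (L2_deriv L v) (L2_deriv L (L2_deriv L v))" by simp
qed

lemma periodic_representative:
  fixes g :: "real \<Rightarrow> real"
  assumes L: "0 < L" and per: "\<And>x. g (x + L) = g x"
  obtains n :: int where "0 \<le> x - of_int n * L" "x - of_int n * L \<le> L" "g x = g (x - of_int n * L)"
proof -
  define n where "n = \<lfloor>x / L\<rfloor>"
  interpret periodic_fun_simple g L by unfold_locales (rule per)
  have "of_int n \<le> x / L" "x / L < of_int n + 1" unfolding n_def by linarith+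
  then have "of_int n * L \<le> x" "x < (of_int n + 1) * L"
    using L by (simp_all only: pos_le_divide_eq pos_divide_less_eq)
  moreover have "g x = g (x - of_int n * L)" using minus_of_int by metis
  ultimately show ?thesis using that[of n] by (simp add: algebra_simps)
qed

text \<open>A periodic \<open>g\<close> that is continuous on one closed period is bounded on the
  whole line, so \<open>f\<close> is Lipschitz. Continuity on the whole line is what the
  construction of an antiderivative below starts from.\<close>

lemma L2_deriv_continuous_imp_continuous:
  assumes d: "has_L2_deriv L f g" and L: "0 < L" and g: "continuous_on {0..L} g"
  shows "continuous_on UNIV f"
proof -
  have gm: "g \<in> borel_measurable lebesgue" and per: "\<And>x. g (x + L) = g x"
    and inc: "\<And>x y. x \<le> y \<Longrightarrow> f y - f x = set_lebesgue_integral lebesgue {x..y} g"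
    using d by (auto simp: has_L2_deriv_def L2_per_def)
  have "bounded (g ` {0..L})" using g compact_continuous_image compact_imp_bounded by blast
  then obtain M where M: "\<And>x. x \<in> {0..L} \<Longrightarrow> \<bar>g x\<bar> \<le> M"
    unfolding bounded_iff by (metis image_eqI real_norm_def)
  have bd: "\<bar>g x\<bar> \<le> M" for x
    using periodic_representative[of L g x, OF L per] M by (metis atLeastAtMost_iff)
  have step: "\<bar>f y - f x\<bar> \<le> M * (y - x)" if "x \<le> y" for x y
  proof -
    have gi: "g absolutely_integrable_on {x..y}"
      by (rule measurable_bounded_by_integrable_imp_absolutely_integrable[where g = "\<lambda>_. M"])
        (use gm bd in \<open>auto intro: measurable_restrict_space1\<close>)
    have "f y - f x = integral {x..y} g"
      using inc[OF that] set_lebesgue_integral_eq_integral(2)[OF gi] by simp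
    also have "\<bar>\<dots>\<bar> \<le> integral {x..y} (\<lambda>_. M)"
      using gi bd set_lebesgue_integral_eq_integral(1)
      by (intro integral_norm_bound_integral[where 'a = real, unfolded real_norm_def]) auto
    finally show ?thesis using that by (simp add: mult.commute)
  qed
  have "dist (f x) (f y) \<le> M * dist x y" for x y
    using step[of x y] step[of y x] by (cases "x \<le> y") (auto simp: dist_real_def abs_minus_commute)
  then have "M-lipschitz_on UNIV f"
    using bd[of 0] by (intro lipschitz_onI) auto
  then show ?thesis by (rule lipschitz_on_continuous_on)
qed

text \<open>A definite description requires existence and uniqueness. A primitive of
  \<open>v\<close> is periodic because \<open>v\<close> has zero mean; two primitives differ by a
  constant, and the zero mean fixes that constant.\<close>

lemma zero_mean_antideriv_deriv:
  assumes L: "0 < L" and v: "continuous_on UNIV v" "v \<in> L2_per L" and mean: "per_integral L v = 0"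
  shows "has_L2_deriv L (zero_mean_antideriv L v) v"
proof -
  have vper: "v (x + L) = v x" for x using v(2) by (simp add: L2_per_def)
  have vi: "v absolutely_integrable_on {x..y}" for x y
    by (intro absolutely_integrable_continuous_real continuous_on_subset[OF v(1)]) auto
  obtain F where F: "\<And>x. (F has_real_derivative v x) (at x)"
  proof -
    have "\<exists>F. \<forall>x::real. - \<infinity> < ereal x \<longrightarrow> ereal x < \<infinity> \<longrightarrow> (F has_vector_derivative v x) (at x)"
      by (rule einterval_antiderivative) (use v(1) in \<open>auto simp: continuous_on_eq_continuous_at\<close>)
    then show ?thesis using that by (auto simp: has_real_derivative_iff_has_vector_derivative)
  qed
  have Finc: "F y - F x = set_lebesgue_integral lebesgue {x..y} v" if "x \<le> y" for x y
  proof -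
    have "(v has_integral F y - F x) {x..y}"
      by (rule fundamental_theorem_of_calculus[OF that])
        (use F in \<open>auto simp: has_real_derivative_iff_has_vector_derivative[symmetric]
          intro: has_field_derivative_at_within\<close>)
    then show ?thesis using set_lebesgue_integral_eq_integral(2)[OF vi] by (simp add: integral_unique)
  qed
  have Fper: "F (x + L) = F x" for x
  proof -
    have "((\<lambda>x. F (x + L) - F x) has_real_derivative 0) (at x)" for x
      using DERIV_diff[OF F[of "x + L", unfolded DERIV_shift] F[of x]] vper by simp
    then have "F (x + L) - F x = F (0 + L) - F 0"
      using DERIV_isconst_all[of "\<lambda>x. F (x + L) - F x" x 0] by blast
    also have "\<dots> = 0" using Finc[of 0 L] L mean by (simp add: per_integral_def)
    finally show ?thesis by simp
  qed
  have Fc: "continuous_on UNIV F"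
    using F by (meson DERIV_isCont continuous_at_imp_continuous_on)
  define c where "c = per_integral L F / L"
  define w where "w x = F x - c" for x
  have wm: "per_integral L (\<lambda>x. F x - d) = per_integral L F - d * L" for d
  proof -
    have "F absolutely_integrable_on {0..L}" "(\<lambda>x. F x - d) absolutely_integrable_on {0..L}"
      by (intro absolutely_integrable_continuous_real continuous_intros continuous_on_subset[OF Fc]; simp)+
    moreover have "integral {0..L} (\<lambda>x. F x - d) = integral {0..L} F - d * L"
      using calculation(1) set_lebesgue_integral_eq_integral(1) L
      by (subst Henstock_Kurzweil_Integration.integral_diff) auto
    ultimately show ?thesis by (simp add: per_integral_eq)
  qed
  have "has_L2_deriv L w v \<and> per_integral L w = 0"
  proof -
    have "w \<in> L2_per L"
      unfolding w_def using Fper by (intro continuous_periodic_L2 continuous_intros Fc) auto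
    then show ?thesis
      using v(2) Finc L wm[of c] by (simp add: has_L2_deriv_def w_def[abs_def]) (simp add: c_def)
  qed
  moreover have "w' = w" if "has_L2_deriv L w' v \<and> per_integral L w' = 0" for w'
  proof -
    have inc: "w' y - w' x = F y - F x" if "x \<le> y" for x y
      using \<open>has_L2_deriv L w' v \<and> per_integral L w' = 0\<close> that Finc by (simp add: has_L2_deriv_def)
    define d where "d = F 0 - w' 0"
    have eq: "w' x = F x - d" for x
      using inc[of 0 x] inc[of x 0] by (cases "0 \<le> x") (auto simp: d_def)
    have w': "w' = (\<lambda>x. F x - d)" by (rule ext) (rule eq)
    have "per_integral L w' = per_integral L F - d * L" unfolding w' by (rule wm)
    then have "d = c" using that L by (simp add: c_def field_simps)
    then show ?thesis using w' by (simp add: w_def[abs_def])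
  qed
  ultimately have "\<exists>!w. has_L2_deriv L w v \<and> per_integral L w = 0" by blast
  from theI'[OF this] show ?thesis by (simp add: zero_mean_antideriv_def)
qed

section \<open>Pointwise identities and inequalities\<close>

text \<open>
  Here \<open>k\<close> and \<open>l\<close> stand for \<open>h'\<close> and \<open>h''\<close>, \<open>g\<close> for \<open>\<gamma>\<close>, and \<open>fp\<close>, \<open>dT\<close>, \<open>dp\<close>, \<open>dq\<close>, \<open>dr\<close>
  for the derivatives of \<open>f\<close>, \<open>T\<close>, \<open>p\<close>, \<open>q\<close>, \<open>r\<close>: the last two lines are the derivative of
  \<open>2 h\<^sup>2 T f + p W\<^sup>2 + q W v + r v\<^sup>2\<close>.
\<close>

lemma hessian_identity:
  fixes h k g W v v1 v2 l f fp J T dT p q r dp dq dr :: real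
  assumes h: "h \<noteq> 0"
    and l: "l * h = g - h - k\<^sup>2"
    and f: "f = h * v1 + k * v + W"
    and fp: "fp = h * v2 + 2 * k * v1 + (1 + l) * v"
    and J: "J = h^3 + 3 * (g - h) * h\<^sup>2 - 3 * k\<^sup>2 * h\<^sup>2"
    and T: "T = 2 * k * W + (3 * k\<^sup>2 - g) * v"
    and dT: "dT = 2 * l * W + 2 * k * v + 6 * k * l * v + (3 * k\<^sup>2 - g) * v1"
    and dp: "dp = l * (2 * g * h - 4 * h\<^sup>2) + k * (2 * g * k - 8 * h * k)"
    and p: "p = k * (2 * g * h - 4 * h\<^sup>2)"
    and q: "q = - h * (6 * h * (k\<^sup>2 + g - h) + 2 * h\<^sup>2 - 2 * g\<^sup>2)"
    and dq: "dq = - k * (6 * h * (k\<^sup>2 + g - h) + 2 * h\<^sup>2 - 2 * g\<^sup>2)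
       - h * (6 * k * (k\<^sup>2 + g - h) + 6 * h * (2 * k * l - k) + 4 * h * k)"
    and r: "r = k * h\<^sup>2 * (h - 3 * (k\<^sup>2 + g - h))"
    and dr: "dr = l * h\<^sup>2 * (h - 3 * (k\<^sup>2 + g - h)) + k * (2 * h * k) * (h - 3 * (k\<^sup>2 + g - h))
        + k * h\<^sup>2 * (k - 3 * (2 * k * l - k))"
  shows "h^5 * v2\<^sup>2 - J * v\<^sup>2 = 
      h * (h * fp - 2 * k * f)\<^sup>2 + 2 * h * (g - 3 * k\<^sup>2) * f\<^sup>2 - 2 * g\<^sup>2 * W * f + 2 * h * ((g - h) * v + k * W)\<^sup>2
    + 2 * (fp * (h\<^sup>2 * T) + f * (2 * h * k * T + h\<^sup>2 * dT))
    + (dp * W\<^sup>2 + 2 * p * W * v + dq * W * v + q * v\<^sup>2 + q * W * v1 + dr * v\<^sup>2 + 2 * r * v * v1)"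
proof -
  \<comment> \<open>Once \<open>l\<close>, \<open>v1\<close> and \<open>v2\<close> are solved for,
    both sides are rational in \<open>h\<close>, \<open>k\<close>, \<open>g\<close>,
    \<open>W\<close>, \<open>v\<close>, \<open>f\<close>, \<open>fp\<close>; clearing powers of
    \<open>h\<close> leaves a polynomial identity.\<close>
  have l': "l = (g - h - k\<^sup>2) / h" using h l by (simp add: field_simps)
  have v1: "v1 = (f - k * v - W) / h" using h f by (simp add: field_simps)
  have v2: "v2 = (fp - 2 * k * v1 - (1 + l) * v) / h" using h fp by (simp add: field_simps)
  show ?thesis
    unfolding p q dq r dr dp dT T J v2 v1 l' using h
    by (simp add: divide_simps) algebra
qed

text \<open>
  The two lines added to the lower bound are the derivatives of \<open>s cos z b f\<close> and
  \<open>s\<^sup>2/8 sin 2z b\<^sup>2\<close> for \<open>b' = \<phi> f\<close>; they integrate to zero. The second one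
  replaces \<open>sin\<^sup>2 z b\<^sup>2\<close> by its mean.
\<close>

lemma oscillation_square:
  fixes a K \<alpha> \<beta> \<kappa> \<nu> \<mu> \<epsilon> \<phi> f fp b z :: real
  defines "s \<equiv> - (2 * \<epsilon> / 3)"
  assumes a: "0 < a" "a \<le> 1" and K: "0 \<le> K" "8 * (2 * K + 6) * a \<le> 1"
    and \<alpha>: "\<bar>\<alpha> - 1/2\<bar> \<le> K * a" and \<beta>: "\<bar>\<beta>\<bar> \<le> K * a" and \<kappa>: "\<bar>\<kappa> - 1\<bar> \<le> K * a"
    and \<nu>: "\<bar>\<nu> - a\<^sup>2\<bar> \<le> K * a^3" and \<mu>: "\<bar>\<mu> - 2 * \<epsilon> * sin z\<bar> \<le> K * a\<^sup>2"
    and \<epsilon>: "\<bar>\<epsilon>\<bar> \<le> 2 * a" and \<phi>: "\<bar>\<phi>\<bar> \<le> 2"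
    and gap: "3/4 * s\<^sup>2 + (17 * (2 * K + 6) + 1) * a^3 \<le> a\<^sup>2"
  shows "a^3 / 64 * (fp\<^sup>2 + f\<^sup>2 + b\<^sup>2)
      + (s * cos z * b * fp + s * (cos z * (\<phi> * f) - sin z * b) * f)
      + s\<^sup>2 / 8 * (2 * cos (2 * z) * b\<^sup>2 + 2 * sin (2 * z) * b * (\<phi> * f))
     \<le> \<alpha> * fp\<^sup>2 + \<beta> * fp * f + \<kappa> * f\<^sup>2 + \<nu> * b\<^sup>2 + \<mu> * b * f"
proof -
  \<comment> \<open>\<open>K1\<close> dominates the accumulated coefficients of the errors
    \<open>e1\<close> to \<open>e7\<close>; the largest total is \<open>2 * K + 5\<close>, on
    \<open>a * f^2\<close>.\<close>
  define K1 where "K1 = 2 * K + 6"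
  define A where "A = fp - s * cos z * b"
  define B where "B = f - s * sin z * b"
  have s: "\<bar>s\<bar> \<le> 2 * a" using \<epsilon> unfolding s_def by linarith
  have s2: "s\<^sup>2 \<le> 4 * a\<^sup>2" using power_mono[OF s, of 2] by (simp add: power_mult_distrib)
  \<comment> \<open>The value of \<open>s\<close> makes the cross terms agree: \<open>B^2\<close>
    supplies \<open>- 2 * s * sin z * b * f\<close> and the first exact derivative supplies
    \<open>- s * sin z * b * f\<close>, together \<open>2 * \<epsilon> * sin z * b * f\<close>. The
    factor \<open>3/4\<close> is the mean of \<open>sin^2 + cos^2 / 2\<close>.\<close>
  have sq: "1/2 * fp\<^sup>2 + f\<^sup>2 + 2 * \<epsilon> * sin z * b * f
     = 1/2 * A\<^sup>2 + B\<^sup>2 - 3/4 * s\<^sup>2 * b\<^sup>2 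
      + (s * cos z * b * fp + s * (cos z * (\<phi> * f) - sin z * b) * f)
      + s\<^sup>2 / 8 * (2 * cos (2 * z) * b\<^sup>2 + 2 * sin (2 * z) * b * (\<phi> * f))
      - s * cos z * \<phi> * f\<^sup>2 - 1/4 * s\<^sup>2 * sin (2 * z) * \<phi> * b * f"
  proof -
    have e: "\<epsilon> = - (3 * s / 2)" by (simp add: s_def)
    have c2: "(cos z)\<^sup>2 = 1 - (sin z)\<^sup>2" by (simp add: cos_squared_eq)
    have c3: "cos (2 * z) = 1 - 2 * (sin z)\<^sup>2" by (simp add: cos_double_sin)
    have "A\<^sup>2 = fp\<^sup>2 - 2 * s * cos z * b * fp + s\<^sup>2 * b\<^sup>2 * (cos z)\<^sup>2"
      unfolding A_def by (simp add: algebra_simps power2_eq_square)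
    then show ?thesis unfolding e B_def c3 c2 by (simp add: algebra_simps power2_eq_square)
  qed
  \<comment> \<open>Young's inequality is weighted so that a cross term of size \<open>a^2\<close>
    costs only \<open>a\<close> on \<open>f^2\<close>, where the form has order 1, and
    \<open>a^3\<close> on \<open>b^2\<close>, where the margin has that order.\<close>
  have bf: "a\<^sup>2 * \<bar>b * f\<bar> \<le> 1/2 * (a * f\<^sup>2 + a^3 * b\<^sup>2)"
  proof -
    have "0 \<le> a * (\<bar>f\<bar> - a * \<bar>b\<bar>)\<^sup>2" using a by simp
    also have "\<dots> = a * f\<^sup>2 + a^3 * b\<^sup>2 - 2 * (a\<^sup>2 * \<bar>b * f\<bar>)"
      by (simp add: power2_diff power_mult_distrib abs_mult) (simp add: algebra_simps power2_eq_square power3_eq_cube)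
    finally show ?thesis by simp
  qed
  have ff: "\<bar>fp * f\<bar> \<le> 1/2 * (fp\<^sup>2 + f\<^sup>2)"
  proof -
    have "0 \<le> (\<bar>fp\<bar> - \<bar>f\<bar>)\<^sup>2" by simp
    then show ?thesis by (simp add: power2_diff abs_mult)
  qed
  have e1: "(\<alpha> - 1/2) * fp\<^sup>2 \<ge> - (K * a) * fp\<^sup>2" 
    by (rule mult_right_mono) (use \<alpha> in auto)
  have e2: "\<beta> * fp * f \<ge> - (K * a) * (1/2 * (fp\<^sup>2 + f\<^sup>2))"
  proof -
    have "\<bar>\<beta> * (fp * f)\<bar> \<le> (K * a) * (1/2 * (fp\<^sup>2 + f\<^sup>2))"
      unfolding abs_mult[of \<beta>] using \<beta> ff K a by (intro mult_mono) auto
    then show ?thesis by (simp add: mult.assoc)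
  qed
  have e3: "(\<kappa> - 1) * f\<^sup>2 \<ge> - (K * a) * f\<^sup>2" 
    by (rule mult_right_mono) (use \<kappa> in auto)
  have e4: "(\<nu> - a\<^sup>2) * b\<^sup>2 \<ge> - (K * a^3) * b\<^sup>2" 
    by (rule mult_right_mono) (use \<nu> in auto)
  have e5: "(\<mu> - 2 * \<epsilon> * sin z) * b * f \<ge> - K * (1/2 * (a * f\<^sup>2 + a^3 * b\<^sup>2))"
  proof -
    have "\<bar>(\<mu> - 2 * \<epsilon> * sin z) * (b * f)\<bar> \<le> (K * a\<^sup>2) * \<bar>b * f\<bar>"
      unfolding abs_mult[of "\<mu> - 2 * \<epsilon> * sin z"] using \<mu> by (intro mult_right_mono) auto
    also have "\<dots> \<le> K * (1/2 * (a * f\<^sup>2 + a^3 * b\<^sup>2))"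
      using mult_left_mono[OF bf K(1)] by (simp add: mult.assoc)
    finally show ?thesis by (simp add: mult.assoc)
  qed
  have e6: "- (s * cos z * \<phi>) * f\<^sup>2 \<ge> - (4 * a) * f\<^sup>2"
  proof (rule mult_right_mono)
    have "\<bar>s * cos z * \<phi>\<bar> \<le> (2 * a) * 1 * 2"
      unfolding abs_mult using s \<phi> a by (intro mult_mono) auto
    then show "- (4 * a) \<le> - (s * cos z * \<phi>)" by simp
  qed simp
  have e7: "- 1/4 * s\<^sup>2 * sin (2 * z) * \<phi> * b * f \<ge> - 2 * (1/2 * (a * f\<^sup>2 + a^3 * b\<^sup>2))"
  proof -
    have "\<bar>1/4 * s\<^sup>2 * sin (2 * z) * \<phi> * (b * f)\<bar> \<le> 1/4 * (4 * a\<^sup>2) * 1 * 2 * \<bar>b * f\<bar>"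
      unfolding abs_mult using s2 \<phi> by (intro mult_mono) auto
    also have "\<dots> \<le> 2 * (1/2 * (a * f\<^sup>2 + a^3 * b\<^sup>2))" using bf by simp
    finally have "1/4 * s\<^sup>2 * sin (2 * z) * \<phi> * (b * f) \<le> 2 * (1/2 * (a * f\<^sup>2 + a^3 * b\<^sup>2))"
      by linarith
    then show ?thesis by (simp add: algebra_simps)
  qed
  have n: "0 \<le> a * fp\<^sup>2" "0 \<le> a * f\<^sup>2" "0 \<le> a^3 * b\<^sup>2" using a by auto
  have Kn: "0 \<le> K * (a * fp\<^sup>2)" "0 \<le> K * (a * f\<^sup>2)" "0 \<le> K * (a^3 * b\<^sup>2)" using n K by auto
  \<comment> \<open>Errors measured in \<open>fp\<close> and \<open>f\<close> are returned to the
    completed squares; the shift by \<open>s * b\<close> costs a multiple of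
    \<open>a^2 * b^2\<close>.\<close>
  have fpA: "fp\<^sup>2 + f\<^sup>2 \<le> 2 * (A\<^sup>2 + B\<^sup>2) + 8 * a\<^sup>2 * b\<^sup>2"
  proof -
    have "fp\<^sup>2 + f\<^sup>2 = (A + s * cos z * b)\<^sup>2 + (B + s * sin z * b)\<^sup>2"
      by (simp add: A_def B_def)
    also have "\<dots> \<le> 2 * A\<^sup>2 + 2 * (s * cos z * b)\<^sup>2 + (2 * B\<^sup>2 + 2 * (s * sin z * b)\<^sup>2)"
      by (intro add_mono) (smt (verit) sum_squares_bound power2_sum)+
    also have "\<dots> = 2 * (A\<^sup>2 + B\<^sup>2) + 2 * s\<^sup>2 * b\<^sup>2"
      by (simp add: power_mult_distrib cos_squared_eq algebra_simps)
    also have "\<dots> \<le> 2 * (A\<^sup>2 + B\<^sup>2) + 8 * a\<^sup>2 * b\<^sup>2"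
      using mult_right_mono[OF s2, of "b\<^sup>2"] by (simp add: algebra_simps)
    finally show ?thesis .
  qed
  have ab: "a\<^sup>2 * b\<^sup>2 * a = a^3 * b\<^sup>2" by (simp add: power2_eq_square power3_eq_cube)
  let ?total = "(s * cos z * b * fp + s * (cos z * (\<phi> * f) - sin z * b) * f)
      + s\<^sup>2 / 8 * (2 * cos (2 * z) * b\<^sup>2 + 2 * sin (2 * z) * b * (\<phi> * f))"
  have "\<alpha> * fp\<^sup>2 + \<beta> * fp * f + \<kappa> * f\<^sup>2 + \<nu> * b\<^sup>2 + \<mu> * b * f - ?total
     = 1/2 * A\<^sup>2 + B\<^sup>2 + (a\<^sup>2 - 3/4 * s\<^sup>2) * b\<^sup>2 + (\<alpha> - 1/2) * fp\<^sup>2 + \<beta> * fp * f + (\<kappa> - 1) * f\<^sup>2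
      + (\<nu> - a\<^sup>2) * b\<^sup>2 + (\<mu> - 2 * \<epsilon> * sin z) * b * f - (s * cos z * \<phi>) * f\<^sup>2
      - 1/4 * s\<^sup>2 * sin (2 * z) * \<phi> * b * f"
    using sq by (simp add: algebra_simps)
  also have "\<dots> \<ge> 1/2 * A\<^sup>2 + B\<^sup>2 + (a\<^sup>2 - 3/4 * s\<^sup>2) * b\<^sup>2 - K1 * (a * (fp\<^sup>2 + f\<^sup>2)) - K1 * (a^3 * b\<^sup>2)"
    using e1 e2 e3 e4 e5 e6 e7 n Kn unfolding K1_def by (simp add: algebra_simps)
  finally have 1: "\<alpha> * fp\<^sup>2 + \<beta> * fp * f + \<kappa> * f\<^sup>2 + \<nu> * b\<^sup>2 + \<mu> * b * f - ?total
     \<ge> 1/2 * A\<^sup>2 + B\<^sup>2 + (a\<^sup>2 - 3/4 * s\<^sup>2) * b\<^sup>2 - K1 * (a * (fp\<^sup>2 + f\<^sup>2)) - K1 * (a^3 * b\<^sup>2)" .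
  have "K1 * a * (fp\<^sup>2 + f\<^sup>2) \<le> K1 * a * (2 * (A\<^sup>2 + B\<^sup>2) + 8 * a\<^sup>2 * b\<^sup>2)"
    using fpA K a by (intro mult_left_mono) (auto simp: K1_def)
  then have 2: "K1 * (a * (fp\<^sup>2 + f\<^sup>2)) \<le> 2 * (K1 * a) * (A\<^sup>2 + B\<^sup>2) + 8 * K1 * (a^3 * b\<^sup>2)"
    using ab by (simp add: algebra_simps power2_eq_square power3_eq_cube)
  \<comment> \<open>This is the smallness assumption on \<open>a\<close>, that is
    \<open>8 * K1 * a <= 1\<close>.\<close>
  have 3: "2 * (K1 * a) * (A\<^sup>2 + B\<^sup>2) \<le> 1/4 * (A\<^sup>2 + B\<^sup>2)"
    using K by (intro mult_right_mono) (auto simp: K1_def algebra_simps)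
  have 4: "(17 * K1 + 1) * (a^3 * b\<^sup>2) \<le> (a\<^sup>2 - 3/4 * s\<^sup>2) * b\<^sup>2"
    using gap mult_right_mono[of "(17 * K1 + 1) * a^3" "a\<^sup>2 - 3/4 * s\<^sup>2" "b\<^sup>2"] by (simp add: K1_def)
  have K1: "0 \<le> K1 * (a^3 * b\<^sup>2)" using n K by (simp add: K1_def)
  have 5: "1/2 * A\<^sup>2 + B\<^sup>2 + (a\<^sup>2 - 3/4 * s\<^sup>2) * b\<^sup>2 - K1 * (a * (fp\<^sup>2 + f\<^sup>2)) - K1 * (a^3 * b\<^sup>2)
      \<ge> 1/4 * (A\<^sup>2 + B\<^sup>2) + a^3 * b\<^sup>2"
  proof -
    \<comment> \<open>The errors consume one multiple of \<open>X = K1 * a^3 * b^2\<close> directly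
      and eight more through \<open>fpA\<close>. The 17 multiples reserved in \<open>gap\<close>
      cover these, and one \<open>a^3 * b^2\<close> is kept for the conclusion.\<close>
    have lin: "1/4 * N + Y \<le> 1/2 * A\<^sup>2 + B\<^sup>2 + G - P - X"
      if "P \<le> R + 8 * X" "R \<le> 1/4 * N" "17 * X + Y \<le> G" "0 \<le> X" "N = A\<^sup>2 + B\<^sup>2" for N P R X Y G
      using that zero_le_power2[of A] zero_le_power2[of B] by linarith
    have "(17 * K1 + 1) * (a^3 * b\<^sup>2) = 17 * (K1 * (a^3 * b\<^sup>2)) + a^3 * b\<^sup>2"
      by (simp add: algebra_simps)
    then show ?thesis
      using 2 3 4 K1 by (intro lin[OF _ 3]) (auto simp: mult.assoc)
  qed
  have a3: "a^3 \<le> a" "a^3 \<le> 1" using a by (auto simp: power_le_one power3_eq_cube mult_le_one)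
  have "a^3 / 64 * (fp\<^sup>2 + f\<^sup>2) \<le> a / 64 * (2 * (A\<^sup>2 + B\<^sup>2) + 8 * a\<^sup>2 * b\<^sup>2)"
    by (rule mult_mono) (use a3 fpA a in auto)
  then have "a^3 / 64 * (fp\<^sup>2 + f\<^sup>2 + b\<^sup>2)
      \<le> a / 64 * (2 * (A\<^sup>2 + B\<^sup>2) + 8 * a\<^sup>2 * b\<^sup>2) + a^3 / 64 * b\<^sup>2"
    by (simp add: distrib_left)
  also have "\<dots> = a / 32 * (A\<^sup>2 + B\<^sup>2) + 9/64 * (a^3 * b\<^sup>2)"
    by (simp add: algebra_simps power2_eq_square power3_eq_cube)
  also have "\<dots> \<le> 1/4 * (A\<^sup>2 + B\<^sup>2) + a^3 * b\<^sup>2"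
    using a n(3) by (intro add_mono mult_right_mono) auto
  finally have "a^3 / 64 * (fp\<^sup>2 + f\<^sup>2 + b\<^sup>2) \<le> 1/4 * (A\<^sup>2 + B\<^sup>2) + a^3 * b\<^sup>2" .
  from order_trans[OF this order_trans[OF 5 1]] show ?thesis
    by (simp only: le_diff_eq add.assoc)
qed

section \<open>Uniform asymptotics in the amplitude\<close>

text \<open>Uniform in \<open>z\<close> and in the speeds \<open>c\<close> with \<open>\<bar>c - 1/2\<bar> \<le> a\<close>, a range that contains \<open>(c\<^sub>-, c\<^sub>+)\<close>.\<close>

definition unif_bigo :: "nat \<Rightarrow> (real \<Rightarrow> real \<Rightarrow> real \<Rightarrow> real) \<Rightarrow> bool" where
  "unif_bigo n F \<longleftrightarrow>
     (\<exists>K. \<forall>\<^sub>F a in at_right 0. \<forall>c z. \<bar>c - 1/2\<bar> \<le> a \<longrightarrow> \<bar>F a c z\<bar> \<le> K * a ^ n)"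

lemma unif_bigoI:
  assumes "\<forall>\<^sub>F a in at_right 0. \<forall>c z. \<bar>c - 1/2\<bar> \<le> a \<longrightarrow> \<bar>F a c z\<bar> \<le> K * a ^ n"
  shows "unif_bigo n F"
  using assms unfolding unif_bigo_def by blast

lemma eventually_small: "\<forall>\<^sub>F a::real in at_right 0. 0 < a \<and> a \<le> 1"
  unfolding eventually_at_right_field by (intro exI[of _ 1]) auto

text \<open>A nonnegative constant and \<open>0 < a <= 1\<close> are built into the elimination
  rule, since multiplying bounds and lowering exponents both rely on monotonicity.\<close>

lemma unif_bigoE:
  assumes "unif_bigo n F"
  obtains K where "0 \<le> K"
    "\<forall>\<^sub>F a in at_right 0. 0 < a \<and> a \<le> 1 \<and> (\<forall>c z. \<bar>c - 1/2\<bar> \<le> a \<longrightarrow> \<bar>F a c z\<bar> \<le> K * a ^ n)"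
proof -
  obtain K where K: "\<forall>\<^sub>F a in at_right 0. \<forall>c z. \<bar>c - 1/2\<bar> \<le> a \<longrightarrow> \<bar>F a c z\<bar> \<le> K * a ^ n"
    using assms unfolding unif_bigo_def by blast
  have "\<forall>\<^sub>F a in at_right 0. 0 < a \<and> a \<le> 1 \<and>
      (\<forall>c z. \<bar>c - 1/2\<bar> \<le> a \<longrightarrow> \<bar>F a c z\<bar> \<le> \<bar>K\<bar> * a ^ n)"
    using K eventually_small
  proof eventually_elim
    case (elim a)
    have "K * a ^ n \<le> \<bar>K\<bar> * a ^ n" using elim(2) by (intro mult_right_mono) auto
    then show ?case using elim by (meson order_trans)
  qed
  then show ?thesis using that[of "\<bar>K\<bar>"] by simp
qed

lemma unif_bigo_const: "unif_bigo 0 (\<lambda>a c z. x)"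
  by (rule unif_bigoI[where K = "\<bar>x\<bar>"]) simp

lemma unif_bigo_bounded: "(\<And>z. \<bar>g z\<bar> \<le> K) \<Longrightarrow> unif_bigo 0 (\<lambda>a c z. g z)"
  by (rule unif_bigoI[where K = K]) simp

lemma unif_bigo_power: "unif_bigo n (\<lambda>a c z. a ^ n)"
  using eventually_small by (intro unif_bigoI[where K = 1]) (auto elim!: eventually_mono)

lemma unif_bigo_amplitude: "unif_bigo 1 (\<lambda>a c z. a)"
  using unif_bigo_power[of 1] by simp

lemma unif_bigo_speed: "unif_bigo 1 (\<lambda>a c z. c - 1/2)"
  by (rule unif_bigoI[where K = 1]) simp

lemma unif_bigo_mono:
  assumes "unif_bigo m F" "n \<le> m" shows "unif_bigo n F"
proof -
  obtain K where K: "0 \<le> K" and *: "\<forall>\<^sub>F a in at_right 0. 0 < a \<and> a \<le> 1 \<and>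
      (\<forall>c z. \<bar>c - 1/2\<bar> \<le> a \<longrightarrow> \<bar>F a c z\<bar> \<le> K * a ^ m)"
    using assms(1) by (rule unif_bigoE)
  show ?thesis
    using *
  proof (intro unif_bigoI[where K = K], eventually_elim)
    case (elim a)
    have "K * a ^ m \<le> K * a ^ n"
      using elim assms(2) K by (intro mult_left_mono power_decreasing) auto
    then show ?case using elim by (meson order_trans)
  qed
qed

lemma unif_bigo_add:
  assumes "unif_bigo n F" "unif_bigo n G" shows "unif_bigo n (\<lambda>a c z. F a c z + G a c z)"
proof -
  obtain K where *: "\<forall>\<^sub>F a in at_right 0. 0 < a \<and> a \<le> 1 \<and>
      (\<forall>c z. \<bar>c - 1/2\<bar> \<le> a \<longrightarrow> \<bar>F a c z\<bar> \<le> K * a ^ n)"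
    using assms(1) by (rule unif_bigoE)
  obtain K' where **: "\<forall>\<^sub>F a in at_right 0. 0 < a \<and> a \<le> 1 \<and>
      (\<forall>c z. \<bar>c - 1/2\<bar> \<le> a \<longrightarrow> \<bar>G a c z\<bar> \<le> K' * a ^ n)"
    using assms(2) by (rule unif_bigoE)
  show ?thesis
    using * **
  proof (intro unif_bigoI[where K = "K + K'"], eventually_elim)
    case (elim a)
    show ?case
    proof (intro allI impI)
      fix c z :: real assume "\<bar>c - 1/2\<bar> \<le> a"
      then have "\<bar>F a c z\<bar> \<le> K * a ^ n" "\<bar>G a c z\<bar> \<le> K' * a ^ n" using elim by blast+
      then show "\<bar>F a c z + G a c z\<bar> \<le> (K + K') * a ^ n" by (simp add: distrib_right)
    qed
  qed
qed

lemma unif_bigo_mult: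
  assumes "unif_bigo n F" "unif_bigo m G" shows "unif_bigo (n + m) (\<lambda>a c z. F a c z * G a c z)"
proof -
  obtain K where K: "0 \<le> K" and *: "\<forall>\<^sub>F a in at_right 0. 0 < a \<and> a \<le> 1 \<and>
      (\<forall>c z. \<bar>c - 1/2\<bar> \<le> a \<longrightarrow> \<bar>F a c z\<bar> \<le> K * a ^ n)"
    using assms(1) by (rule unif_bigoE)
  obtain K' where **: "\<forall>\<^sub>F a in at_right 0. 0 < a \<and> a \<le> 1 \<and>
      (\<forall>c z. \<bar>c - 1/2\<bar> \<le> a \<longrightarrow> \<bar>G a c z\<bar> \<le> K' * a ^ m)"
    using assms(2) by (rule unif_bigoE)
  show ?thesis
    using * **
  proof (intro unif_bigoI[where K = "K * K'"], eventually_elim)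
    case (elim a)
    show ?case
    proof (intro allI impI)
      fix c z :: real assume "\<bar>c - 1/2\<bar> \<le> a"
      then have "\<bar>F a c z\<bar> \<le> K * a ^ n" "\<bar>G a c z\<bar> \<le> K' * a ^ m" using elim by blast+
      then have "\<bar>F a c z\<bar> * \<bar>G a c z\<bar> \<le> (K * a ^ n) * (K' * a ^ m)"
        using K elim by (intro mult_mono) auto
      then show "\<bar>F a c z * G a c z\<bar> \<le> K * K' * a ^ (n + m)"
        by (simp add: abs_mult power_add mult_ac)
    qed
  qed
qed

lemma unif_bigo_bounded_mult:
  assumes "unif_bigo 0 F" "unif_bigo n G" shows "unif_bigo n (\<lambda>a c z. F a c z * G a c z)"
  using unif_bigo_mult[OF assms] by simp

lemma unif_bigo_cmult: "unif_bigo n G \<Longrightarrow> unif_bigo n (\<lambda>a c z. x * G a c z)"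
  by (rule unif_bigo_bounded_mult[OF unif_bigo_const])

lemma unif_bigo_minus: "unif_bigo n G \<Longrightarrow> unif_bigo n (\<lambda>a c z. - G a c z)"
  unfolding unif_bigo_def by simp

lemma unif_bigo_diff:
  assumes "unif_bigo n F" "unif_bigo n G" shows "unif_bigo n (\<lambda>a c z. F a c z - G a c z)"
  using unif_bigo_add[OF assms(1) unif_bigo_minus[OF assms(2)]] by simp

lemma unif_bigo_div_amplitude:
  assumes "unif_bigo (Suc n) F" shows "unif_bigo n (\<lambda>a c z. F a c z / a)"
proof -
  obtain K where *: "\<forall>\<^sub>F a in at_right 0. 0 < a \<and> a \<le> 1 \<and>
      (\<forall>c z. \<bar>c - 1/2\<bar> \<le> a \<longrightarrow> \<bar>F a c z\<bar> \<le> K * a ^ Suc n)"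
    using assms(1) by (rule unif_bigoE)
  show ?thesis
    using * by (intro unif_bigoI[where K = K]) (auto elim!: eventually_mono simp: field_simps)
qed

lemma unif_bigo_diff_imp:
  assumes "unif_bigo n (\<lambda>a c z. F a c z - G a c z)" "unif_bigo n G"
  shows "unif_bigo n F"
  using unif_bigo_add[OF assms] by simp

text \<open>\<open>F G - F' G' = F (G - G') + G' (F - F')\<close>, where \<open>F\<close> is bounded
  because it is close to the bounded \<open>F'\<close>.\<close>

lemma unif_bigo_mult_close:
  assumes "unif_bigo n (\<lambda>a c z. F a c z - F' a c z)" "unif_bigo n (\<lambda>a c z. G a c z - G' a c z)"
    "unif_bigo 0 F'" "unif_bigo 0 G'"
  shows "unif_bigo n (\<lambda>a c z. F a c z * G a c z - F' a c z * G' a c z)"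
proof -
  have "unif_bigo 0 F"
    by (rule unif_bigo_diff_imp[OF unif_bigo_mono[OF assms(1)] assms(3)]) simp
  then have "unif_bigo n (\<lambda>a c z. F a c z * (G a c z - G' a c z) + G' a c z * (F a c z - F' a c z))"
    using assms by (intro unif_bigo_add unif_bigo_bounded_mult)
  then show ?thesis by (simp add: algebra_simps)
qed

text \<open>Differentiability at the single point \<open>x\<close> already gives a Lipschitz bound
  between \<open>x\<close> and nearby points, and \<open>1 \<le> n\<close> brings the values of
  \<open>F\<close> near \<open>x\<close> for small \<open>a\<close>.\<close>

lemma unif_bigo_compose:
  assumes g: "(g has_real_derivative D) (at x)" and "1 \<le> n"
    and F: "unif_bigo n (\<lambda>a c z. F a c z - x)"
  shows "unif_bigo n (\<lambda>a c z. g (F a c z) - g x)"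
proof -
  have "((\<lambda>y. (g y - g x) / (y - x)) \<longlongrightarrow> D) (at x)"
    using g by (simp add: has_field_derivative_iff)
  then have "\<forall>\<^sub>F y in at x. dist ((g y - g x) / (y - x)) D < 1"
    by (rule tendstoD) simp
  then obtain d where d: "0 < d"
    "\<And>y. y \<noteq> x \<Longrightarrow> dist y x < d \<Longrightarrow> dist ((g y - g x) / (y - x)) D < 1"
    unfolding eventually_at by auto
  have lip: "\<bar>g y - g x\<bar> \<le> (\<bar>D\<bar> + 1) * \<bar>y - x\<bar>" if "\<bar>y - x\<bar> < d" for y
  proof (cases "y = x")
    case False
    then have "\<bar>(g y - g x) / (y - x) - D\<bar> < 1" using d(2)[of y] that by (simp add: dist_real_def)
    then have "\<bar>(g y - g x) / (y - x)\<bar> \<le> \<bar>D\<bar> + 1" by linarith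
    then show ?thesis using False by (simp add: abs_divide divide_simps)
  qed simp
  obtain K where K: "0 \<le> K" and *: "\<forall>\<^sub>F a in at_right 0. 0 < a \<and> a \<le> 1 \<and>
      (\<forall>c z. \<bar>c - 1/2\<bar> \<le> a \<longrightarrow> \<bar>F a c z - x\<bar> \<le> K * a ^ n)"
    using F by (rule unif_bigoE)
  \<comment> \<open>With this threshold \<open>K * a + a < d\<close>, so the deviation
    \<open>K * a ^ n\<close> stays inside the neighbourhood where the Lipschitz bound holds.\<close>
  have "\<forall>\<^sub>F a in at_right 0. 0 < a \<and> a < d / (K + 1)"
    unfolding eventually_at_right_field using d K by (intro exI[of _ "d / (K + 1)"]) auto
  with * show ?thesis
  proof (intro unif_bigoI[where K = "(\<bar>D\<bar> + 1) * K"], eventually_elim)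
    case (elim a)
    have "a ^ n \<le> a ^ 1" using elim \<open>1 \<le> n\<close> by (intro power_decreasing) auto
    then have "K * a ^ n \<le> K * a" using K by (intro mult_left_mono) auto
    moreover have "K * a + a < d" using elim K by (simp add: field_simps)
    ultimately have small: "K * a ^ n < d" using elim by linarith
    show ?case
    proof (intro allI impI)
      fix c z :: real assume "\<bar>c - 1/2\<bar> \<le> a"
      then have F: "\<bar>F a c z - x\<bar> \<le> K * a ^ n" using elim by blast
      then have "\<bar>g (F a c z) - g x\<bar> \<le> (\<bar>D\<bar> + 1) * \<bar>F a c z - x\<bar>" using lip small by simp
      also have "\<dots> \<le> (\<bar>D\<bar> + 1) * (K * a ^ n)" using F by (intro mult_left_mono) auto
      finally show "\<bar>g (F a c z) - g x\<bar> \<le> (\<bar>D\<bar> + 1) * K * a ^ n" by (simp add: mult.assoc)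
    qed
  qed
qed

lemma unif_bigo_inverse:
  assumes "1 \<le> n" "unif_bigo n (\<lambda>a c z. F a c z - 1)"
  shows "unif_bigo n (\<lambda>a c z. 1 / F a c z - 1)"
proof -
  have "(inverse has_real_derivative - 1) (at (1::real))"
    using DERIV_inverse[of "1::real" UNIV] by simp
  from unif_bigo_compose[OF this assms] show ?thesis by (simp add: inverse_eq_divide)
qed

lemma unif_bigo_powr:
  assumes "1 \<le> n" "unif_bigo n (\<lambda>a c z. F a c z - 1)"
  shows "unif_bigo n (\<lambda>a c z. F a c z powr p - 1)"
proof -
  have "((\<lambda>x. x powr p) has_real_derivative p * 1 powr (p - 1)) (at 1)"
    by (rule has_real_derivative_powr) simp
  from unif_bigo_compose[OF this assms] show ?thesis by simp
qed

section \<open>The approximate second solution and the coefficients of the reduced form\<close>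

text \<open>
  The coefficient \<open>1/3\<close> is chosen such that \<open>sine2\<close> solves \<open>(h Y')' + Y = 0\<close> up to \<open>residue2\<close>,
  which is of order \<open>a\<^sup>2\<close>; the derivative \<open>U'/a\<close> would only achieve order \<open>a\<close>.
\<close>

definition sine2 :: "real \<Rightarrow> real \<Rightarrow> real" where
  "sine2 a z = sin z + a/3 * sin (2 * z)"

definition sine2' :: "real \<Rightarrow> real \<Rightarrow> real" where
  "sine2' a z = cos z + 2*a/3 * cos (2 * z)"

definition sine2'' :: "real \<Rightarrow> real \<Rightarrow> real" where
  "sine2'' a z = - sin z - 4*a/3 * sin (2 * z)"

definition residue2 :: "real \<Rightarrow> real \<Rightarrow> real \<Rightarrow> real \<Rightarrow> real" where
  "residue2 a h k z = h * sine2'' a z + k * sine2' a z + sine2 a z"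

text \<open>The Wronskian of the exact solution \<open>U\<close> and the approximate solution
  \<open>sine2\<close>, with \<open>u\<close> in place of \<open>U'\<close>. Division by
  \<open>a\<close> normalizes it to \<open>1 + O(a)\<close>, the leading term being
  \<open>cos^2 + sin^2\<close>.\<close>

definition wronskian :: "real \<Rightarrow> real \<Rightarrow> real \<Rightarrow> real \<Rightarrow> real" where
  "wronskian a U u z = (U * sine2' a z - u * sine2 a z) / a"

lemma unif_bigo_trig:
  "unif_bigo 0 (\<lambda>a c z. sin z)" "unif_bigo 0 (\<lambda>a c z. cos z)"
  "unif_bigo 0 (\<lambda>a c z. sin (2 * z))" "unif_bigo 0 (\<lambda>a c z. cos (2 * z))"
  by (rule unif_bigo_bounded[where K = 1]; simp)+

lemma unif_bigo_sine2:
  "unif_bigo 1 (\<lambda>a c z. sine2 a z - sin z)" "unif_bigo 1 (\<lambda>a c z. sine2' a z - cos z)"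
  "unif_bigo 0 (\<lambda>a c z. sine2 a z)" "unif_bigo 0 (\<lambda>a c z. sine2' a z)" "unif_bigo 0 (\<lambda>a c z. sine2'' a z)"
proof -
  have *: "unif_bigo 1 (\<lambda>a c z. x * (sin (2 * z) * a))" "unif_bigo 1 (\<lambda>a c z. x * (cos (2 * z) * a))" for x
    by (intro unif_bigo_cmult unif_bigo_bounded_mult unif_bigo_trig unif_bigo_amplitude)+
  show 1: "unif_bigo 1 (\<lambda>a c z. sine2 a z - sin z)"
    using *(1)[of "1/3"] by (simp add: sine2_def mult_ac)
  show 2: "unif_bigo 1 (\<lambda>a c z. sine2' a z - cos z)"
    using *(2)[of "2/3"] by (simp add: sine2'_def mult_ac)
  have 3: "unif_bigo 1 (\<lambda>a c z. sine2'' a z - (- sin z))"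
    using *(1)[of "-4/3"] by (simp add: sine2''_def mult_ac)
  show "unif_bigo 0 (\<lambda>a c z. sine2 a z)"
    by (rule unif_bigo_diff_imp[OF unif_bigo_mono[OF 1] unif_bigo_trig(1)]) simp
  show "unif_bigo 0 (\<lambda>a c z. sine2' a z)"
    by (rule unif_bigo_diff_imp[OF unif_bigo_mono[OF 2] unif_bigo_trig(2)]) simp
  show "unif_bigo 0 (\<lambda>a c z. sine2'' a z)"
    by (rule unif_bigo_diff_imp[OF unif_bigo_mono[OF 3] unif_bigo_minus[OF unif_bigo_trig(1)]]) simp
qed

text \<open>Phrasing the choice of the constant as an eventual statement lets finitely many
  estimates share one constant by intersecting filters.\<close>

lemma unif_bigo_eventually:
  assumes "unif_bigo n F"
  shows "\<forall>\<^sub>F K in at_top. \<forall>\<^sub>F a in at_right 0. \<forall>c z. \<bar>c - 1/2\<bar> \<le> a \<longrightarrow> \<bar>F a c z\<bar> \<le> K * a ^ n"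
proof -
  obtain K0 where *: "\<forall>\<^sub>F a in at_right 0. 0 < a \<and> a \<le> 1 \<and>
      (\<forall>c z. \<bar>c - 1/2\<bar> \<le> a \<longrightarrow> \<bar>F a c z\<bar> \<le> K0 * a ^ n)"
    using assms by (rule unif_bigoE)
  have "\<forall>\<^sub>F a in at_right 0. \<forall>c z. \<bar>c - 1/2\<bar> \<le> a \<longrightarrow> \<bar>F a c z\<bar> \<le> K * a ^ n" if "K0 \<le> K" for K
    using *
  proof eventually_elim
    case (elim a)
    have "K0 * a ^ n \<le> K * a ^ n" using elim that by (intro mult_right_mono) auto
    then show ?case using elim by (meson order_trans)
  qed
  then show ?thesis unfolding eventually_at_top_linorder by blast
qed

text \<open>The last five estimates supply \<open>\<alpha>\<close>, \<open>\<beta>\<close>,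
  \<open>\<kappa>\<close>, \<open>\<nu>\<close>, \<open>\<mu>\<close> for
  \<open>oscillation_square\<close>. The coefficient of \<open>b^2\<close> is needed to order
  \<open>a^3\<close> because its leading value \<open>a^2\<close> is itself small; that of
  \<open>b * f\<close> is needed to order \<open>a^2\<close>, the size which the weighted Young
  inequality can absorb.\<close>

lemma coefficient_asymptotics:
  fixes U u :: "real \<Rightarrow> real \<Rightarrow> real" and \<gamma> J :: "real \<Rightarrow> real"
  assumes U: "unif_bigo 2 (\<lambda>a c z. U a z - a * cos z)"
    and u: "unif_bigo 2 (\<lambda>a c z. u a z + a * sin z)"
    and \<gamma>: "unif_bigo 2 (\<lambda>a c z. \<gamma> a - 1)"
    and J: "unif_bigo 2 (\<lambda>a c z. J a - 1)"
  defines "h \<equiv> \<lambda>a z. \<gamma> a - U a z"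
    and "m \<equiv> \<lambda>a c. c * J a powr (-5/3)"
    and "\<epsilon> \<equiv> \<lambda>a c. 1 - 2 * (c * J a powr (-5/3)) * (\<gamma> a)\<^sup>2"
    and "D \<equiv> \<lambda>a z. wronskian a (U a z) (u a z) z"
    and "r \<equiv> \<lambda>a z. residue2 a (\<gamma> a - U a z) (- u a z) z"
  shows "unif_bigo 1 (\<lambda>a c z. U a z / a - cos z)"
    and "unif_bigo 1 (\<lambda>a c z. h a z * D a z - 1)"
    and "unif_bigo 2 (\<lambda>a c z. \<epsilon> a c - (1 - 2 * c))"
    and "unif_bigo 1 (\<lambda>a c z. m a c * h a z ^ 3 - 1/2)"
    and "unif_bigo 1 (\<lambda>a c z. 4 * m a c * (h a z)\<^sup>2 * u a z)"
    and "unif_bigo 1 (\<lambda>a c z. 4 * m a c * h a z * (u a z)\<^sup>2 + 2 * m a c * h a z * (\<gamma> a - 3 * (u a z)\<^sup>2) - 1)"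
    and "unif_bigo 3 (\<lambda>a c z. 2 * m a c * a\<^sup>2 / h a z - \<epsilon> a c * r a z * sine2 a z / (h a z * D a z)\<^sup>2 - a\<^sup>2)"
    and "unif_bigo 2 (\<lambda>a c z. 2 * \<epsilon> a c * sine2 a z / (h a z * D a z) - 2 * \<epsilon> a c * sin z)"
proof -
  note trig = unif_bigo_trig and sine2 = unif_bigo_sine2
  note bmult = unif_bigo_bounded_mult
  have one: "unif_bigo 0 (\<lambda>a c z. 1)" by (rule unif_bigo_const)
  have mult1: "unif_bigo n (\<lambda>a c z. F a c z * G a c z - 1)"
    if "unif_bigo n (\<lambda>a c z. F a c z - 1)" "unif_bigo n (\<lambda>a c z. G a c z - 1)" for n F G
    using unif_bigo_mult_close[OF that one one] by simp
  have close1: "unif_bigo 0 F" if "unif_bigo n (\<lambda>a c z. F a c z - 1)" for n F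
    by (rule unif_bigo_diff_imp[OF unif_bigo_mono[OF that] one]) simp
  show \<phi>: "unif_bigo 1 (\<lambda>a c z. U a z / a - cos z)"
  proof -
    have *: "unif_bigo 1 (\<lambda>a c z. (U a z - a * cos z) / a)"
      by (rule unif_bigo_div_amplitude) (use U in \<open>simp add: numeral_2_eq_2\<close>)
    \<comment> \<open>Splitting the quotient into \<open>U / a - cos z\<close> requires
      \<open>a \<noteq> 0\<close>, so it is done inside the eventual bound, where \<open>a\<close>
      is positive.\<close>
    then obtain K where "\<forall>\<^sub>F a in at_right 0. 0 < a \<and> a \<le> 1 \<and>
      (\<forall>c z. \<bar>c - 1/2\<bar> \<le> a \<longrightarrow> \<bar>(U a z - a * cos z) / a\<bar> \<le> K * a ^ 1)" by (rule unif_bigoE)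
    then show ?thesis
      by (intro unif_bigoI[where K = K]) (auto elim!: eventually_mono simp: diff_divide_distrib)
  qed
  have \<psi>: "unif_bigo 1 (\<lambda>a c z. u a z / a - (- sin z))"
  proof -
    have *: "unif_bigo 1 (\<lambda>a c z. (u a z + a * sin z) / a)"
      by (rule unif_bigo_div_amplitude) (use u in \<open>simp add: numeral_2_eq_2\<close>)
    then obtain K where "\<forall>\<^sub>F a in at_right 0. 0 < a \<and> a \<le> 1 \<and>
      (\<forall>c z. \<bar>c - 1/2\<bar> \<le> a \<longrightarrow> \<bar>(u a z + a * sin z) / a\<bar> \<le> K * a ^ 1)" by (rule unif_bigoE)
    then show ?thesis
      by (intro unif_bigoI[where K = K]) (auto elim!: eventually_mono simp: add_divide_distrib)
  qed
  have acos: "unif_bigo 1 (\<lambda>a c z. a * cos z)" and asin: "unif_bigo 1 (\<lambda>a c z. a * sin z)"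
    using bmult[OF trig(2) unif_bigo_amplitude] bmult[OF trig(1) unif_bigo_amplitude]
    by (simp_all add: mult.commute)
  have U1: "unif_bigo 1 (\<lambda>a c z. U a z)"
    by (rule unif_bigo_diff_imp[OF unif_bigo_mono[OF U] acos]) simp
  have u1: "unif_bigo 1 (\<lambda>a c z. u a z)"
    using unif_bigo_diff[OF unif_bigo_mono[OF u] asin] by simp
  have u2: "unif_bigo 2 (\<lambda>a c z. (u a z)\<^sup>2)"
    using unif_bigo_mult[OF u1 u1] by (simp only: one_add_one power2_eq_square)
  have h: "unif_bigo 1 (\<lambda>a c z. h a z - 1)"
    using unif_bigo_diff[OF unif_bigo_mono[OF \<gamma>] U1] by (simp add: h_def algebra_simps)
  have h0: "unif_bigo 0 (\<lambda>a c z. h a z)" by (rule close1[OF h])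
  have D: "unif_bigo 1 (\<lambda>a c z. D a z - 1)"
  proof -
    have "unif_bigo 1 (\<lambda>a c z. (U a z / a * sine2' a z - cos z * cos z)
       - (u a z / a * sine2 a z - (- sin z) * sin z))"
      by (intro unif_bigo_diff unif_bigo_mult_close \<phi> \<psi> sine2 trig unif_bigo_minus)
    moreover have "(U a z / a * sine2' a z - cos z * cos z) - (u a z / a * sine2 a z - (- sin z) * sin z)
        = D a z - 1" for a z
    proof -
      have "(U a z / a * sine2' a z - cos z * cos z) - (u a z / a * sine2 a z - (- sin z) * sin z)
        = D a z - (cos z * cos z + sin z * sin z)"
        unfolding D_def wronskian_def diff_divide_distrib by (simp only: algebra_simps times_divide_eq_left times_divide_eq_right)
      then show ?thesis by (simp only: sin_cos_squared_add3)
    qed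
    ultimately show ?thesis by simp
  qed
  show hD: "unif_bigo 1 (\<lambda>a c z. h a z * D a z - 1)" by (rule mult1[OF h D])
  have ihD: "unif_bigo 1 (\<lambda>a c z. 1 / (h a z * D a z) - 1)" by (rule unif_bigo_inverse[OF _ hD]) simp
  have ih: "unif_bigo 1 (\<lambda>a c z. 1 / h a z - 1)" by (rule unif_bigo_inverse[OF _ h]) simp
  have Jp: "unif_bigo 2 (\<lambda>a c z. J a powr (-5/3) - 1)"
    by (rule unif_bigo_powr[OF _ J]) simp
  have J\<gamma>: "unif_bigo 2 (\<lambda>a c z. J a powr (-5/3) * (\<gamma> a * \<gamma> a) - 1)"
    by (intro mult1 Jp \<gamma>)
  have c0: "unif_bigo 0 (\<lambda>a c z. c)"
    by (rule unif_bigo_diff_imp[OF unif_bigo_mono[OF unif_bigo_speed] unif_bigo_const]) simp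
  have "unif_bigo 2 (\<lambda>a c z. -2 * (c * (J a powr (-5/3) * (\<gamma> a * \<gamma> a) - 1)))"
    by (intro unif_bigo_cmult bmult c0 J\<gamma>)
  moreover have "-2 * (c * (J a powr (-5/3) * (\<gamma> a * \<gamma> a) - 1)) = \<epsilon> a c - (1 - 2 * c)" for a c
    by (simp add: \<epsilon>_def algebra_simps power2_eq_square)
  ultimately show \<epsilon>: "unif_bigo 2 (\<lambda>a c z. \<epsilon> a c - (1 - 2 * c))" by (simp only:)
  have "unif_bigo 1 (\<lambda>a c z. (\<epsilon> a c - (1 - 2 * c)) + (-2) * (c - 1/2))"
    by (intro unif_bigo_add unif_bigo_mono[OF \<epsilon>] unif_bigo_cmult unif_bigo_speed) simp
  then have \<epsilon>1: "unif_bigo 1 (\<lambda>a c z. \<epsilon> a c)" by (simp add: algebra_simps)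
  have m: "unif_bigo 1 (\<lambda>a c z. m a c - 1/2)"
    using unif_bigo_mult_close[OF unif_bigo_speed unif_bigo_mono[OF Jp] unif_bigo_const one]
    by (simp add: m_def)
  have m0: "unif_bigo 0 (\<lambda>a c z. m a c)"
    by (rule unif_bigo_diff_imp[OF unif_bigo_mono[OF m] unif_bigo_const]) simp
  have "unif_bigo 1 (\<lambda>a c z. m a c * (h a z * (h a z * h a z)) - 1/2 * 1)"
    by (intro unif_bigo_mult_close[OF m] mult1 h unif_bigo_const)
  then show "unif_bigo 1 (\<lambda>a c z. m a c * h a z ^ 3 - 1/2)"
    by (simp add: power3_eq_cube mult.assoc)
  have "unif_bigo 1 (\<lambda>a c z. 4 * (m a c * (h a z * (h a z * u a z))))"
    by (intro bmult m0 h0 u1 unif_bigo_const)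
  then show "unif_bigo 1 (\<lambda>a c z. 4 * m a c * (h a z)\<^sup>2 * u a z)"
    by (simp add: power2_eq_square mult_ac)
  have mh: "unif_bigo 1 (\<lambda>a c z. m a c * h a z - 1/2 * 1)"
    by (intro unif_bigo_mult_close[OF m] h unif_bigo_const)
  have mh\<gamma>: "unif_bigo 1 (\<lambda>a c z. m a c * h a z * \<gamma> a - 1/2 * 1 * 1)"
    by (rule unif_bigo_mult_close[OF mh unif_bigo_mono[OF \<gamma>]]) (auto intro: unif_bigo_const)
  have u21: "unif_bigo 1 (\<lambda>a c z. (u a z)\<^sup>2)" by (rule unif_bigo_mono[OF u2]) simp
  have "unif_bigo 1 (\<lambda>a c z. 2 * (m a c * h a z * \<gamma> a - 1/2 * 1 * 1) + (-2) * (m a c * (h a z * (u a z)\<^sup>2)))"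
    by (intro unif_bigo_add[OF unif_bigo_cmult[OF mh\<gamma>]] unif_bigo_cmult bmult[OF m0] bmult[OF h0] u21)
  then show "unif_bigo 1 (\<lambda>a c z. 4 * m a c * h a z * (u a z)\<^sup>2 + 2 * m a c * h a z * (\<gamma> a - 3 * (u a z)\<^sup>2) - 1)"
    by (simp add: algebra_simps)
  \<comment> \<open>The first-order terms cancel: \<open>sine2'' + sine2\<close> equals
    \<open>- a * sin (2 * z)\<close>, while the leading parts of \<open>U\<close> and
    \<open>u\<close> contribute \<open>2 * a * sin z * cos z\<close>. The displayed sum is what
    remains.\<close>
  have r: "unif_bigo 2 (\<lambda>a c z. r a z)"
  proof -
    have "unif_bigo 2 (\<lambda>a c z. sine2'' a z * ((\<gamma> a - 1) - (U a z - a * cos z))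
       - sine2' a z * (u a z + a * sin z) + (4/3 * (cos z * (sin (2 * z) * a^2)) + 2/3 * (sin z * (cos (2 * z) * a^2))))"
      by (intro unif_bigo_add unif_bigo_diff bmult[OF sine2(5)] bmult[OF sine2(4)] U u \<gamma>
          unif_bigo_cmult bmult[OF trig(1)] bmult[OF trig(2)] bmult[OF trig(3)] bmult[OF trig(4)] unif_bigo_power)
    moreover have "sine2'' a z * ((\<gamma> a - 1) - (U a z - a * cos z))
       - sine2' a z * (u a z + a * sin z) + (4/3 * (cos z * (sin (2 * z) * a^2)) + 2/3 * (sin z * (cos (2 * z) * a^2)))
       = r a z" for a z
    proof -
      have "sin (2 * z) = 2 * sin z * cos z" by (rule sin_double)
      then show ?thesis
        unfolding r_def residue2_def sine2_def sine2'_def sine2''_def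
        by (simp add: algebra_simps power2_eq_square add_divide_distrib diff_divide_distrib)
    qed
    ultimately show ?thesis by simp
  qed
  have "unif_bigo (2 + 1) (\<lambda>a c z. a^2 * (2 * (m a c * (1 / h a z) - 1/2 * 1)))"
    by (intro unif_bigo_mult unif_bigo_power unif_bigo_cmult unif_bigo_mult_close[OF m] ih unif_bigo_const)
  \<comment> \<open>Here \<open>r\<close> has order \<open>a^2\<close> and \<open>\<epsilon>\<close>
    has order \<open>a\<close>. A residue of order \<open>a\<close> would contribute at order
    \<open>a^2\<close> and change the leading coefficient of \<open>b^2\<close>.\<close>
  moreover have "unif_bigo (2 + 1) (\<lambda>a c z. r a z * (sine2 a z * (1 / (h a z * D a z) * (1 / (h a z * D a z) * \<epsilon> a c))))"
    by (intro unif_bigo_mult[OF r] bmult[OF sine2(3)] bmult[OF close1[OF ihD]] \<epsilon>1)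
  ultimately have "unif_bigo (2 + 1) (\<lambda>a c z. a^2 * (2 * (m a c * (1 / h a z) - 1/2 * 1))
      - r a z * (sine2 a z * (1 / (h a z * D a z) * (1 / (h a z * D a z) * \<epsilon> a c))))"
    by (rule unif_bigo_diff)
  then show "unif_bigo 3 (\<lambda>a c z. 2 * m a c * a\<^sup>2 / h a z - \<epsilon> a c * r a z * sine2 a z / (h a z * D a z)\<^sup>2 - a\<^sup>2)"
    by (simp add: algebra_simps power2_eq_square numeral_3_eq_3)
  have "unif_bigo (1 + 1) (\<lambda>a c z. 2 * \<epsilon> a c * (sine2 a z * (1 / (h a z * D a z)) - sin z * 1))"
    by (intro unif_bigo_mult unif_bigo_cmult \<epsilon>1 unif_bigo_mult_close sine2 ihD trig one)
  then show "unif_bigo 2 (\<lambda>a c z. 2 * \<epsilon> a c * sine2 a z / (h a z * D a z) - 2 * \<epsilon> a c * sin z)"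
    by (simp add: algebra_simps numeral_2_eq_2)
qed

section \<open>Small-amplitude waves\<close>

text \<open>Evenness gives the vanishing slope at 0. The first integral, expanded in
  \<open>\<gamma> - U\<close>, gives the formula for \<open>\<gamma>^3 - 6 * I\<close>; with
  \<open>U''\<close> eliminated by the profile equation this turns the weight
  \<open>1 - 3 U''\<close> into a constant over a cube.\<close>

lemma wave_derivs:
  assumes "ostrovsky_wave \<gamma> I U"
  shows "(U has_real_derivative deriv U z) (at z)"
    and "(deriv U has_real_derivative ((deriv U z)\<^sup>2 - U z) / (\<gamma> - U z)) (at z)"
    and "((\<lambda>x. (\<gamma> - U x) * deriv U x) has_real_derivative - U z) (at z)"
    and "deriv U (z + 2 * pi) = deriv U z"
    and "deriv U 0 = 0"
    and "\<gamma>^3 - 6 * I = (\<gamma> - U z)^3 + 3 * U z * (\<gamma> - U z)\<^sup>2 - 3 * (deriv U z)\<^sup>2 * (\<gamma> - U z)\<^sup>2"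
    and "1 - 3 * deriv (deriv U) z = (\<gamma>^3 - 6 * I) / (\<gamma> - U z)^3"
proof -
  note w = assms[unfolded ostrovsky_wave_def]
  have smooth: "(deriv ^^ k) U differentiable at z" for k z using w by blast
  show U: "(U has_real_derivative deriv U z) (at z)" for z
    using smooth[of 0 z] by (simp add: DERIV_deriv_iff_real_differentiable)
  have u: "(deriv U has_real_derivative deriv (deriv U) z) (at z)" for z
    using smooth[of 1 z] by (simp add: DERIV_deriv_iff_real_differentiable)
  have F: "((\<lambda>x. (\<gamma> - U x) * deriv U x) has_real_derivative
      (\<gamma> - U z) * deriv (deriv U) z - (deriv U z)\<^sup>2) (at z)" for z
    by (rule derivative_eq_intros U u refl | simp add: power2_eq_square)+
  have "deriv (\<lambda>x. (\<gamma> - U x) * deriv U x) z + U z = 0" using w by blast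
  then have eq: "(\<gamma> - U z) * deriv (deriv U) z - (deriv U z)\<^sup>2 = - U z"
    using DERIV_imp_deriv[OF F] by simp
  then show "((\<lambda>x. (\<gamma> - U x) * deriv U x) has_real_derivative - U z) (at z)"
    using F by metis
  have pos: "\<gamma> - U z > 0" using w by (simp add: less_diff_eq)
  have uu: "deriv (deriv U) z = ((deriv U z)\<^sup>2 - U z) / (\<gamma> - U z)"
    using eq pos by (simp add: field_simps)
  then show "(deriv U has_real_derivative ((deriv U z)\<^sup>2 - U z) / (\<gamma> - U z)) (at z)"
    using u[of z] by simp
  have "((\<lambda>x. U (x + 2 * pi)) has_real_derivative deriv U (z + 2 * pi)) (at z)"
    using U by (simp add: DERIV_shift[symmetric])
  moreover have "(\<lambda>x. U (x + 2 * pi)) = U" using w by blast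
  ultimately show "deriv U (z + 2 * pi) = deriv U z" using U DERIV_unique by metis
  have "((\<lambda>x. U (- x)) has_real_derivative - deriv U 0) (at 0)"
    using U[of 0] DERIV_mirror[of U "deriv U 0" 0, THEN iffD1] by simp
  moreover have "(\<lambda>x. U (- x)) = U" using w by blast
  ultimately have "(U has_real_derivative - deriv U 0) (at 0)" by metis
  from DERIV_unique[OF U[of 0] this] show "deriv U 0 = 0" by simp
  have "I = 1/2 * (\<gamma> - U z)\<^sup>2 * (deriv U z)\<^sup>2 + \<gamma>/2 * (U z)\<^sup>2 - 1/3 * (U z)^3" using w by blast
  then show J: "\<gamma>^3 - 6 * I = (\<gamma> - U z)^3 + 3 * U z * (\<gamma> - U z)\<^sup>2 - 3 * (deriv U z)\<^sup>2 * (\<gamma> - U z)\<^sup>2"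
    by (simp add: power2_eq_square power3_eq_cube algebra_simps)
  show "1 - 3 * deriv (deriv U) z = (\<gamma>^3 - 6 * I) / (\<gamma> - U z)^3"
    unfolding uu J using pos by (simp add: divide_simps) (simp add: power2_eq_square power3_eq_cube algebra_simps)
qed

lemma bigo_unif_bigo:
  assumes "f \<in> O[at_right 0](\<lambda>a. a ^ n)"
  shows "unif_bigo n (\<lambda>a c z. f a)"
proof -
  obtain K where "\<forall>\<^sub>F a in at_right 0. norm (f a) \<le> K * norm (a ^ n)"
    using assms by (rule landau_o.bigE)
  then have "\<forall>\<^sub>F a in at_right 0. \<forall>c z. \<bar>c - 1/2\<bar> \<le> a \<longrightarrow> \<bar>f a\<bar> \<le> K * a ^ n"
    using eventually_small by eventually_elim (simp add: power_abs)
  then show ?thesis by (rule unif_bigoI)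
qed

text \<open>The assumed expansion says nothing about \<open>U'\<close>. Its asymptotics follow by
  integrating \<open>((\<gamma> - U) U')' = - U\<close> from 0, where the slope vanishes, and
  dividing by \<open>\<gamma> - U\<close>.\<close>

lemma wave_asymptotics:
  assumes "small_amplitude_waves a0 \<gamma>1 U \<gamma> I"
  shows "unif_bigo 2 (\<lambda>a c z. U a z - a * cos z)"
    and "unif_bigo 2 (\<lambda>a c z. deriv (U a) z + a * sin z)"
    and "unif_bigo 2 (\<lambda>a c z. \<gamma> a - 1)"
    and "unif_bigo 2 (\<lambda>a c z. (\<gamma> a)^3 - 6 * I a - 1)"
proof -
  note s = assms[unfolded small_amplitude_waves_def]
  have wave: "\<forall>\<^sub>F a in at_right 0. ostrovsky_wave (\<gamma> a) (I a) (U a)"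
    unfolding eventually_at_right_field using s by (intro exI[of _ a0]) auto
  obtain K where K: "\<forall>\<^sub>F a in at_right 0. \<forall>z.
        \<bar>U a z - (a * cos z + 1/3 * a^2 * cos (2 * z) + 3/16 * a^3 * cos (3 * z))\<bar> \<le> K * a^4"
    using s by blast
  have sc: "unif_bigo 0 (\<lambda>a c z. cos (x * z))" "unif_bigo 0 (\<lambda>a c z. sin z)" for x
    by (rule unif_bigo_bounded[where K = 1]; simp)+
  have U4: "unif_bigo 4 (\<lambda>a c z. U a z - (a * cos z + 1/3 * a^2 * cos (2 * z) + 3/16 * a^3 * cos (3 * z)))"
    by (rule unif_bigoI[where K = K], use K in eventually_elim) blast
  have U2: "unif_bigo 2 (\<lambda>a c z. 1/3 * (cos (2 * z) * a^2) + 3/16 * (cos (3 * z) * a^3))"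
    by (intro unif_bigo_add unif_bigo_cmult unif_bigo_bounded_mult sc unif_bigo_power
        unif_bigo_mono[OF unif_bigo_power[of 3]]) simp
  have "unif_bigo 2 (\<lambda>a c z. U a z - (a * cos z + 1/3 * a^2 * cos (2 * z) + 3/16 * a^3 * cos (3 * z))
      + (1/3 * (cos (2 * z) * a^2) + 3/16 * (cos (3 * z) * a^3)))"
    by (rule unif_bigo_add[OF unif_bigo_mono[OF U4] U2]) simp
  then show U: "unif_bigo 2 (\<lambda>a c z. U a z - a * cos z)"
    by (simp add: algebra_simps)
  have "unif_bigo 4 (\<lambda>a c z. \<gamma> a - (1 + 1/6 * a^2))" 
    using s by (intro bigo_unif_bigo) auto
  then have "unif_bigo 2 (\<lambda>a c z. (\<gamma> a - (1 + 1/6 * a^2)) + 1/6 * a^2)"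
    by (intro unif_bigo_add unif_bigo_cmult unif_bigo_power) (auto elim: unif_bigo_mono)
  then show g: "unif_bigo 2 (\<lambda>a c z. \<gamma> a - 1)" by (simp add: algebra_simps)
  have "unif_bigo 4 (\<lambda>a c z. I a - 1/2 * a^2)" 
    using s by (intro bigo_unif_bigo) auto
  then have "unif_bigo 2 (\<lambda>a c z. (I a - 1/2 * a^2) + 1/2 * a^2)"
    by (intro unif_bigo_add unif_bigo_cmult unif_bigo_power) (auto elim: unif_bigo_mono)
  then have I: "unif_bigo 2 (\<lambda>a c z. I a)" by simp
  have "unif_bigo 2 (\<lambda>a c z. (\<gamma> a)^3 - 1^3)"
    by (rule unif_bigo_compose[where D = 3 and g = "\<lambda>x. x^3"])
      (use g in \<open>auto intro!: derivative_eq_intros\<close>)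
  from unif_bigo_diff[OF this unif_bigo_cmult[OF I, of 6]]
  show "unif_bigo 2 (\<lambda>a c z. (\<gamma> a)^3 - 6 * I a - 1)" by (simp add: algebra_simps)
  have cos0: "unif_bigo 0 (\<lambda>a c z. cos z)" using sc(1)[of 1] by simp
  have U1: "unif_bigo 1 (\<lambda>a c z. U a z)"
    by (rule unif_bigo_diff_imp[OF unif_bigo_mono[OF U]])
      (use unif_bigo_bounded_mult[OF cos0 unif_bigo_amplitude] in \<open>simp_all add: mult.commute\<close>)
  have h: "unif_bigo 1 (\<lambda>a c z. (\<gamma> a - U a z) - 1)"
    using unif_bigo_diff[OF unif_bigo_mono[OF g] U1] by (simp add: algebra_simps)
  obtain C where C: "0 \<le> C" and *: "\<forall>\<^sub>F a in at_right 0. 0 < a \<and> a \<le> 1 \<and>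
      (\<forall>c z. \<bar>c - 1/2\<bar> \<le> a \<longrightarrow> \<bar>U a z - a * cos z\<bar> \<le> C * a ^ 2)"
    using U by (rule unif_bigoE)
  have "\<forall>\<^sub>F a in at_right 0. \<forall>c z. \<bar>c - 1/2\<bar> \<le> a \<longrightarrow>
      \<bar>(\<gamma> a - U a z) * deriv (U a) z + a * sin z\<bar> \<le> C * (2 * pi) * a ^ 2"
    using * wave
  proof eventually_elim
    case (elim a)
    note D = wave_derivs[OF elim(2)]
    let ?F = "\<lambda>z. (\<gamma> a - U a z) * deriv (U a) z"
    \<comment> \<open>The uniform bound is read at the admissible speed
      \<open>c = 1/2\<close>.\<close>
    have Ub: "\<bar>U a z - a * cos z\<bar> \<le> C * a ^ 2" for z
      using elim(1) by (metis abs_zero cancel_comm_monoid_add_class.diff_cancel order_less_imp_le)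
    let ?g = "\<lambda>z. ?F z + a * sin z"
    have per: "?g (z + 2 * pi) = ?g z" for z
      using D(4) elim(2) by (simp add: ostrovsky_wave_def)
    have "\<bar>?g y\<bar> \<le> C * (2 * pi) * a ^ 2" if y: "0 \<le> y" "y \<le> 2 * pi" for y
    proof -
      \<comment> \<open>\<open>?g\<close> vanishes at 0 and its derivative is
        \<open>-(U - a * cos z)\<close>, already of order \<open>a^2\<close>; one period suffices
        because \<open>?g\<close> is periodic.\<close>
      have "norm (?g y - ?g 0) \<le> (C * a ^ 2) * norm (y - 0)"
      proof (rule field_differentiable_bound[of UNIV _ "\<lambda>z. - U a z + a * cos z"])
        show "(?g has_real_derivative - U a z + a * cos z) (at z within UNIV)" for z
          by (rule derivative_eq_intros D(3) refl | simp)+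
        show "norm (- U a z + a * cos z) \<le> C * a ^ 2" for z using Ub[of z] by simp
      qed auto
      also have "\<dots> \<le> (C * a ^ 2) * (2 * pi)"
        using y C by (intro mult_left_mono) auto
      finally show ?thesis using D(5) by (simp add: mult_ac)
    qed
    then have "\<bar>?g z\<bar> \<le> C * (2 * pi) * a ^ 2" for z
      using periodic_representative[of "2 * pi" ?g z] per by (metis pi_gt_zero zero_less_mult_iff zero_less_numeral)
    then show ?case by blast
  qed
  then have hu: "unif_bigo 2 (\<lambda>a c z. (\<gamma> a - U a z) * deriv (U a) z + a * sin z)"
    by (rule unif_bigoI)
  have h': "unif_bigo 1 (\<lambda>a c z. 1 / (\<gamma> a - U a z) - 1)"
    by (rule unif_bigo_inverse) (use h in auto)
  have h'0: "unif_bigo 0 (\<lambda>a c z. 1 / (\<gamma> a - U a z))"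
    by (rule unif_bigo_diff_imp[OF unif_bigo_mono[OF h'] unif_bigo_const]) simp
  \<comment> \<open>Dividing the estimate for \<open>(\<gamma> - U) U' + a * sin z\<close> by
    \<open>\<gamma> - U\<close> leaves \<open>a * sin z / (\<gamma> - U)\<close>; this term measures
    its distance from \<open>a * sin z\<close>.\<close>
  have "unif_bigo 2 (\<lambda>a c z. a * (1 / (\<gamma> a - U a z) - 1))"
    using unif_bigo_mult[OF unif_bigo_amplitude h'] by (simp only: one_add_one)
  from unif_bigo_diff[OF unif_bigo_bounded_mult[OF h'0 hu] unif_bigo_bounded_mult[OF sc(2) this]]
  obtain C' where "\<forall>\<^sub>F a in at_right 0. 0 < a \<and> a \<le> 1 \<and> (\<forall>c z. \<bar>c - 1/2\<bar> \<le> a \<longrightarrow>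
      \<bar>1 / (\<gamma> a - U a z) * ((\<gamma> a - U a z) * deriv (U a) z + a * sin z)
      - sin z * (a * (1 / (\<gamma> a - U a z) - 1))\<bar> \<le> C' * a ^ 2)"
    by (rule unif_bigoE)
  then have "\<forall>\<^sub>F a in at_right 0. \<forall>c z. \<bar>c - 1/2\<bar> \<le> a \<longrightarrow> \<bar>deriv (U a) z + a * sin z\<bar> \<le> C' * a ^ 2"
    using wave
  proof eventually_elim
    case (elim a)
    have "1 / (\<gamma> a - U a z) * ((\<gamma> a - U a z) * deriv (U a) z + a * sin z)
      - sin z * (a * (1 / (\<gamma> a - U a z) - 1)) = deriv (U a) z + a * sin z" for z
    proof -
      have "\<gamma> a - U a z \<noteq> 0" using elim(2) by (auto simp: ostrovsky_wave_def)
      then show ?thesis by (simp add: divide_simps) (simp add: algebra_simps)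
    qed
    then show ?case using elim(1) by simp
  qed
  then show "unif_bigo 2 (\<lambda>a c z. deriv (U a) z + a * sin z)"
    by (rule unif_bigoI)
qed

section \<open>The quadratic form in adapted variables\<close>

text \<open>Variation of constants: \<open>b\<close> and \<open>e\<close> are \<open>h\<close> times
  the Wronskians of \<open>W\<close> with \<open>U / a\<close> and \<open>Y\<close>, and the
  resulting linear system for \<open>W\<close> and \<open>v\<close> has determinant
  \<open>p\<close>. The bracket subtracted in the third identity is the derivative of
  \<open>e * b / p\<close> when \<open>e' = Y * f - r * W\<close>, \<open>b' = \<phi> * f\<close>
  and \<open>p' = \<phi> * r\<close>.\<close>

lemma second_solution_identity:
  fixes h U u a Y Y' r W v f b e p \<phi> :: real
  assumes nz: "a \<noteq> 0" "p \<noteq> 0"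
    and p: "p = h * ((U * Y' - u * Y) / a)"
    and b: "b = h * (U * v - u * W) / a"
    and e: "e = h * (Y * v - Y' * W)"
    and \<phi>: "\<phi> = U / a"
  shows "W = (Y * b - \<phi> * e) / p"
    and "v = (Y' * b - u / a * e) / p"
    and "W * f = 2 * Y * b * f / p - r * Y * b\<^sup>2 / p\<^sup>2
      - (((Y * f - r * W) * b + e * (\<phi> * f)) / p - e * b * (\<phi> * r) / p\<^sup>2)"
proof -
  have "W * p = Y * b - \<phi> * e" "v * p = Y' * b - u / a * e"
    unfolding p b e \<phi> using nz by (simp_all add: divide_simps) (simp_all add: algebra_simps)
  then show W: "W = (Y * b - \<phi> * e) / p" and "v = (Y' * b - u / a * e) / p"
    using nz by (simp_all add: field_simps)
  have "2 * Y * b * f / p - r * Y * b\<^sup>2 / p\<^sup>2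
      - (((Y * f - r * W) * b + e * (\<phi> * f)) / p - e * b * (\<phi> * r) / p\<^sup>2)
      = (Y * b - \<phi> * e) / p * f + r * b / p * (W - (Y * b - \<phi> * e) / p)"
    using nz by (simp add: divide_simps) (simp add: algebra_simps power2_eq_square)
  then show "W * f = 2 * Y * b * f / p - r * Y * b\<^sup>2 / p\<^sup>2
      - (((Y * f - r * W) * b + e * (\<phi> * f)) / p - e * b * (\<phi> * r) / p\<^sup>2)"
    using W by simp
qed

text \<open>Periodicity is recorded only as agreement of values at 0 and \<open>L\<close>.
  Positivity of the Wronskian keeps \<open>U\<close> and the approximate solution independent, so
  that division by \<open>p\<close> is legitimate.\<close>

locale periodic_wave =
  fixes \<gamma> J a L :: real and U u :: "real \<Rightarrow> real"
  assumes L: "0 < L" and a: "0 < a"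
    and U: "\<And>z. (U has_real_derivative u z) (at z)"
    and u: "\<And>z. (u has_real_derivative ((u z)\<^sup>2 - U z) / (\<gamma> - U z)) (at z)"
    and pos: "\<And>z. 0 < \<gamma> - U z"
    and D_pos: "\<And>z. 0 < wronskian a (U z) (u z) z"
    and J: "\<And>z. J = (\<gamma> - U z)^3 + 3 * U z * (\<gamma> - U z)\<^sup>2 - 3 * (u z)\<^sup>2 * (\<gamma> - U z)\<^sup>2"
    and per: "U L = U 0" "u L = u 0" "sin L = 0" "cos L = 1"
begin

abbreviation "Y \<equiv> sine2 a"
abbreviation "Y' \<equiv> sine2' a"
definition "h z = \<gamma> - U z"
definition "k z = - u z"
text \<open>The second derivative of \<open>h\<close>, with \<open>U''\<close> eliminated by the
  profile equation.\<close>

definition "l z = (U z - (u z)\<^sup>2) / h z"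
text \<open>This would be constant by Abel's identity if \<open>Y\<close> were an exact
  solution.\<close>

definition "p z = h z * wronskian a (U z) (u z) z"
definition "r z = residue2 a (h z) (k z) z"

lemma h_nz [simp]: "h z \<noteq> 0" and h_pos: "0 < h z"
  using pos[of z] by (auto simp: h_def)

lemma p_nz [simp]: "p z \<noteq> 0"
  using h_pos[of z] D_pos[of z] by (auto simp: p_def)

text \<open>The last line is Abel's identity with a defect: \<open>U\<close> solves
  \<open>(h Y')' + Y = 0\<close> exactly and \<open>Y\<close> up to \<open>r\<close>, so only
  \<open>(U / a) * r\<close> survives.\<close>

lemma coeff_derivs [derivative_intros]:
  "(U has_real_derivative u z) (at z within S)"
  "(u has_real_derivative - l z) (at z within S)"
  "(h has_real_derivative k z) (at z within S)"
  "(k has_real_derivative l z) (at z within S)"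
  "(Y has_real_derivative Y' z) (at z within S)"
  "(Y' has_real_derivative sine2'' a z) (at z within S)"
  "(p has_real_derivative (U z / a) * r z) (at z within S)"
proof -
  show U': "(U has_real_derivative u z) (at z within S)"
    using U has_field_derivative_at_within by blast
  show u': "(u has_real_derivative - l z) (at z within S)"
    using u[of z, THEN has_field_derivative_at_within, of S] unfolding l_def h_def minus_divide_left by simp
  show h': "(h has_real_derivative k z) (at z within S)"
    unfolding h_def k_def using U' by (auto intro!: derivative_eq_intros)
  show "(k has_real_derivative l z) (at z within S)"
    unfolding k_def using u' by (auto intro!: derivative_eq_intros)
  show Y: "(Y has_real_derivative Y' z) (at z within S)"
    unfolding sine2_def sine2'_def by (auto intro!: derivative_eq_intros)
  show Y': "(Y' has_real_derivative sine2'' a z) (at z within S)"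
    unfolding sine2'_def sine2''_def by (auto intro!: derivative_eq_intros)
  have "(p has_real_derivative k z * wronskian a (U z) (u z) z
     + h z * (((u z * Y' z + U z * sine2'' a z) - (- l z * Y z + u z * Y' z)) / a)) (at z within S)"
    unfolding p_def wronskian_def
    by (rule derivative_eq_intros U' u' h' Y Y' refl | (use a in force))+
  moreover have "k z * wronskian a (U z) (u z) z
     + h z * (((u z * Y' z + U z * sine2'' a z) - (- l z * Y z + u z * Y' z)) / a) = (U z / a) * r z"
  proof -
    have "h z * l z = U z - (u z)\<^sup>2" by (simp add: l_def)
    then show ?thesis
      unfolding wronskian_def r_def residue2_def k_def using a
      by (simp add: divide_simps) algebra
  qed
  ultimately show "(p has_real_derivative (U z / a) * r z) (at z within S)" by simp
qed

lemma coeff_cont [continuous_intros]: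
  "continuous_on S U" "continuous_on S u" "continuous_on S h" "continuous_on S k"
  "continuous_on S l" "continuous_on S Y" "continuous_on S Y'" "continuous_on S p" "continuous_on S r"
proof -
  show U': "continuous_on S U" and u': "continuous_on S u" and h': "continuous_on S h"
    and "continuous_on S k" and "continuous_on S Y" and "continuous_on S Y'" and "continuous_on S p"
    using coeff_derivs by (meson DERIV_continuous continuous_on_eq_continuous_within)+
  show "continuous_on S l"
    unfolding l_def by (intro continuous_intros U' u' h') auto
  show "continuous_on S r"
    unfolding r_def residue2_def h_def k_def sine2_def sine2'_def sine2''_def
    by (intro continuous_intros U' u')
qed

lemma coeff_per: "h L = h 0" "k L = k 0" "Y L = Y 0" "Y' L = Y' 0" "p L = p 0"
  "sin (2 * L) = 0" "cos (2 * L) = 1"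
proof -
  show 1: "sin (2 * L) = 0" "cos (2 * L) = 1" using per by (simp_all add: sin_double cos_double)
  show 2: "h L = h 0" "k L = k 0" "Y L = Y 0" "Y' L = Y' 0"
    using per 1 by (simp_all add: h_def k_def sine2_def sine2'_def)
  show "p L = p 0" using per 2 by (simp add: p_def wronskian_def)
qed

end

text \<open>For \<open>v\<close> in \<open>H^2\<close> the second derivative is only square
  integrable, so \<open>v1\<close> is described by its increments, whereas \<open>W\<close> and
  \<open>v\<close> are classically differentiable.\<close>

locale perturbed_wave = periodic_wave +
  fixes W v v1 v2 :: "real \<Rightarrow> real"
  assumes W: "\<And>z. z \<in> {0..L} \<Longrightarrow> (W has_real_derivative v z) (at z within {0..L})"
    and v: "\<And>z. z \<in> {0..L} \<Longrightarrow> (v has_real_derivative v1 z) (at z within {0..L})"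
    and v1: "\<And>x y. 0 \<le> x \<Longrightarrow> x \<le> y \<Longrightarrow> y \<le> L \<Longrightarrow> v1 y - v1 x = integral {x..y} v2"
    and v2: "v2 absolutely_integrable_on {0..L}" "(\<lambda>z. (v2 z)\<^sup>2) absolutely_integrable_on {0..L}"
    and perv: "W L = W 0" "v L = v 0" "v1 L = v1 0"
begin

definition "f z = h z * v1 z + k z * v z + W z"
text \<open>The derivative of \<open>f\<close> as a formula in \<open>v2\<close>; it is meaningful
  almost everywhere, and no pointwise derivative of \<open>f\<close> is claimed.\<close>

definition "fp z = h z * v2 z + 2 * k z * v1 z + (1 + l z) * v z"
definition "b z = h z * (U z * v z - u z * W z) / a"
definition "e z = h z * (Y z * v z - Y' z * W z)"
definition "T z = 2 * k z * W z + (3 * (k z)\<^sup>2 - \<gamma>) * v z"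

lemma pert_cont [continuous_intros]:
  "continuous_on {0..L} W" "continuous_on {0..L} v" "continuous_on {0..L} v1"
  "continuous_on {0..L} f" "continuous_on {0..L} b" "continuous_on {0..L} e" "continuous_on {0..L} T"
proof -
  show W': "continuous_on {0..L} W" and v': "continuous_on {0..L} v"
    using W v by (meson DERIV_continuous continuous_on_eq_continuous_within)+
  show v1': "continuous_on {0..L} v1"
    by (rule integral_by_parts_indefinite(1)[of L v2 v1 "\<lambda>_. 0" "\<lambda>_. 0"])
      (use L v1 v2 in auto)
  show "continuous_on {0..L} f" "continuous_on {0..L} b" "continuous_on {0..L} e" "continuous_on {0..L} T"
    unfolding f_def b_def e_def T_def using a by (intro continuous_intros W' v' v1'; simp)+
qed

text \<open>Every integrand below is a quadratic polynomial in \<open>v2\<close> with continuous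
  coefficients.\<close>

lemma integrable_quadratic:
  assumes "continuous_on {0..L} X" "continuous_on {0..L} Z1" "continuous_on {0..L} Z2"
  shows "(\<lambda>z. (v2 z)\<^sup>2 * X z + v2 z * Z1 z + Z2 z) absolutely_integrable_on {0..L}"
  by (intro set_integral_add(1) absolutely_integrable_mult_continuous v2 assms
      absolutely_integrable_continuous_real)

text \<open>For \<open>b\<close> and \<open>e\<close> this is Lagrange's identity: \<open>U\<close>
  solves the homogeneous equation exactly, so only \<open>f\<close> appears in \<open>b'\<close>;
  \<open>Y\<close> solves it up to \<open>r\<close>, which adds \<open>- r * W\<close> to
  \<open>e'\<close>.\<close>

lemma pert_derivs:
  assumes z: "z \<in> {0..L}"
  shows "(b has_real_derivative (U z / a) * f z) (at z within {0..L})"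
    and "(e has_real_derivative Y z * f z - r z * W z) (at z within {0..L})"
    and "(T has_real_derivative 2 * l z * W z + 2 * k z * v z + 6 * k z * l z * v z + (3 * (k z)\<^sup>2 - \<gamma>) * v1 z)
        (at z within {0..L})"
proof -
  note d = coeff_derivs W[OF z] v[OF z]
  have hl: "h z * l z = U z - (u z)\<^sup>2" by (simp add: l_def)
  have "(b has_real_derivative (k z * (U z * v z - u z * W z)
      + h z * ((u z * v z + U z * v1 z) - (- l z * W z + u z * v z))) / a) (at z within {0..L})"
    unfolding b_def by (rule derivative_eq_intros d refl | (use a in force))+
  moreover have "(k z * (U z * v z - u z * W z)
      + h z * ((u z * v z + U z * v1 z) - (- l z * W z + u z * v z))) / a = (U z / a) * f z"
  proof -
    show ?thesis unfolding f_def k_def using a hl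
      by (simp add: divide_simps) algebra
  qed
  ultimately show "(b has_real_derivative (U z / a) * f z) (at z within {0..L})" by (simp only:)
  have "(e has_real_derivative k z * (Y z * v z - Y' z * W z)
      + h z * ((Y' z * v z + Y z * v1 z) - (sine2'' a z * W z + Y' z * v z))) (at z within {0..L})"
    unfolding e_def by (rule derivative_eq_intros d refl)+ (simp add: algebra_simps)
  moreover have "k z * (Y z * v z - Y' z * W z)
      + h z * ((Y' z * v z + Y z * v1 z) - (sine2'' a z * W z + Y' z * v z)) = Y z * f z - r z * W z"
    unfolding f_def r_def residue2_def by (simp add: algebra_simps)
  ultimately show "(e has_real_derivative Y z * f z - r z * W z) (at z within {0..L})" by simp
  show "(T has_real_derivative 2 * l z * W z + 2 * k z * v z + 6 * k z * l z * v z + (3 * (k z)\<^sup>2 - \<gamma>) * v1 z)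
        (at z within {0..L})"
    unfolding T_def by (rule derivative_eq_intros d refl)+ (simp add: algebra_simps)
qed

text \<open>The integrand is formally \<open>(f X)'\<close>. Of
  \<open>f = h * v1 + (k * v + W)\<close>, the first part is integrated by parts against the
  indefinite integral \<open>v1\<close>, and the second by the fundamental theorem.\<close>

lemma f_total_derivative:
  assumes X: "\<And>z. z \<in> {0..L} \<Longrightarrow> (X has_real_derivative X' z) (at z within {0..L})"
    and X': "continuous_on {0..L} X'" and "X L = X 0"
  shows "(\<lambda>z. fp z * X z + f z * X' z) absolutely_integrable_on {0..L}"
    and "integral {0..L} (\<lambda>z. fp z * X z + f z * X' z) = 0"
proof -
  have cX: "continuous_on {0..L} X"
    using X by (meson DERIV_continuous continuous_on_eq_continuous_within)
  have i: "(\<lambda>z. (v2 z)\<^sup>2 * 0 + v2 z * (h z * X z) + ((2 * k z * v1 z + (1 + l z) * v z) * X z + f z * X' z))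
      absolutely_integrable_on {0..L}"
    by (intro integrable_quadratic continuous_intros cX X')
  have eq: "(v2 z)\<^sup>2 * 0 + v2 z * (h z * X z) + ((2 * k z * v1 z + (1 + l z) * v z) * X z + f z * X' z)
    = fp z * X z + f z * X' z" for z
    by (simp add: fp_def algebra_simps)
  show "(\<lambda>z. fp z * X z + f z * X' z) absolutely_integrable_on {0..L}"
    using i unfolding eq .
  let ?G' = "\<lambda>z. k z * X z + h z * X' z"
  let ?\<Psi> = "\<lambda>z. (k z * v z + W z) * X z"
  let ?\<Psi>' = "\<lambda>z. (l z * v z + k z * v1 z + v z) * X z + (k z * v z + W z) * X' z"
  have G: "((\<lambda>z. h z * X z) has_real_derivative ?G' z) (at z within {0..L})" if "z \<in> {0..L}" for z
    by (rule derivative_eq_intros coeff_derivs X that refl)+ simp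
  have \<Psi>: "(?\<Psi> has_real_derivative ?\<Psi>' z) (at z within {0..L})" if "z \<in> {0..L}" for z
    by (rule derivative_eq_intros coeff_derivs X W v that refl)+ (simp add: algebra_simps)
  have cG': "continuous_on {0..L} ?G'" by (intro continuous_intros cX X')
  have "integral {0..L} (\<lambda>z. v2 z * (h z * X z) + v1 z * ?G' z) = v1 L * (h L * X L) - v1 0 * (h 0 * X 0)"
    by (rule integral_by_parts_indefinite(2)) (use L v1 v2 G cG' in auto)
  moreover have "(?\<Psi>' has_integral ?\<Psi> L - ?\<Psi> 0) {0..L}"
    by (rule fundamental_theorem_of_calculus)
      (use L \<Psi> in \<open>auto simp: has_real_derivative_iff_has_vector_derivative\<close>)
  moreover have "(\<lambda>z. v2 z * (h z * X z) + v1 z * ?G' z) integrable_on {0..L}"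
  proof -
    have "(\<lambda>z. (v2 z)\<^sup>2 * 0 + v2 z * (h z * X z) + v1 z * ?G' z) absolutely_integrable_on {0..L}"
      by (intro integrable_quadratic continuous_intros cX X')
    then show ?thesis using set_lebesgue_integral_eq_integral(1) by auto
  qed
  ultimately have "integral {0..L} (\<lambda>z. (v2 z * (h z * X z) + v1 z * ?G' z) + ?\<Psi>' z) = 0"
    using assms(3) perv coeff_per
    by (subst Henstock_Kurzweil_Integration.integral_add) (auto simp: has_integral_iff)
  moreover have "(v2 z * (h z * X z) + v1 z * ?G' z) + ?\<Psi>' z = fp z * X z + f z * X' z" for z
    by (simp add: f_def fp_def algebra_simps)
  ultimately show "integral {0..L} (\<lambda>z. fp z * X z + f z * X' z) = 0" by simp
qed

lemma smooth_total_derivative: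
  assumes X: "\<And>z. z \<in> {0..L} \<Longrightarrow> (X has_real_derivative X' z) (at z within {0..L})"
    and "X L = X 0"
  shows "(X' has_integral 0) {0..L}"
proof -
  have "(X' has_integral X L - X 0) {0..L}"
    by (rule fundamental_theorem_of_calculus)
      (use L X in \<open>auto simp: has_real_derivative_iff_has_vector_derivative\<close>)
  then show ?thesis using assms(2) by simp
qed

end

section \<open>The form bounded below by \<open>fp\<close>, \<open>f\<close> and
  \<open>b\<close>\<close>

context perturbed_wave
begin

text \<open>Pointwise, the integrand of the form dominates \<open>a^3 / 64\<close> times the sum of
  squares plus exact derivatives, and the latter integrate to zero over the period. Here
  \<open>m\<close> stands for \<open>c J^(-5/3)\<close> and \<open>\<epsilon>\<close> is the total
  coefficient of \<open>W * f\<close>.\<close>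

lemma energy_lower_bound:
  assumes \<epsilon>: "\<epsilon> = 1 - 2 * m * \<gamma>\<^sup>2"
    and a1: "a \<le> 1" and K: "0 \<le> K" "8 * (2 * K + 6) * a \<le> 1"
    and \<epsilon>a: "\<bar>\<epsilon>\<bar> \<le> 2 * a"
    and gap: "3/4 * (- (2 * \<epsilon> / 3))\<^sup>2 + (17 * (2 * K + 6) + 1) * a^3 \<le> a\<^sup>2"
    and \<alpha>: "\<And>z. \<bar>m * h z ^ 3 - 1/2\<bar> \<le> K * a"
    and \<beta>: "\<And>z. \<bar>4 * m * (h z)\<^sup>2 * u z\<bar> \<le> K * a"
    and \<kappa>: "\<And>z. \<bar>4 * m * h z * (u z)\<^sup>2 + 2 * m * h z * (\<gamma> - 3 * (u z)\<^sup>2) - 1\<bar> \<le> K * a"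
    and \<nu>: "\<And>z. \<bar>2 * m * a\<^sup>2 / h z - \<epsilon> * r z * Y z / (p z)\<^sup>2 - a\<^sup>2\<bar> \<le> K * a^3"
    and \<mu>: "\<And>z. \<bar>2 * \<epsilon> * Y z / p z - 2 * \<epsilon> * sin z\<bar> \<le> K * a\<^sup>2"
    and \<phi>: "\<And>z. \<bar>U z / a\<bar> \<le> 2"
  shows "a^3 / 64 * integral {0..L} (\<lambda>z. (fp z)\<^sup>2 + (f z)\<^sup>2 + (b z)\<^sup>2)
    \<le> integral {0..L} (\<lambda>z. (W z)\<^sup>2 - h z * (v z)\<^sup>2 + m * (h z ^ 5 * (v2 z)\<^sup>2 - J * (v z)\<^sup>2))"
    and "(\<lambda>z. (fp z)\<^sup>2 + (f z)\<^sup>2 + (b z)\<^sup>2) absolutely_integrable_on {0..L}"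
    and "(\<lambda>z. (W z)\<^sup>2 - h z * (v z)\<^sup>2 + m * (h z ^ 5 * (v2 z)\<^sup>2 - J * (v z)\<^sup>2))
      absolutely_integrable_on {0..L}"
proof -
  define s where "s = - (2 * \<epsilon> / 3)"
  define kk where "kk z = (k z)\<^sup>2 + \<gamma> - h z" for z
  define dT where "dT z = 2 * l z * W z + 2 * k z * v z + 6 * k z * l z * v z + (3 * (k z)\<^sup>2 - \<gamma>) * v1 z" for z
  \<comment> \<open>\<open>X\<close> collects all multipliers of \<open>f\<close> inside exact
    derivatives: \<open>2 m h^2 T\<close> from \<open>hessian_identity\<close> and
    \<open>s * cos z * b\<close> from the completed square. These need
    \<open>f_total_derivative\<close>.\<close>
  define X where "X z = m * (2 * ((h z)\<^sup>2 * T z)) + s * (cos z * b z)" for z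
  define X' where "X' z = m * (2 * (2 * h z * k z * T z + (h z)\<^sup>2 * dT z))
      + s * (cos z * (U z / a * f z) - sin z * b z)" for z
  define P where "P z = k z * (2 * \<gamma> * h z - 4 * (h z)\<^sup>2)" for z
  define Q where "Q z = - h z * (6 * h z * kk z + 2 * (h z)\<^sup>2 - 2 * \<gamma>\<^sup>2)" for z
  define R where "R z = k z * (h z)\<^sup>2 * (h z - 3 * kk z)" for z
  define dP where "dP z = l z * (2 * \<gamma> * h z - 4 * (h z)\<^sup>2) + k z * (2 * \<gamma> * k z - 8 * h z * k z)" for z
  define dQ where "dQ z = - k z * (6 * h z * kk z + 2 * (h z)\<^sup>2 - 2 * \<gamma>\<^sup>2)
       - h z * (6 * k z * kk z + 6 * h z * (2 * k z * l z - k z) + 4 * h z * k z)" for z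
  define dR where "dR z = l z * (h z)\<^sup>2 * (h z - 3 * kk z) + k z * (2 * h z * k z) * (h z - 3 * kk z)
        + k z * (h z)\<^sup>2 * (k z - 3 * (2 * k z * l z - k z))" for z
  \<comment> \<open>The remaining exact derivatives are classical: \<open>\<Psi>0\<close> reduces
    \<open>W^2 - h v^2\<close> to \<open>W * f\<close>, \<open>\<Psi>2\<close> comes from
    \<open>hessian_identity\<close>, \<open>\<Psi>3\<close> eliminates \<open>W * f\<close>, and
    \<open>\<Psi>4\<close> averages the oscillating coefficient of \<open>b^2\<close>.\<close>
  define \<Psi>0 where "\<Psi>0 z = - (h z * v z * W z)" for z
  define \<Psi>0' where "\<Psi>0' z = - (k z * v z * W z + h z * v1 z * W z + h z * v z * v z)" for z
  define \<Psi>2 where "\<Psi>2 z = P z * (W z)\<^sup>2 + Q z * W z * v z + R z * (v z)\<^sup>2" for z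
  define \<Psi>2' where "\<Psi>2' z = dP z * (W z)\<^sup>2 + 2 * P z * W z * v z + dQ z * W z * v z + Q z * (v z)\<^sup>2
      + Q z * W z * v1 z + dR z * (v z)\<^sup>2 + 2 * R z * v z * v1 z" for z
  define \<Psi>3 where "\<Psi>3 z = e z * b z / p z" for z
  define \<Psi>3' where "\<Psi>3' z = ((Y z * f z - r z * W z) * b z + e z * (U z / a * f z)) / p z
      - e z * b z * (U z / a * r z) / (p z)\<^sup>2" for z
  define \<Psi>4 where "\<Psi>4 z = sin (2 * z) * (b z)\<^sup>2" for z
  define \<Psi>4' where "\<Psi>4' z = 2 * cos (2 * z) * (b z)\<^sup>2 + 2 * sin (2 * z) * b z * (U z / a * f z)" for z
  define \<Psi>' where "\<Psi>' z = \<Psi>0' z + m * \<Psi>2' z - \<epsilon> * \<Psi>3' z + s\<^sup>2 / 8 * \<Psi>4' z" for z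
  have per0: "b L = b 0" "e L = e 0" "T L = T 0"
    using per coeff_per perv by (simp_all add: b_def e_def T_def)
  have Xd: "(X has_real_derivative X' z) (at z within {0..L})" if "z \<in> {0..L}" for z
    unfolding X_def X'_def dT_def
    by (rule derivative_eq_intros coeff_derivs pert_derivs that refl)+ (simp add: algebra_simps)
  have X'c: "continuous_on {0..L} X'"
    unfolding X'_def dT_def using a by (intro continuous_intros) auto
  have XL: "X L = X 0" using per coeff_per per0 by (simp add: X_def)
  have d0: "(\<Psi>0 has_real_derivative \<Psi>0' z) (at z within {0..L})" if "z \<in> {0..L}" for z
    unfolding \<Psi>0_def \<Psi>0'_def
    by (rule derivative_eq_intros coeff_derivs W v that refl)+ (simp add: algebra_simps)
  have d2: "(\<Psi>2 has_real_derivative \<Psi>2' z) (at z within {0..L})" if "z \<in> {0..L}" for z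
  proof -
    have kk: "(kk has_real_derivative 2 * k z * l z - k z) (at z within {0..L})"
      unfolding kk_def by (rule derivative_eq_intros coeff_derivs refl)+ simp
    have "(P has_real_derivative dP z) (at z within {0..L})"
      unfolding P_def dP_def by (rule derivative_eq_intros coeff_derivs refl)+ (simp add: algebra_simps)
    moreover have "(Q has_real_derivative dQ z) (at z within {0..L})"
      unfolding Q_def dQ_def by (rule derivative_eq_intros coeff_derivs kk refl)+ (simp add: algebra_simps)
    moreover have "(R has_real_derivative dR z) (at z within {0..L})"
      unfolding R_def dR_def by (rule derivative_eq_intros coeff_derivs kk refl)+ (simp add: algebra_simps)
    ultimately show ?thesis
      unfolding \<Psi>2_def \<Psi>2'_def
      using W[OF that] v[OF that]
      by (auto intro!: derivative_eq_intros simp: algebra_simps power2_eq_square)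
  qed
  have d3: "(\<Psi>3 has_real_derivative \<Psi>3' z) (at z within {0..L})" if "z \<in> {0..L}" for z
    unfolding \<Psi>3_def \<Psi>3'_def
    by (rule derivative_eq_intros coeff_derivs pert_derivs that refl p_nz)+
      (use a in \<open>simp add: divide_simps\<close>, simp add: algebra_simps power2_eq_square)
  have d4: "(\<Psi>4 has_real_derivative \<Psi>4' z) (at z within {0..L})" if "z \<in> {0..L}" for z
    unfolding \<Psi>4_def \<Psi>4'_def
    by (rule derivative_eq_intros pert_derivs that refl)+ (simp add: algebra_simps power2_eq_square)
  have "(\<Psi>0' has_integral 0) {0..L}" "(\<Psi>2' has_integral 0) {0..L}"
      "(\<Psi>3' has_integral 0) {0..L}" "(\<Psi>4' has_integral 0) {0..L}"
    using per coeff_per perv per0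
    by (intro smooth_total_derivative[OF d0] smooth_total_derivative[OF d2]
        smooth_total_derivative[OF d3] smooth_total_derivative[OF d4];
        simp add: \<Psi>0_def \<Psi>2_def \<Psi>3_def \<Psi>4_def P_def Q_def R_def kk_def)+
  then have "(\<Psi>' has_integral 0 + m * 0 - \<epsilon> * 0 + s\<^sup>2 / 8 * 0) {0..L}"
    unfolding \<Psi>'_def by (intro has_integral_add has_integral_diff has_integral_mult_right)
  then have \<Psi>': "(\<Psi>' has_integral 0) {0..L}" by simp
  have X0: "((\<lambda>z. fp z * X z + f z * X' z) has_integral 0) {0..L}"
    using f_total_derivative[OF Xd X'c XL] set_lebesgue_integral_eq_integral(1)
    by (metis has_integral_iff)
  have "(\<lambda>z. (v2 z)\<^sup>2 * (h z)\<^sup>2 + v2 z * (2 * h z * (2 * k z * v1 z + (1 + l z) * v z))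
      + ((2 * k z * v1 z + (1 + l z) * v z)\<^sup>2 + (f z)\<^sup>2 + (b z)\<^sup>2)) absolutely_integrable_on {0..L}"
    by (intro integrable_quadratic continuous_intros)
  then show Ei: "(\<lambda>z. (fp z)\<^sup>2 + (f z)\<^sup>2 + (b z)\<^sup>2) absolutely_integrable_on {0..L}"
    by (simp add: fp_def algebra_simps power2_eq_square)
  have "(\<lambda>z. (v2 z)\<^sup>2 * (m * h z ^ 5) + v2 z * 0
      + ((W z)\<^sup>2 - h z * (v z)\<^sup>2 - m * J * (v z)\<^sup>2)) absolutely_integrable_on {0..L}"
    by (intro integrable_quadratic continuous_intros)
  then show Qi: "(\<lambda>z. (W z)\<^sup>2 - h z * (v z)\<^sup>2 + m * (h z ^ 5 * (v2 z)\<^sup>2 - J * (v z)\<^sup>2)) absolutely_integrable_on {0..L}"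
    by (simp add: algebra_simps)
  have pw: "a^3 / 64 * ((fp z)\<^sup>2 + (f z)\<^sup>2 + (b z)\<^sup>2) + (fp z * X z + f z * X' z) + \<Psi>' z
      \<le> (W z)\<^sup>2 - h z * (v z)\<^sup>2 + m * (h z ^ 5 * (v2 z)\<^sup>2 - J * (v z)\<^sup>2)" for z
  proof -
    have "l z * h z = U z - (u z)\<^sup>2" by (simp add: l_def)
    then have hl: "l z * h z = \<gamma> - h z - (k z)\<^sup>2" by (simp add: h_def k_def)
    have Jz: "J = h z^3 + 3 * (\<gamma> - h z) * (h z)\<^sup>2 - 3 * (k z)\<^sup>2 * (h z)\<^sup>2"
      using J[of z] by (simp add: h_def k_def)
    note curv = hessian_identity[OF h_nz hl f_def fp_def Jz T_def dT_def dP_def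
        P_def Q_def[unfolded kk_def] dQ_def[unfolded kk_def] R_def[unfolded kk_def] dR_def[unfolded kk_def]]
    \<comment> \<open>\<open>(\<gamma> - h) v + k W = U v - U' W\<close>, which equals
      \<open>a * b / h\<close>.\<close>
    have bz: "2 * h z * ((\<gamma> - h z) * v z + k z * W z)\<^sup>2 = 2 * a\<^sup>2 * (b z)\<^sup>2 / h z"
      unfolding b_def k_def using a h_nz[of z]
      by (simp add: h_def[of z, symmetric] power_mult_distrib power_divide) (simp add: h_def divide_simps power2_eq_square)
    have I3: "W z * f z = 2 * Y z * b z * f z / p z - r z * Y z * (b z)\<^sup>2 / (p z)\<^sup>2 - \<Psi>3' z"
      unfolding \<Psi>3'_def using a p_nz[of z]
      by (intro second_solution_identity(3)[where h = "h z" and U = "U z" and u = "u z" and a = a and v = "v z" and Y' = "Y' z"])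
        (auto simp: p_def wronskian_def b_def e_def)
    have I1: "(W z)\<^sup>2 - h z * (v z)\<^sup>2 = W z * f z + \<Psi>0' z"
      unfolding \<Psi>0'_def f_def by (simp add: algebra_simps power2_eq_square)
    have osc: "a^3 / 64 * ((fp z)\<^sup>2 + (f z)\<^sup>2 + (b z)\<^sup>2)
      + (s * cos z * b z * fp z + s * (cos z * (U z / a * f z) - sin z * b z) * f z)
      + s\<^sup>2 / 8 * \<Psi>4' z
     \<le> (m * h z ^ 3) * (fp z)\<^sup>2 + (4 * m * (h z)\<^sup>2 * u z) * fp z * f z
       + (4 * m * h z * (u z)\<^sup>2 + 2 * m * h z * (\<gamma> - 3 * (u z)\<^sup>2)) * (f z)\<^sup>2
       + (2 * m * a\<^sup>2 / h z - \<epsilon> * r z * Y z / (p z)\<^sup>2) * (b z)\<^sup>2 + (2 * \<epsilon> * Y z / p z) * b z * f z"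
      unfolding \<Psi>4'_def s_def
      by (rule oscillation_square[OF a a1 K \<alpha> \<beta> \<kappa> \<nu> \<mu> \<epsilon>a \<phi> gap])
    have "(W z)\<^sup>2 - h z * (v z)\<^sup>2 + m * (h z ^ 5 * (v2 z)\<^sup>2 - J * (v z)\<^sup>2)
      = W z * f z + \<Psi>0' z + m * (h z * (h z * fp z - 2 * k z * f z)\<^sup>2 + 2 * h z * (\<gamma> - 3 * (k z)\<^sup>2) * (f z)\<^sup>2
        - 2 * \<gamma>\<^sup>2 * W z * f z + 2 * a\<^sup>2 * (b z)\<^sup>2 / h z
        + 2 * (fp z * ((h z)\<^sup>2 * T z) + f z * (2 * h z * k z * T z + (h z)\<^sup>2 * dT z)) + \<Psi>2' z)"
      unfolding I1 curv bz \<Psi>2'_def ..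
    \<comment> \<open>\<open>W * f\<close> occurs once from \<open>W^2 - h v^2\<close> and
      \<open>- 2 * m * \<gamma>^2\<close> times from the curvature terms; the sum is
      \<open>\<epsilon>\<close>.\<close>
    also have "\<dots> = \<epsilon> * (W z * f z) + \<Psi>0' z + m * \<Psi>2' z + m * (h z * (h z * fp z - 2 * k z * f z)\<^sup>2)
        + 2 * m * h z * (\<gamma> - 3 * (k z)\<^sup>2) * (f z)\<^sup>2 + 2 * m * a\<^sup>2 / h z * (b z)\<^sup>2
        + m * (2 * (fp z * ((h z)\<^sup>2 * T z) + f z * (2 * h z * k z * T z + (h z)\<^sup>2 * dT z)))"
      unfolding \<epsilon> by (simp add: algebra_simps)
    also have "\<dots> = ((m * h z ^ 3) * (fp z)\<^sup>2 + (4 * m * (h z)\<^sup>2 * u z) * fp z * f z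
       + (4 * m * h z * (u z)\<^sup>2 + 2 * m * h z * (\<gamma> - 3 * (u z)\<^sup>2)) * (f z)\<^sup>2
       + (2 * m * a\<^sup>2 / h z - \<epsilon> * r z * Y z / (p z)\<^sup>2) * (b z)\<^sup>2 + (2 * \<epsilon> * Y z / p z) * b z * f z)
       + \<Psi>0' z + m * \<Psi>2' z - \<epsilon> * \<Psi>3' z
       + m * (2 * (fp z * ((h z)\<^sup>2 * T z) + f z * (2 * h z * k z * T z + (h z)\<^sup>2 * dT z)))"
      unfolding I3 k_def by (simp add: algebra_simps power2_eq_square power3_eq_cube)
    finally show ?thesis
      using osc unfolding X_def X'_def \<Psi>'_def by (simp add: algebra_simps)
  qed
  have Li: "((\<lambda>z. a^3 / 64 * ((fp z)\<^sup>2 + (f z)\<^sup>2 + (b z)\<^sup>2) + (fp z * X z + f z * X' z) + \<Psi>' z)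
      has_integral a^3 / 64 * integral {0..L} (\<lambda>z. (fp z)\<^sup>2 + (f z)\<^sup>2 + (b z)\<^sup>2) + 0 + 0) {0..L}"
    using set_lebesgue_integral_eq_integral(1)[OF Ei]
    by (intro has_integral_add has_integral_mult_right X0 \<Psi>' integrable_integral)
  show "a^3 / 64 * integral {0..L} (\<lambda>z. (fp z)\<^sup>2 + (f z)\<^sup>2 + (b z)\<^sup>2)
    \<le> integral {0..L} (\<lambda>z. (W z)\<^sup>2 - h z * (v z)\<^sup>2 + m * (h z ^ 5 * (v2 z)\<^sup>2 - J * (v z)\<^sup>2))"
    using has_integral_le[OF Li integrable_integral[OF set_lebesgue_integral_eq_integral(1)[OF Qi]]] pw by simp
qed

end

section \<open>Coercivity\<close>

text \<open>Cauchy-Schwarz against the constant function, obtained from nonnegativity of the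
  variance about the mean \<open>\<mu>\<close>.\<close>

lemma square_integral_le:
  fixes g :: "real \<Rightarrow> real"
  assumes "0 < L" and g: "continuous_on {0..L} g"
  shows "(integral {0..L} g)\<^sup>2 \<le> L * integral {0..L} (\<lambda>z. (g z)\<^sup>2)"
proof -
  define \<mu> where "\<mu> = integral {0..L} g / L"
  have i: "g integrable_on {0..L}" "(\<lambda>z. (g z)\<^sup>2) integrable_on {0..L}"
    by (intro integrable_continuous_real continuous_intros g)+
  have "((\<lambda>z. (g z)\<^sup>2 - 2 * \<mu> * g z + \<mu>\<^sup>2) has_integral
      integral {0..L} (\<lambda>z. (g z)\<^sup>2) - 2 * \<mu> * integral {0..L} g + (L - 0) *\<^sub>R \<mu>\<^sup>2) {0..L}"
    using \<open>0 < L\<close> has_integral_const_real[of "\<mu>\<^sup>2" 0 L]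
    by (intro has_integral_add has_integral_diff has_integral_mult_right integrable_integral i) auto
  moreover have "(g z)\<^sup>2 - 2 * \<mu> * g z + \<mu>\<^sup>2 = (g z - \<mu>)\<^sup>2" for z by (simp add: power2_diff)
  ultimately have "((\<lambda>z. (g z - \<mu>)\<^sup>2) has_integral
      integral {0..L} (\<lambda>z. (g z)\<^sup>2) - 2 * \<mu> * integral {0..L} g + L * \<mu>\<^sup>2) {0..L}"
    by simp
  from has_integral_nonneg[OF this]
  have "0 \<le> integral {0..L} (\<lambda>z. (g z)\<^sup>2) - 2 * \<mu> * integral {0..L} g + L * \<mu>\<^sup>2"
    by simp
  also have "\<dots> = integral {0..L} (\<lambda>z. (g z)\<^sup>2) - (integral {0..L} g)\<^sup>2 / L"
    using \<open>0 < L\<close> by (simp add: \<mu>_def field_simps power2_eq_square)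
  finally show ?thesis using \<open>0 < L\<close> by (simp add: field_simps)
qed

lemma increment_square_le:
  fixes A A' :: "real \<Rightarrow> real"
  assumes "0 < L" and A: "\<And>z. z \<in> {0..L} \<Longrightarrow> (A has_real_derivative A' z) (at z within {0..L})"
    and A': "continuous_on {0..L} A'" and z: "z \<in> {0..L}"
  shows "(A z - A 0)\<^sup>2 \<le> L * integral {0..L} (\<lambda>z. (A' z)\<^sup>2)"
proof -
  have sub: "{0..z} \<subseteq> {0..L}" using z by auto
  have ac: "continuous_on {0..L} (\<lambda>z. \<bar>A' z\<bar>)" by (intro continuous_intros A')
  have "(A' has_integral A z - A 0) {0..z}"
    by (rule fundamental_theorem_of_calculus)
      (use z sub in \<open>auto simp: has_real_derivative_iff_has_vector_derivative[symmetric]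
        intro: has_field_derivative_subset[OF A]\<close>)
  then have "\<bar>A z - A 0\<bar> \<le> integral {0..z} (\<lambda>z. \<bar>A' z\<bar>)"
    using integral_norm_bound_integral[of A' "{0..z}" "\<lambda>z. \<bar>A' z\<bar>"]
      integrable_continuous_real[OF continuous_on_subset[OF ac sub]]
    by (auto simp: has_integral_iff)
  also have "\<dots> \<le> integral {0..L} (\<lambda>z. \<bar>A' z\<bar>)"
    by (intro integral_subset_le sub integrable_continuous_real continuous_on_subset[OF ac]) auto
  finally have "\<bar>A z - A 0\<bar>\<^sup>2 \<le> (integral {0..L} (\<lambda>z. \<bar>A' z\<bar>))\<^sup>2" by (intro power_mono) auto
  also have "\<dots> \<le> L * integral {0..L} (\<lambda>z. \<bar>A' z\<bar>\<^sup>2)"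
    by (rule square_integral_le[OF \<open>0 < L\<close> ac])
  finally show ?thesis by simp
qed

lemma sum_square_le:
  fixes x y z :: real
  shows "(x + y)\<^sup>2 \<le> 2 * x\<^sup>2 + 2 * y\<^sup>2" and "(x + y + z)\<^sup>2 \<le> 3 * (x\<^sup>2 + y\<^sup>2 + z\<^sup>2)"
proof -
  have "0 \<le> (x - y)\<^sup>2" "0 \<le> (x - z)\<^sup>2" "0 \<le> (y - z)\<^sup>2" by simp_all
  then show "(x + y)\<^sup>2 \<le> 2 * x\<^sup>2 + 2 * y\<^sup>2" "(x + y + z)\<^sup>2 \<le> 3 * (x\<^sup>2 + y\<^sup>2 + z\<^sup>2)"
    by (simp_all add: power2_eq_square algebra_simps)
qed

lemma product_square_le:
  fixes x y :: real
  assumes "\<bar>x\<bar> \<le> B" shows "(x * y)\<^sup>2 \<le> B\<^sup>2 * y\<^sup>2"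
  using power_mono[OF assms, of 2] by (simp add: power_mult_distrib mult_right_mono)

section \<open>Recovering the perturbation from \<open>fp\<close>, \<open>f\<close> and
  \<open>b\<close>\<close>

context periodic_wave
begin

text \<open>By compactness of the period. The bound may grow as \<open>a\<close> tends to 0, which
  is harmless because the coercivity constant may depend on the wave.\<close>

lemma coeff_bound:
  obtains B where "1 \<le> B" and "\<And>z. z \<in> {0..L} \<Longrightarrow> \<bar>U z\<bar> \<le> B \<and> \<bar>u z\<bar> \<le> B \<and> \<bar>k z\<bar> \<le> B \<and> \<bar>1 + l z\<bar> \<le> B
    \<and> \<bar>1 / h z\<bar> \<le> B \<and> \<bar>Y z / p z\<bar> \<le> B \<and> \<bar>Y' z / p z\<bar> \<le> B
    \<and> \<bar>Y z / (a * p z)\<bar> \<le> B \<and> \<bar>r z * Y z / (a * (p z)\<^sup>2)\<bar> \<le> B"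
proof -
  let ?F = "\<lambda>z. \<bar>U z\<bar> + \<bar>u z\<bar> + \<bar>k z\<bar> + \<bar>1 + l z\<bar> + \<bar>1 / h z\<bar> + \<bar>Y z / p z\<bar> + \<bar>Y' z / p z\<bar>
    + \<bar>Y z / (a * p z)\<bar> + \<bar>r z * Y z / (a * (p z)\<^sup>2)\<bar>"
  have "continuous_on {0..L} ?F"
    using a by (intro continuous_intros) auto
  then have "bounded (?F ` {0..L})"
    using compact_continuous_image compact_imp_bounded by blast
  then obtain B where B: "\<And>z. z \<in> {0..L} \<Longrightarrow> norm (?F z) \<le> B"
    unfolding bounded_iff by blast
  have F: "?F z \<le> max 1 B" if "z \<in> {0..L}" for z
    using order_trans[OF abs_ge_self B[OF that, unfolded real_norm_def]] by (simp only: max.coboundedI2)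
  have split: "x1 \<le> M \<and> x2 \<le> M \<and> x3 \<le> M \<and> x4 \<le> M \<and> x5 \<le> M \<and> x6 \<le> M \<and> x7 \<le> M \<and> x8 \<le> M \<and> x9 \<le> M"
    if "x1 + x2 + x3 + x4 + x5 + x6 + x7 + x8 + x9 \<le> M"
      "0 \<le> x1" "0 \<le> x2" "0 \<le> x3" "0 \<le> x4" "0 \<le> x5" "0 \<le> x6" "0 \<le> x7" "0 \<le> x8" "0 \<le> x9"
    for x1 x2 x3 x4 x5 x6 x7 x8 x9 M :: real
    using that by (intro conjI; linarith)
  show ?thesis
    by (rule that[of "max 1 B"], simp, rule split[OF F]) simp_all
qed

text \<open>If the slope vanished on the whole period, so would its derivative, and the profile
  equation would give \<open>U = 0\<close>; this contradicts the positive Wronskian.\<close>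

lemma slope_square_pos: "0 < integral {0..L} (\<lambda>z. (u z)\<^sup>2)"
proof (rule ccontr)
  assume "\<not> ?thesis"
  moreover have "0 \<le> integral {0..L} (\<lambda>z. (u z)\<^sup>2)"
    by (intro integral_nonneg integrable_continuous_real continuous_intros) auto
  ultimately have "integral {0..L} (\<lambda>z. (u z)\<^sup>2) = 0" by simp
  moreover have "continuous_on {0..L} (\<lambda>z. (u z)\<^sup>2)" by (intro continuous_intros)
  ultimately have zero: "u z = 0" if "z \<in> {0..L}" for z
    using integral_eq_0_iff[of 0 L "\<lambda>z. (u z)\<^sup>2"] that L by auto
  have U0: "U z = 0" if z: "z \<in> {0..L}" for z
  proof -
    have "(u has_real_derivative 0) (at z within {0..L})"
      by (rule has_field_derivative_transform_within[OF DERIV_const zero_less_one z]) (use zero in auto)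
    moreover have "(u has_real_derivative - l z) (at z within {0..L})" by (rule coeff_derivs)
    ultimately have "l z = 0"
      using vector_derivative_unique_within_closed_interval[of 0 L z u 0 "- l z"] L z
      by (auto simp: has_real_derivative_iff_has_vector_derivative)
    then show ?thesis using zero[OF z] by (simp add: l_def)
  qed
  show False using D_pos[of 0] zero[of 0] U0[of 0] L by (simp add: wronskian_def)
qed

text \<open>The constant produced in \<open>quadratic_dominates_H2\<close>, with its
  \<open>K1\<close>, \<open>K2\<close>, \<open>K3\<close> expanded. It depends on the wave and on
  \<open>L\<close>, not on the perturbation or the speed \<open>c\<close>.\<close>

definition "coercivity B = 206 * B^10 *
  ((2 * (2 * B\<^sup>2 * (2 * B\<^sup>2 * L * L + 1) / integral {0..L} (\<lambda>z. (u z)\<^sup>2)) + 2 * (2 * B\<^sup>2 * L)) * L + 1)"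

lemma coercivity_pos: "1 \<le> B \<Longrightarrow> 0 < coercivity B"
  unfolding coercivity_def using L slope_square_pos
  by (intro mult_pos_pos add_nonneg_pos mult_nonneg_nonneg add_nonneg_nonneg divide_nonneg_nonneg) auto

end

context perturbed_wave
begin

text \<open>Variation of constants writes \<open>W = A * U + (Y / p) * b\<close> and
  \<open>v = A * U' + (Y' / p) * b\<close>. Since \<open>A'\<close> involves only \<open>f\<close>
  and \<open>b\<close>, only the value of \<open>A\<close> at 0 is left free, and that is the kernel
  direction removed by orthogonality to \<open>U'\<close>.\<close>

lemma quadratic_dominates_H2:
  assumes orth: "integral {0..L} (\<lambda>z. u z * v z) = 0"
    and B: "1 \<le> B" "\<And>z. z \<in> {0..L} \<Longrightarrow> \<bar>U z\<bar> \<le> B \<and> \<bar>u z\<bar> \<le> B \<and> \<bar>k z\<bar> \<le> B \<and> \<bar>1 + l z\<bar> \<le> B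
      \<and> \<bar>1 / h z\<bar> \<le> B \<and> \<bar>Y z / p z\<bar> \<le> B \<and> \<bar>Y' z / p z\<bar> \<le> B
      \<and> \<bar>Y z / (a * p z)\<bar> \<le> B \<and> \<bar>r z * Y z / (a * (p z)\<^sup>2)\<bar> \<le> B"
    and Ei: "(\<lambda>z. (fp z)\<^sup>2 + (f z)\<^sup>2 + (b z)\<^sup>2) absolutely_integrable_on {0..L}"
  shows "integral {0..L} (\<lambda>z. (v z)\<^sup>2 + (v1 z)\<^sup>2 + (v2 z)\<^sup>2)
      \<le> coercivity B * integral {0..L} (\<lambda>z. (fp z)\<^sup>2 + (f z)\<^sup>2 + (b z)\<^sup>2)"
    and "(\<lambda>z. (v z)\<^sup>2 + (v1 z)\<^sup>2 + (v2 z)\<^sup>2) absolutely_integrable_on {0..L}"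
proof -
  define E where "E = integral {0..L} (\<lambda>z. (fp z)\<^sup>2 + (f z)\<^sup>2 + (b z)\<^sup>2)"
  define K1 where "K1 = 2 * B\<^sup>2 * L"
  define K2 where "K2 = 2 * B\<^sup>2 * (K1 * L + 1)"
  define K3 where "K3 = 2 * (K2 / integral {0..L} (\<lambda>z. (u z)\<^sup>2)) + 2 * K1"
  define A where "A z = - (e z / (a * p z))" for z
  define A' where "A' z = r z * Y z / (a * (p z)\<^sup>2) * b z - Y z / (a * p z) * f z" for z
  have decomp: "W z = A z * U z + Y z / p z * b z" "v z = A z * u z + Y' z / p z * b z" for z
  proof -
    have pz: "p z = h z * ((U z * Y' z - u z * Y z) / a)" by (simp add: p_def wronskian_def)
    note id = second_solution_identity[OF _ p_nz pz b_def e_def refl]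
    show "W z = A z * U z + Y z / p z * b z" using a
      by (subst id(1)) (simp_all add: A_def divide_simps)
    show "v z = A z * u z + Y' z / p z * b z" using a
      by (subst id(2)) (simp_all add: A_def divide_simps)
  qed
  \<comment> \<open>Inserting the decomposition of \<open>W\<close> cancels the terms in
    \<open>e\<close>, so \<open>A'\<close> is linear in \<open>f\<close> and \<open>b\<close>
    alone.\<close>
  have A_deriv: "(A has_real_derivative A' z) (at z within {0..L})" if z: "z \<in> {0..L}" for z
  proof -
    have "(A has_real_derivative - (((Y z * f z - r z * W z) * (a * p z) - e z * (a * (U z / a * r z)))
        / ((a * p z) * (a * p z)))) (at z within {0..L})"
      unfolding A_def
      by (rule derivative_eq_intros coeff_derivs pert_derivs z refl | (use a in force))+
    moreover have "- (((Y z * f z - r z * W z) * (a * p z) - e z * (a * (U z / a * r z)))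
        / ((a * p z) * (a * p z))) = A' z"
    proof -
      have "a * p z * W z = a * Y z * b z - U z * e z"
        using decomp(1)[of z] a by (simp add: A_def divide_simps) (simp add: algebra_simps)
      then show ?thesis unfolding A'_def using a
        by (simp add: divide_simps) algebra
    qed
    ultimately show ?thesis by simp
  qed
  have A'c: "continuous_on {0..L} A'"
    unfolding A'_def using a by (auto intro!: continuous_intros)
  have fbi: "(\<lambda>z. (f z)\<^sup>2 + (b z)\<^sup>2) integrable_on {0..L}"
    by (intro integrable_continuous_real continuous_intros)
  have Ei': "(\<lambda>z. (fp z)\<^sup>2 + (f z)\<^sup>2 + (b z)\<^sup>2) integrable_on {0..L}"
    using Ei set_lebesgue_integral_eq_integral(1) by auto
  have fbE: "integral {0..L} (\<lambda>z. (f z)\<^sup>2 + (b z)\<^sup>2) \<le> E"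
    unfolding E_def by (intro integral_le fbi Ei') auto
  have bE: "integral {0..L} (\<lambda>z. (b z)\<^sup>2) \<le> E"
    unfolding E_def by (intro integral_le Ei' integrable_continuous_real continuous_intros) auto
  have A'E: "integral {0..L} (\<lambda>z. (A' z)\<^sup>2) \<le> 2 * B\<^sup>2 * E"
  proof -
    have "integral {0..L} (\<lambda>z. (A' z)\<^sup>2) \<le> integral {0..L} (\<lambda>z. 2 * B\<^sup>2 * ((f z)\<^sup>2 + (b z)\<^sup>2))"
    proof (intro integral_le integrable_on_mult_right fbi integrable_continuous_real continuous_intros A'c)
      fix z assume z: "z \<in> {0..L}"
      have "(A' z)\<^sup>2 \<le> 2 * (r z * Y z / (a * (p z)\<^sup>2) * b z)\<^sup>2 + 2 * (- (Y z / (a * p z)) * f z)\<^sup>2"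
        using sum_square_le(1)[of "r z * Y z / (a * (p z)\<^sup>2) * b z" "- (Y z / (a * p z)) * f z"]
        by (simp add: A'_def)
      also have "\<dots> \<le> 2 * (B\<^sup>2 * (b z)\<^sup>2) + 2 * (B\<^sup>2 * (f z)\<^sup>2)"
        using B(2)[OF z] by (intro add_mono mult_left_mono product_square_le) auto
      finally show "(A' z)\<^sup>2 \<le> 2 * B\<^sup>2 * ((f z)\<^sup>2 + (b z)\<^sup>2)" by (simp add: algebra_simps)
    qed
    also have "\<dots> = 2 * B\<^sup>2 * integral {0..L} (\<lambda>z. (f z)\<^sup>2 + (b z)\<^sup>2)" by simp
    also have "\<dots> \<le> 2 * B\<^sup>2 * E" using fbE by (intro mult_left_mono) auto
    finally show ?thesis .
  qed
  \<comment> \<open>\<open>A\<close> is the component of \<open>W\<close> along \<open>U\<close>: its oscillation is controlled by \<open>E\<close>, its value at \<open>0\<close> by orthogonality.\<close>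
  have osc: "(A z - A 0)\<^sup>2 \<le> K1 * E" if "z \<in> {0..L}" for z
  proof -
    have "(A z - A 0)\<^sup>2 \<le> L * integral {0..L} (\<lambda>z. (A' z)\<^sup>2)"
      by (rule increment_square_le[OF L A_deriv A'c that])
    also have "\<dots> \<le> L * (2 * B\<^sup>2 * E)" using A'E L by (intro mult_left_mono) auto
    finally show ?thesis by (simp add: K1_def mult_ac)
  qed
  let ?P = "integral {0..L} (\<lambda>z. (u z)\<^sup>2)"
  have A0: "(A 0)\<^sup>2 * ?P \<le> K2 * E"
  proof -
    have i: "(\<lambda>z. (v z)\<^sup>2) integrable_on {0..L}" "(\<lambda>z. u z * v z) integrable_on {0..L}"
      "(\<lambda>z. (u z)\<^sup>2) integrable_on {0..L}" "(\<lambda>z. (b z)\<^sup>2) integrable_on {0..L}"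
      by (intro integrable_continuous_real continuous_intros)+
    have "((\<lambda>z. (v z)\<^sup>2 - 2 * A 0 * (u z * v z) + (A 0)\<^sup>2 * (u z)\<^sup>2) has_integral
        integral {0..L} (\<lambda>z. (v z)\<^sup>2) - 2 * A 0 * integral {0..L} (\<lambda>z. u z * v z) + (A 0)\<^sup>2 * ?P) {0..L}"
      by (intro has_integral_add has_integral_diff has_integral_mult_right integrable_integral i)
    moreover have "(v z)\<^sup>2 - 2 * A 0 * (u z * v z) + (A 0)\<^sup>2 * (u z)\<^sup>2 = (v z - A 0 * u z)\<^sup>2" for z
      by (simp add: power2_eq_square algebra_simps)
    \<comment> \<open>Pythagoras: orthogonality removes the mixed term, so \<open>A 0\<close> is
      bounded by the distance of \<open>v\<close> from \<open>A 0 * U'\<close>.\<close>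
    ultimately have lhs: "((\<lambda>z. (v z - A 0 * u z)\<^sup>2) has_integral
        integral {0..L} (\<lambda>z. (v z)\<^sup>2) + (A 0)\<^sup>2 * ?P) {0..L}"
      using orth by simp
    have rhs: "((\<lambda>z. 2 * B\<^sup>2 * (K1 * E + (b z)\<^sup>2)) has_integral
        2 * B\<^sup>2 * ((L - 0) *\<^sub>R (K1 * E) + integral {0..L} (\<lambda>z. (b z)\<^sup>2))) {0..L}"
      using L has_integral_const_real[of "K1 * E" 0 L]
      by (intro has_integral_mult_right has_integral_add integrable_integral i) auto
    have "integral {0..L} (\<lambda>z. (v z)\<^sup>2) + (A 0)\<^sup>2 * ?P
        \<le> 2 * B\<^sup>2 * ((L - 0) *\<^sub>R (K1 * E) + integral {0..L} (\<lambda>z. (b z)\<^sup>2))"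
    proof (rule has_integral_le[OF lhs rhs])
      fix z assume z: "z \<in> {0..L}"
      have "v z - A 0 * u z = u z * (A z - A 0) + Y' z / p z * b z"
        using decomp(2)[of z] by (simp add: algebra_simps)
      then have "(v z - A 0 * u z)\<^sup>2 \<le> 2 * (u z * (A z - A 0))\<^sup>2 + 2 * (Y' z / p z * b z)\<^sup>2"
        using sum_square_le(1) by metis
      also have "\<dots> \<le> 2 * (B\<^sup>2 * (A z - A 0)\<^sup>2) + 2 * (B\<^sup>2 * (b z)\<^sup>2)"
        using B(2)[OF z] by (intro add_mono mult_left_mono product_square_le) auto
      also have "\<dots> \<le> 2 * (B\<^sup>2 * (K1 * E)) + 2 * (B\<^sup>2 * (b z)\<^sup>2)"
        using osc[OF z] by (intro add_mono mult_left_mono) auto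
      finally show "(v z - A 0 * u z)\<^sup>2 \<le> 2 * B\<^sup>2 * (K1 * E + (b z)\<^sup>2)" by (simp add: algebra_simps)
    qed
    also have "\<dots> \<le> 2 * B\<^sup>2 * (L * (K1 * E) + E)"
      using bE by (intro mult_left_mono) auto
    also have "\<dots> = K2 * E" by (simp add: K2_def algebra_simps)
    finally show ?thesis using integral_nonneg[OF i(1)] by simp
  qed
  have AK3: "(A z)\<^sup>2 \<le> K3 * E" if z: "z \<in> {0..L}" for z
  proof -
    have "(A z)\<^sup>2 \<le> 2 * (A 0)\<^sup>2 + 2 * (A z - A 0)\<^sup>2"
      using sum_square_le(1)[of "A 0" "A z - A 0"] by simp
    also have "(A 0)\<^sup>2 \<le> K2 * E / ?P"
      using A0 slope_square_pos by (simp add: field_simps)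
    finally show ?thesis using osc[OF z] by (simp add: K3_def algebra_simps)
  qed
  \<comment> \<open>\<open>v1\<close> and \<open>v2\<close> come from solving the definitions of
    \<open>f\<close> and \<open>fp\<close> after division by \<open>h\<close>. The squares give
    \<open>15 = 3 + 6 + 6\<close> for \<open>v1\<close> and \<open>189 = 3 + 180 + 6\<close> for
    \<open>v2\<close>; with 2 for \<open>v\<close> the total is 206, lower powers of
    \<open>B\<close> being raised by \<open>1 \<le> B\<close>.\<close>
  have pw: "(v z)\<^sup>2 + (v1 z)\<^sup>2 + (v2 z)\<^sup>2 \<le> 206 * B^10 * (K3 * E + ((fp z)\<^sup>2 + (f z)\<^sup>2 + (b z)\<^sup>2))"
    if z: "z \<in> {0..L}" for z
  proof -
    note Bz = B(2)[OF z]
    define S where "S = (A z)\<^sup>2 + (fp z)\<^sup>2 + (f z)\<^sup>2 + (b z)\<^sup>2"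
    have S: "(A z)\<^sup>2 + (b z)\<^sup>2 \<le> S" "(f z)\<^sup>2 \<le> S" "(fp z)\<^sup>2 \<le> S" "0 \<le> S" by (auto simp: S_def)
    have pow: "B ^ m * S \<le> B ^ n * S" if "m \<le> n" for m n
      using that B(1) S(4) by (intro mult_right_mono power_increasing) auto
    have two: "(x * A z + y * b z)\<^sup>2 \<le> 2 * B\<^sup>2 * S" if "\<bar>x\<bar> \<le> B" "\<bar>y\<bar> \<le> B" for x y
    proof -
      have "(x * A z + y * b z)\<^sup>2 \<le> 2 * (x * A z)\<^sup>2 + 2 * (y * b z)\<^sup>2" by (rule sum_square_le)
      also have "\<dots> \<le> 2 * (B\<^sup>2 * (A z)\<^sup>2) + 2 * (B\<^sup>2 * (b z)\<^sup>2)"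
        using that by (intro add_mono mult_left_mono product_square_le) auto
      also have "\<dots> = 2 * B\<^sup>2 * ((A z)\<^sup>2 + (b z)\<^sup>2)" by (simp add: algebra_simps)
      also have "\<dots> \<le> 2 * B\<^sup>2 * S" using S by (intro mult_left_mono) auto
      finally show ?thesis .
    qed
    have Wb: "(W z)\<^sup>2 \<le> 2 * B\<^sup>2 * S" and vb: "(v z)\<^sup>2 \<le> 2 * B\<^sup>2 * S"
      using decomp[of z] two[of "U z" "Y z / p z"] two[of "u z" "Y' z / p z"] Bz by (simp_all add: mult_ac)
    have v1b: "(v1 z)\<^sup>2 \<le> 15 * (B^6 * S)"
    proof -
      have "v1 z = 1 / h z * (f z + - k z * v z + - W z)" by (simp add: f_def)
      then have "(v1 z)\<^sup>2 \<le> B\<^sup>2 * (f z + - k z * v z + - W z)\<^sup>2"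
        using product_square_le Bz by metis
      also have "\<dots> \<le> B\<^sup>2 * (3 * ((f z)\<^sup>2 + (- k z * v z)\<^sup>2 + (- W z)\<^sup>2))"
        by (intro mult_left_mono sum_square_le) auto
      also have "\<dots> \<le> B\<^sup>2 * (3 * (S + B\<^sup>2 * (2 * B\<^sup>2 * S) + 2 * B\<^sup>2 * S))"
      proof (intro mult_left_mono add_mono S)
        show "(- k z * v z)\<^sup>2 \<le> B\<^sup>2 * (2 * B\<^sup>2 * S)"
          using product_square_le[of "- k z" B "v z"] Bz mult_left_mono[OF vb, of "B\<^sup>2"] by simp
      qed (use Wb in auto)
      also have "\<dots> = 3 * (B^2 * S) + 6 * (B^6 * S) + 6 * (B^4 * S)" by (simp add: eval_nat_numeral algebra_simps)
      finally show ?thesis using pow[of 2 6] pow[of 4 6] by simp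
    qed
    have v2b: "(v2 z)\<^sup>2 \<le> 189 * (B^10 * S)"
    proof -
      have "v2 z = 1 / h z * (fp z + - (2 * k z) * v1 z + - (1 + l z) * v z)" by (simp add: fp_def field_simps)
      then have "(v2 z)\<^sup>2 \<le> B\<^sup>2 * (fp z + - (2 * k z) * v1 z + - (1 + l z) * v z)\<^sup>2"
        using product_square_le Bz by metis
      also have "\<dots> \<le> B\<^sup>2 * (3 * ((fp z)\<^sup>2 + (- (2 * k z) * v1 z)\<^sup>2 + (- (1 + l z) * v z)\<^sup>2))"
        by (intro mult_left_mono sum_square_le) auto
      also have "\<dots> \<le> B\<^sup>2 * (3 * (S + (2 * B)\<^sup>2 * (15 * (B^6 * S)) + B\<^sup>2 * (2 * B\<^sup>2 * S)))"
      proof (intro mult_left_mono add_mono S)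
        have "\<bar>- (2 * k z)\<bar> \<le> 2 * B" using Bz by (simp add: abs_mult)
        from order_trans[OF product_square_le[OF this] mult_left_mono[OF v1b]]
        show "(- (2 * k z) * v1 z)\<^sup>2 \<le> (2 * B)\<^sup>2 * (15 * (B^6 * S))" by simp
        have "\<bar>- (1 + l z)\<bar> \<le> B" using Bz by linarith
        from order_trans[OF product_square_le[OF this] mult_left_mono[OF vb]]
        show "(- (1 + l z) * v z)\<^sup>2 \<le> B\<^sup>2 * (2 * B\<^sup>2 * S)" by simp
      qed auto
      also have "\<dots> = 3 * (B^2 * S) + 180 * (B^10 * S) + 6 * (B^6 * S)" by (simp add: eval_nat_numeral algebra_simps)
      finally show ?thesis using pow[of 2 10] pow[of 6 10] by simp
    qed
    have "(v z)\<^sup>2 + (v1 z)\<^sup>2 + (v2 z)\<^sup>2 \<le> 2 * (B^2 * S) + 15 * (B^6 * S) + 189 * (B^10 * S)"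
      using vb v1b v2b by simp
    also have "\<dots> \<le> 206 * (B^10 * S)" using pow[of 2 10] pow[of 6 10] by linarith
    also have "\<dots> = 206 * B^10 * S" by simp
    also have "\<dots> \<le> 206 * B^10 * (K3 * E + ((fp z)\<^sup>2 + (f z)\<^sup>2 + (b z)\<^sup>2))"
      using AK3[OF z] B(1) by (intro mult_left_mono) (auto simp: S_def)
    finally show ?thesis .
  qed
  have "(\<lambda>z. (v2 z)\<^sup>2 * 1 + v2 z * 0 + ((v z)\<^sup>2 + (v1 z)\<^sup>2)) absolutely_integrable_on {0..L}"
    by (intro integrable_quadratic continuous_intros)
  then show H2i: "(\<lambda>z. (v z)\<^sup>2 + (v1 z)\<^sup>2 + (v2 z)\<^sup>2) absolutely_integrable_on {0..L}"
    by (simp add: add_ac)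
  have Ci: "((\<lambda>z. 206 * B^10 * (K3 * E + ((fp z)\<^sup>2 + (f z)\<^sup>2 + (b z)\<^sup>2))) has_integral
      206 * B^10 * ((L - 0) *\<^sub>R (K3 * E) + E)) {0..L}"
    using L has_integral_const_real[of "K3 * E" 0 L] unfolding E_def
    by (intro has_integral_mult_right has_integral_add integrable_integral Ei') auto
  have "integral {0..L} (\<lambda>z. (v z)\<^sup>2 + (v1 z)\<^sup>2 + (v2 z)\<^sup>2)
      \<le> 206 * B^10 * ((L - 0) *\<^sub>R (K3 * E) + E)"
    by (rule has_integral_le[OF integrable_integral[OF set_lebesgue_integral_eq_integral(1)[OF H2i]] Ci pw])
  also have "\<dots> = coercivity B * E"
    by (simp add: coercivity_def K1_def K2_def K3_def algebra_simps)
  finally show "integral {0..L} (\<lambda>z. (v z)\<^sup>2 + (v1 z)\<^sup>2 + (v2 z)\<^sup>2)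
      \<le> coercivity B * integral {0..L} (\<lambda>z. (fp z)\<^sup>2 + (f z)\<^sup>2 + (b z)\<^sup>2)"
    by (simp add: E_def)
qed

end

section \<open>The second variation\<close>

text \<open>Both weights share the factor \<open>J^(-5/3)\<close>:
  \<open>J^(-2/3) = J^(-5/3) * J\<close>, and \<open>1 - 3 U'' = J / (\<gamma> - U)^3\<close> turns
  the other weight into \<open>J^(-5/3) (\<gamma> - U)^5\<close>.\<close>

lemma second_variation_eq:
  fixes c :: real
  assumes wave: "ostrovsky_wave \<gamma> I U"
  defines "J \<equiv> \<gamma>^3 - 6 * I"
  shows "second_variation c \<gamma> I U L v = per_integral L (\<lambda>z. (zero_mean_antideriv L v z)\<^sup>2 - (\<gamma> - U z) * (v z)\<^sup>2
    + c * J powr (-5/3) * ((\<gamma> - U z) ^ 5 * (L2_deriv L (L2_deriv L v) z)\<^sup>2 - J * (v z)\<^sup>2))"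
proof -
  have J: "0 < J" and h: "\<And>z. 0 < \<gamma> - U z" using wave by (auto simp: ostrovsky_wave_def J_def)
  have J1: "1 / J powr (2/3) = J powr (-5/3) * J"
  proof -
    have "J powr (-5/3) * J = J powr (-5/3 + 1)" using powr_add[of J "-5/3" 1] J by (simp only: powr_one less_imp_le)
    also have "\<dots> = J powr (- (2/3))" by simp
    finally show ?thesis by (simp add: powr_minus_divide)
  qed
  have J2: "1 / (1 - 3 * deriv (deriv U) z) powr (5/3) = J powr (-5/3) * (\<gamma> - U z) ^ 5" for z
  proof -
    have "((\<gamma> - U z) ^ 3) powr (5/3) = (\<gamma> - U z) ^ 5"
    proof -
      have "((\<gamma> - U z) ^ 3) powr (5/3) = ((\<gamma> - U z) powr 3) powr (5/3)"
        using h[of z] by (simp add: powr_numeral)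
      also have "\<dots> = (\<gamma> - U z) powr 5" by (simp add: powr_powr)
      finally show ?thesis using h[of z] by (simp add: powr_numeral)
    qed
    then have "(1 - 3 * deriv (deriv U) z) powr (5/3) = J powr (5/3) / (\<gamma> - U z) ^ 5"
      using wave_derivs(7)[OF wave, of z] J h[of z] by (simp add: J_def powr_divide)
    then show ?thesis by (simp add: powr_minus_divide)
  qed
  have eq: "(zero_mean_antideriv L v z)\<^sup>2 - (\<gamma> - U z) * (v z)\<^sup>2
        - c * (v z)\<^sup>2 / J powr (2/3)
        + c * (L2_deriv L (L2_deriv L v) z)\<^sup>2 / (1 - 3 * deriv (deriv U) z) powr (5/3)
     = (zero_mean_antideriv L v z)\<^sup>2 - (\<gamma> - U z) * (v z)\<^sup>2
    + c * J powr (-5/3) * ((\<gamma> - U z) ^ 5 * (L2_deriv L (L2_deriv L v) z)\<^sup>2 - J * (v z)\<^sup>2)" for z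
  proof -
    have "c * (v z)\<^sup>2 / J powr (2/3) = c * (v z)\<^sup>2 * (1 / J powr (2/3))" by simp
    moreover have "c * (L2_deriv L (L2_deriv L v) z)\<^sup>2 / (1 - 3 * deriv (deriv U) z) powr (5/3)
      = c * (L2_deriv L (L2_deriv L v) z)\<^sup>2 * (1 / (1 - 3 * deriv (deriv U) z) powr (5/3))" by simp
    ultimately show ?thesis unfolding J1 J2 by (simp add: algebra_simps)
  qed
  show ?thesis unfolding second_variation_def J_def[symmetric] eq ..
qed

text \<open>This links the Sobolev definitions to the two locales. All coefficient bounds are
  assumed on the set \<open>S\<close> of speeds, so that \<open>C\<close> can be fixed before the
  speed and the perturbation.\<close>

lemma coercive_on_speed_set:
  fixes \<gamma> I a K :: real and U :: "real \<Rightarrow> real" and S :: "real set" and N :: nat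
  assumes wave: "ostrovsky_wave \<gamma> I U" and N: "1 \<le> N"
    and a0: "0 < a" and a1: "a \<le> 1" and K: "0 \<le> K" "8 * (2 * K + 6) * a \<le> 1"
    and D: "\<And>z. 0 < wronskian a (U z) (deriv U z) z"
    and \<phi>: "\<And>z. \<bar>U z / a\<bar> \<le> 2"
  defines "m \<equiv> \<lambda>c. c * (\<gamma>^3 - 6 * I) powr (-5/3)"
  defines "\<epsilon> \<equiv> \<lambda>c. 1 - 2 * m c * \<gamma>\<^sup>2"
  assumes \<epsilon>a: "\<And>c. c \<in> S \<Longrightarrow> \<bar>\<epsilon> c\<bar> \<le> 2 * a"
    and gap: "\<And>c. c \<in> S \<Longrightarrow> 3/4 * (- (2 * \<epsilon> c / 3))\<^sup>2 + (17 * (2 * K + 6) + 1) * a^3 \<le> a\<^sup>2"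
    and \<alpha>: "\<And>c z. c \<in> S \<Longrightarrow> \<bar>m c * (\<gamma> - U z) ^ 3 - 1/2\<bar> \<le> K * a"
    and \<beta>: "\<And>c z. c \<in> S \<Longrightarrow> \<bar>4 * m c * (\<gamma> - U z)\<^sup>2 * deriv U z\<bar> \<le> K * a"
    and \<kappa>: "\<And>c z. c \<in> S \<Longrightarrow> \<bar>4 * m c * (\<gamma> - U z) * (deriv U z)\<^sup>2
        + 2 * m c * (\<gamma> - U z) * (\<gamma> - 3 * (deriv U z)\<^sup>2) - 1\<bar> \<le> K * a"
    and \<nu>: "\<And>c z. c \<in> S \<Longrightarrow> \<bar>2 * m c * a\<^sup>2 / (\<gamma> - U z)
        - \<epsilon> c * residue2 a (\<gamma> - U z) (- deriv U z) z * sine2 a z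
          / ((\<gamma> - U z) * wronskian a (U z) (deriv U z) z)\<^sup>2 - a\<^sup>2\<bar> \<le> K * a^3"
    and \<mu>: "\<And>c z. c \<in> S \<Longrightarrow> \<bar>2 * \<epsilon> c * sine2 a z / ((\<gamma> - U z) * wronskian a (U z) (deriv U z) z)
        - 2 * \<epsilon> c * sin z\<bar> \<le> K * a\<^sup>2"
  shows "\<exists>C>0. \<forall>c\<in>S. \<forall>v\<in>H2_per_zero (2 * pi * real N).
      L2_inner (2 * pi * real N) (deriv U) v = 0 \<longrightarrow>
      second_variation c \<gamma> I U (2 * pi * real N) v \<ge> C * (H2_norm (2 * pi * real N) v)\<^sup>2"
proof -
  define L where "L = 2 * pi * real N"
  define J where "J = \<gamma>^3 - 6 * I"
  have L: "0 < L" using N by (simp add: L_def)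
  note deriv = wave_derivs[OF wave]
  have per: "g L = g 0" if "\<And>x. g (x + 2 * pi) = g x" for g :: "real \<Rightarrow> real"
  proof -
    interpret periodic_fun_simple g "2 * pi" by unfold_locales (rule that)
    show ?thesis using plus_of_nat[of 0 N] by (simp add: L_def mult_ac)
  qed
  interpret periodic_wave \<gamma> J a L U "deriv U"
  proof
    show "0 < \<gamma> - U z" for z using wave by (simp add: ostrovsky_wave_def)
    show "U L = U 0" using wave by (intro per) (simp add: ostrovsky_wave_def)
    show "deriv U L = deriv U 0" by (rule per) (rule deriv)
    show "sin L = 0" "cos L = 1" using per[of sin] per[of cos] by simp_all
    show "J = (\<gamma> - U z)^3 + 3 * U z * (\<gamma> - U z)\<^sup>2 - 3 * (deriv U z)\<^sup>2 * (\<gamma> - U z)\<^sup>2" for z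
      unfolding J_def by (rule deriv)
  qed (use L a0 D deriv in auto)
  obtain B where B: "1 \<le> B" "\<And>z. z \<in> {0..L} \<Longrightarrow> \<bar>U z\<bar> \<le> B \<and> \<bar>deriv U z\<bar> \<le> B \<and> \<bar>k z\<bar> \<le> B \<and> \<bar>1 + l z\<bar> \<le> B
    \<and> \<bar>1 / h z\<bar> \<le> B \<and> \<bar>Y z / p z\<bar> \<le> B \<and> \<bar>Y' z / p z\<bar> \<le> B
    \<and> \<bar>Y z / (a * p z)\<bar> \<le> B \<and> \<bar>r z * Y z / (a * (p z)\<^sup>2)\<bar> \<le> B"
    by (rule coeff_bound) blast
  \<comment> \<open>The factor \<open>a^3 / 64\<close> comes from \<open>energy_lower_bound\<close>;
    dividing by \<open>coercivity B\<close> passes from the sum of squares to the \<open>H^2\<close>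
    norm.\<close>
  define C where "C = a^3 / 64 / coercivity B"
  have C: "0 < C" using a coercivity_pos[OF B(1)] by (simp add: C_def)
  have main: "second_variation c \<gamma> I U L v \<ge> C * (H2_norm L v)\<^sup>2"
    if c: "c \<in> S" and v: "v \<in> H2_per_zero L" and orth: "L2_inner L (deriv U) v = 0" for c v
  proof -
    define W where "W = zero_mean_antideriv L v"
    define v1 where "v1 = L2_deriv L v"
    define v2 where "v2 = L2_deriv L v1"
    have H2: "v \<in> H2_per L" and mean: "per_integral L v = 0"
      using v by (auto simp: H2_per_zero_def)
    have dv: "has_L2_deriv L v v1" and dv1: "has_L2_deriv L v1 v2"
      unfolding v1_def v2_def by (rule L2_deriv_props[OF H2])+
    note v1 = has_L2_derivD[OF dv1 L] and v = has_L2_derivD[OF dv L]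
    have vc: "continuous_on UNIV v"
      by (rule L2_deriv_continuous_imp_continuous[OF dv L v1(5)])
    have dW: "has_L2_deriv L W v"
      unfolding W_def using dv mean by (intro zero_mean_antideriv_deriv L vc) (auto simp: has_L2_deriv_def)
    note W = has_L2_derivD[OF dW L]
    interpret perturbed_wave \<gamma> J a L U "deriv U" W v v1 v2
      by unfold_locales (use v v1 W in auto)
    have orth': "integral {0..L} (\<lambda>z. deriv U z * v z) = 0"
      using orth unfolding L2_inner_def
      by (subst (asm) per_integral_eq)
        (intro absolutely_integrable_continuous_real continuous_intros, simp)
    have energy:
      "a^3 / 64 * integral {0..L} (\<lambda>z. (fp z)\<^sup>2 + (f z)\<^sup>2 + (b z)\<^sup>2)
        \<le> integral {0..L} (\<lambda>z. (W z)\<^sup>2 - h z * (v z)\<^sup>2 + m c * (h z ^ 5 * (v2 z)\<^sup>2 - J * (v z)\<^sup>2))"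
      "(\<lambda>z. (fp z)\<^sup>2 + (f z)\<^sup>2 + (b z)\<^sup>2) absolutely_integrable_on {0..L}"
      "(\<lambda>z. (W z)\<^sup>2 - h z * (v z)\<^sup>2 + m c * (h z ^ 5 * (v2 z)\<^sup>2 - J * (v z)\<^sup>2)) absolutely_integrable_on {0..L}"
    proof -
      note coeffs = refl[of "1 - 2 * m c * \<gamma>\<^sup>2"] a1 K \<epsilon>a[OF c, unfolded \<epsilon>_def] gap[OF c, unfolded \<epsilon>_def]
        \<alpha>[OF c, folded h_def] \<beta>[OF c, folded h_def] \<kappa>[OF c, folded h_def]
        \<nu>[OF c, folded h_def k_def, folded r_def p_def, unfolded \<epsilon>_def]
        \<mu>[OF c, folded h_def, folded p_def, unfolded \<epsilon>_def] \<phi>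
      note e = energy_lower_bound[OF coeffs]
      show "a^3 / 64 * integral {0..L} (\<lambda>z. (fp z)\<^sup>2 + (f z)\<^sup>2 + (b z)\<^sup>2)
        \<le> integral {0..L} (\<lambda>z. (W z)\<^sup>2 - h z * (v z)\<^sup>2 + m c * (h z ^ 5 * (v2 z)\<^sup>2 - J * (v z)\<^sup>2))"
      "(\<lambda>z. (fp z)\<^sup>2 + (f z)\<^sup>2 + (b z)\<^sup>2) absolutely_integrable_on {0..L}"
      "(\<lambda>z. (W z)\<^sup>2 - h z * (v z)\<^sup>2 + m c * (h z ^ 5 * (v2 z)\<^sup>2 - J * (v z)\<^sup>2)) absolutely_integrable_on {0..L}"
        by (rule e)+
    qed
    note H2 = quadratic_dominates_H2[OF orth' B energy(2)]
    have norm: "(H2_norm L v)\<^sup>2 = integral {0..L} (\<lambda>z. (v z)\<^sup>2 + (v1 z)\<^sup>2 + (v2 z)\<^sup>2)"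
    proof -
      have "0 \<le> integral {0..L} (\<lambda>z. (v z)\<^sup>2 + (v1 z)\<^sup>2 + (v2 z)\<^sup>2)"
        by (rule integral_nonneg[OF set_lebesgue_integral_eq_integral(1)[OF H2(2)]]) auto
      moreover have "per_integral L (\<lambda>z. (v z)\<^sup>2 + (v1 z)\<^sup>2 + (v2 z)\<^sup>2)
          = integral {0..L} (\<lambda>z. (v z)\<^sup>2 + (v1 z)\<^sup>2 + (v2 z)\<^sup>2)"
        by (rule per_integral_eq[OF H2(2)])
      ultimately show ?thesis
        unfolding H2_norm_def v1_def[symmetric] v2_def[symmetric] by (simp only: real_sqrt_pow2)
    qed
    have "second_variation c \<gamma> I U L v
        = integral {0..L} (\<lambda>z. (W z)\<^sup>2 - h z * (v z)\<^sup>2 + m c * (h z ^ 5 * (v2 z)\<^sup>2 - J * (v z)\<^sup>2))"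
      using second_variation_eq[OF wave, of c L v] per_integral_eq[OF energy(3)]
      by (simp add: h_def J_def m_def W_def v1_def v2_def)
    moreover have "C * (H2_norm L v)\<^sup>2
        \<le> C * (coercivity B * integral {0..L} (\<lambda>z. (fp z)\<^sup>2 + (f z)\<^sup>2 + (b z)\<^sup>2))"
      unfolding norm using H2(1) C by (intro mult_left_mono) auto
    moreover have "C * (coercivity B * integral {0..L} (\<lambda>z. (fp z)\<^sup>2 + (f z)\<^sup>2 + (b z)\<^sup>2))
        = a^3 / 64 * integral {0..L} (\<lambda>z. (fp z)\<^sup>2 + (f z)\<^sup>2 + (b z)\<^sup>2)"
      using coercivity_pos[OF B(1)] by (simp add: C_def)
    ultimately show ?thesis using energy(1) by linarith
  qed
  show ?thesis unfolding L_def[symmetric] using C main by blast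
qed

text \<open>Since \<open>3/4 * (2 * \<epsilon> / 3)^2 = \<epsilon>^2 / 3\<close>, the threshold is
  \<open>|\<epsilon>| = sqrt 3 * a\<close>, and \<open>\<epsilon>\<close> is close to
  \<open>1 - 2 * c\<close>; this is the origin of the slope \<open>sqrt 3 / 2\<close>. Narrowing the
  interval by \<open>K / 2 * a^2\<close> pays for the approximation, and by
  \<open>M / 2 * a^2\<close> for the cubic margin.\<close>

lemma speed_gap:
  fixes a K M c \<epsilon> :: real
  assumes a: "0 < a" and M: "0 \<le> M" "M * a \<le> 1"
    and c: "\<bar>c - 1/2\<bar> < sqrt 3 * a / 2 - (M + K) / 2 * a\<^sup>2"
    and \<epsilon>: "\<bar>\<epsilon> - (1 - 2 * c)\<bar> \<le> K * a\<^sup>2"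
  shows "\<bar>\<epsilon>\<bar> \<le> 2 * a" and "3/4 * (- (2 * \<epsilon> / 3))\<^sup>2 + M / 2 * a^3 \<le> a\<^sup>2"
proof -
  have "\<bar>1 - 2 * c\<bar> = 2 * \<bar>c - 1/2\<bar>" by (auto simp: abs_if)
  then have "\<bar>\<epsilon>\<bar> \<le> 2 * \<bar>c - 1/2\<bar> + K * a\<^sup>2"
    using \<epsilon> abs_triangle_ineq[of "\<epsilon> - (1 - 2 * c)" "1 - 2 * c"] by simp
  also have "\<dots> \<le> sqrt 3 * a - M * a\<^sup>2" using c by (simp add: algebra_simps add_divide_distrib)
  finally have e: "\<bar>\<epsilon>\<bar> \<le> sqrt 3 * a - M * a\<^sup>2" .
  have s3: "sqrt 3 \<le> 2" by (rule real_le_lsqrt) auto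
  have "sqrt 3 * a \<le> 2 * a" using s3 a by (intro mult_right_mono) auto
  moreover have "0 \<le> M * a\<^sup>2" using M by simp
  ultimately show "\<bar>\<epsilon>\<bar> \<le> 2 * a" using e by linarith
  have "\<epsilon>\<^sup>2 \<le> (sqrt 3 * a - M * a\<^sup>2)\<^sup>2" using power_mono[OF e, of 2] by simp
  also have "\<dots> = 3 * a\<^sup>2 - 2 * sqrt 3 * (M * a^3) + (M * a) * (M * a^3)"
    by (simp add: power2_eq_square power3_eq_cube algebra_simps)
  also have "\<dots> \<le> 3 * a\<^sup>2 - 2 * sqrt 3 * (M * a^3) + 1 * (M * a^3)"
    using M a by (intro add_left_mono mult_right_mono) auto
  also have "\<dots> \<le> 3 * a\<^sup>2 - 3 * (M * a^3 / 2)"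
  proof -
    \<comment> \<open>The required inequality is \<open>2 * sqrt 3 - 1 >= 3/2\<close>.\<close>
    have "5/4 \<le> sqrt (3::real)" by (rule real_le_rsqrt) (simp add: power2_eq_square)
    then have "5/4 * (M * a^3) \<le> sqrt 3 * (M * a^3)" using M a by (intro mult_right_mono) auto
    then show ?thesis by simp
  qed
  finally show "3/4 * (- (2 * \<epsilon> / 3))\<^sup>2 + M / 2 * a^3 \<le> a\<^sup>2"
    by (simp add: power_divide power_mult_distrib)
qed


theorem theorem2p13:
  fixes U :: "real \<Rightarrow> real \<Rightarrow> real" and \<gamma> I :: "real \<Rightarrow> real" and a0 \<gamma>1 :: real
  assumes "small_amplitude_waves a0 \<gamma>1 U \<gamma> I"
  shows "\<exists>\<gamma>0 c_minus c_plus.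
     \<gamma>0 \<in> {1<..<pi\<^sup>2 / 9} \<and> \<gamma>0 \<le> \<gamma>1 \<and>
     (\<lambda>a. c_minus a - (1/2 - sqrt 3 * a / 2)) \<in> O[at_right 0](\<lambda>a. a^2) \<and>
     (\<lambda>a. c_plus a - (1/2 + sqrt 3 * a / 2)) \<in> O[at_right 0](\<lambda>a. a^2) \<and>
     (\<forall>a\<in>{0<..<a0}. \<gamma> a \<in> {1<..<\<gamma>0} \<longrightarrow>
        c_minus a < c_plus a \<and>
        (\<forall>N::nat. N \<ge> 1 \<longrightarrow>
          (\<exists>C>0. \<forall>c\<in>{c_minus a<..<c_plus a}. \<forall>v\<in>H2_per_zero (2 * pi * real N).
             L2_inner (2 * pi * real N) (deriv (U a)) v = 0 \<longrightarrow>
             second_variation c (\<gamma> a) (I a) (U a) (2 * pi * real N) v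
               \<ge> C * (H2_norm (2 * pi * real N) v)\<^sup>2)))"
proof -
  note waves = assms[unfolded small_amplitude_waves_def]
  define m where "m a c = c * ((\<gamma> a)^3 - 6 * I a) powr (-5/3)" for a c
  define \<epsilon> where "\<epsilon> a c = 1 - 2 * m a c * (\<gamma> a)\<^sup>2" for a c
  define h where "h a z = \<gamma> a - U a z" for a z
  define D where "D a z = wronskian a (U a z) (deriv (U a) z) z" for a z
  define r where "r a z = residue2 a (\<gamma> a - U a z) (- deriv (U a) z) z" for a z
  note asym = coefficient_asymptotics[OF wave_asymptotics[OF assms],
      folded h_def m_def D_def r_def, folded \<epsilon>_def, THEN unif_bigo_eventually]
  \<comment> \<open>Each of the eight estimates holds with every sufficiently large constant, hence
    all hold with a common one.\<close>
  have "\<forall>\<^sub>F K in at_top. 0 \<le> K \<and> (\<forall>\<^sub>F a in at_right 0. \<forall>c z. \<bar>c - 1/2\<bar> \<le> a \<longrightarrow>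
      \<bar>U a z / a - cos z\<bar> \<le> K * a ^ 1 \<and> \<bar>h a z * D a z - 1\<bar> \<le> K * a ^ 1 \<and>
      \<bar>\<epsilon> a c - (1 - 2 * c)\<bar> \<le> K * a ^ 2 \<and> \<bar>m a c * h a z ^ 3 - 1/2\<bar> \<le> K * a ^ 1 \<and>
      \<bar>4 * m a c * (h a z)\<^sup>2 * deriv (U a) z\<bar> \<le> K * a ^ 1 \<and>
      \<bar>4 * m a c * h a z * (deriv (U a) z)\<^sup>2 + 2 * m a c * h a z * (\<gamma> a - 3 * (deriv (U a) z)\<^sup>2) - 1\<bar> \<le> K * a ^ 1 \<and>
      \<bar>2 * m a c * a\<^sup>2 / h a z - \<epsilon> a c * r a z * sine2 a z / (h a z * D a z)\<^sup>2 - a\<^sup>2\<bar> \<le> K * a ^ 3 \<and>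
      \<bar>2 * \<epsilon> a c * sine2 a z / (h a z * D a z) - 2 * \<epsilon> a c * sin z\<bar> \<le> K * a ^ 2)"
    (is "\<forall>\<^sub>F K in at_top. 0 \<le> K \<and> (\<forall>\<^sub>F a in at_right 0. ?bounds K a)")
    using asym eventually_ge_at_top[of 0]
  proof eventually_elim
    case (elim K)
    have "\<forall>\<^sub>F a in at_right 0. ?bounds K a"
      using elim(1-8) by eventually_elim blast
    then show ?case using elim by blast
  qed
  then obtain K where K: "0 \<le> K" and ev: "\<forall>\<^sub>F a in at_right 0. ?bounds K a"
    using eventually_happens'[OF trivial_limit_at_top_linorder] by blast
  \<comment> \<open>\<open>M / 2\<close> is the coefficient of \<open>a^3\<close> demanded by the
    gap condition of \<open>oscillation_square\<close>.\<close>
  define M where "M = 2 * (17 * (2 * K + 6) + 1)"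
  define K' where "K' = (M + K) / 2"
  have M: "1 \<le> M" using K by (simp add: M_def)
  have K': "0 < K'" using K M by (simp add: K'_def)
  define \<rho> where "\<rho> a = sqrt 3 * a / 2 - (M + K) / 2 * a\<^sup>2" for a
  obtain t where t: "0 < t" "\<And>a. 0 < a \<Longrightarrow> a < t \<Longrightarrow> ?bounds K a"
    using ev unfolding eventually_at_right_field by blast
  \<comment> \<open>Below \<open>t\<close> the coefficient bounds hold; \<open>a0 / 2\<close> keeps
    \<open>a1\<close> itself an admissible amplitude; \<open>1 / M\<close> gives the smallness
    conditions; \<open>1 / (2 * K')\<close> makes the speed interval nonempty.\<close>
  define a1 where "a1 = Min {t, a0 / 2, 1 / M, 1 / (2 * K')}"
  have a1: "0 < a1" "a1 \<le> t" "a1 \<le> a0 / 2" "a1 \<le> 1 / M" "a1 \<le> 1 / (2 * K')"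
    using t waves M K' by (auto simp: a1_def)
  have a1a0: "a1 \<in> {0<..<a0}" using a1 waves by auto
  then have \<gamma>a1: "1 < \<gamma> a1" "\<gamma> a1 < \<gamma>1" using waves by (metis greaterThanLessThan_iff imageI)+
  have pi9: "1 < pi\<^sup>2 / 9"
    using power_strict_mono[OF pi_gt3, of 2] by simp
  \<comment> \<open>Strict monotonicity of the speed turns \<open>\<gamma> a < \<gamma> a1\<close>
    into \<open>a < a1\<close>; the midpoint keeps the value strictly below
    \<open>pi^2 / 9\<close>.\<close>
  define \<gamma>0 where "\<gamma>0 = min (\<gamma> a1) ((1 + pi\<^sup>2 / 9) / 2)"
  have \<gamma>0: "\<gamma>0 \<in> {1<..<pi\<^sup>2 / 9}" "\<gamma>0 \<le> \<gamma>1" using \<gamma>a1 pi9 by (auto simp: \<gamma>0_def min_def)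
  have main: "1/2 - \<rho> a < 1/2 + \<rho> a \<and> (\<forall>N::nat. N \<ge> 1 \<longrightarrow>
          (\<exists>C>0. \<forall>c\<in>{1/2 - \<rho> a<..<1/2 + \<rho> a}. \<forall>v\<in>H2_per_zero (2 * pi * real N).
             L2_inner (2 * pi * real N) (deriv (U a)) v = 0 \<longrightarrow>
             second_variation c (\<gamma> a) (I a) (U a) (2 * pi * real N) v
               \<ge> C * (H2_norm (2 * pi * real N) v)\<^sup>2))"
    if a: "a \<in> {0<..<a0}" and \<gamma>a: "\<gamma> a \<in> {1<..<\<gamma>0}" for a
  proof -
    have "a < a1"
    proof (rule ccontr)
      assume "\<not> a < a1"
      moreover have "strict_mono_on {0<..<a0} \<gamma>" using waves by blast
      ultimately have "\<gamma> a1 \<le> \<gamma> a"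
        using a a1a0 strict_mono_onD[of "{0<..<a0}" \<gamma> a1 a] by (cases "a = a1") auto
      then show False using \<gamma>a by (simp add: \<gamma>0_def)
    qed
    have a0: "0 < a" using a by simp
    have aM: "M * a \<le> 1" and aK': "2 * K' * a < 1"
      using a1 \<open>a < a1\<close> M K' by (simp_all add: field_simps) (smt (verit, best) mult_left_mono mult_strict_left_mono)+
    have "1 * a \<le> M * a" using M a0 by (intro mult_right_mono) auto
    then have a_le: "a \<le> 1" using aM by simp
    have Ka: "0 \<le> K * a" "8 * (2 * K + 6) * a \<le> 1"
    proof -
      show "0 \<le> K * a" using K a0 by simp
      have "8 * (2 * K + 6) * a \<le> M * a" using K a0 by (intro mult_right_mono) (auto simp: M_def)
      then show "8 * (2 * K + 6) * a \<le> 1" using aM by simp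
    qed
    have Ka2: "K * a \<le> 1/2" using Ka a0 by (simp add: algebra_simps)
    have bounds: "?bounds K a" using t a1 \<open>a < a1\<close> a0 by simp
    have \<rho>_le: "\<rho> a \<le> a"
    proof -
      have "sqrt 3 \<le> 2" by (rule real_le_lsqrt) auto
      then have "sqrt 3 * a \<le> 2 * a" using a0 by (intro mult_right_mono) auto
      moreover have "0 \<le> (M + K) / 2 * a\<^sup>2" using M K by simp
      ultimately show ?thesis by (simp add: \<rho>_def)
    qed
    have \<rho>_pos: "0 < \<rho> a"
    proof -
      have "1 < sqrt (3::real)" by simp
      then have "1 * a < sqrt 3 * a" using a0 by (intro mult_strict_right_mono) auto
      moreover have "2 * K' * a * a < 1 * a" using aK' a0 by (intro mult_strict_right_mono) auto
      ultimately show ?thesis by (simp add: \<rho>_def K'_def power2_eq_square algebra_simps)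
    qed
    \<comment> \<open>Bounds that do not involve the speed are read off at
      \<open>c = 1/2\<close>.\<close>
    have at_half: "\<bar>1/2 - 1/2 :: real\<bar> \<le> a" using a0 by simp
    have wave: "ostrovsky_wave (\<gamma> a) (I a) (U a)" using waves a by blast
    have \<phi>: "\<bar>U a z / a\<bar> \<le> 2" for z
    proof -
      have "\<bar>U a z / a - cos z\<bar> \<le> K * a"
        using bounds at_half unfolding power_one_right by blast
      moreover have "\<bar>U a z / a\<bar> \<le> \<bar>U a z / a - cos z\<bar> + \<bar>cos z\<bar>"
        using abs_triangle_ineq[of "U a z / a - cos z" "cos z"] by simp
      ultimately show ?thesis using Ka2 abs_cos_le_one[of z] by linarith
    qed
    \<comment> \<open>The bound on \<open>h * D\<close> puts it within 1/2 of 1, and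
      \<open>h\<close> is positive for the wave, so \<open>D\<close> is positive.\<close>
    have D_pos: "0 < D a z" for z
    proof -
      have "\<bar>h a z * D a z - 1\<bar> \<le> K * a ^ 1" using bounds at_half by blast
      then have "0 < h a z * D a z" using Ka2 by simp
      moreover have "0 < h a z" using wave by (simp add: h_def ostrovsky_wave_def)
      ultimately show ?thesis by (simp add: zero_less_mult_iff)
    qed
    have speed: "\<bar>c - 1/2\<bar> < \<rho> a" "\<bar>c - 1/2\<bar> \<le> a" if "c \<in> {1/2 - \<rho> a<..<1/2 + \<rho> a}" for c
      using that \<rho>_le by auto
    have cb: "\<bar>\<epsilon> a c - (1 - 2 * c)\<bar> \<le> K * a ^ 2" "\<bar>m a c * h a z ^ 3 - 1/2\<bar> \<le> K * a"
      "\<bar>4 * m a c * (h a z)\<^sup>2 * deriv (U a) z\<bar> \<le> K * a"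
      "\<bar>4 * m a c * h a z * (deriv (U a) z)\<^sup>2 + 2 * m a c * h a z * (\<gamma> a - 3 * (deriv (U a) z)\<^sup>2) - 1\<bar> \<le> K * a"
      "\<bar>2 * m a c * a\<^sup>2 / h a z - \<epsilon> a c * r a z * sine2 a z / (h a z * D a z)\<^sup>2 - a\<^sup>2\<bar> \<le> K * a ^ 3"
      "\<bar>2 * \<epsilon> a c * sine2 a z / (h a z * D a z) - 2 * \<epsilon> a c * sin z\<bar> \<le> K * a ^ 2"
      if "c \<in> {1/2 - \<rho> a<..<1/2 + \<rho> a}" for c z
      using bounds speed(2)[OF that] unfolding power_one_right by blast+
    have gap: "\<bar>\<epsilon> a c\<bar> \<le> 2 * a" "3/4 * (- (2 * \<epsilon> a c / 3))\<^sup>2 + (17 * (2 * K + 6) + 1) * a^3 \<le> a\<^sup>2"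
      if "c \<in> {1/2 - \<rho> a<..<1/2 + \<rho> a}" for c
    proof -
      have M2: "17 * (2 * K + 6) + 1 = M / 2" by (simp add: M_def)
      have "0 \<le> M" using M by simp
      from speed_gap[OF a0 this aM speed(1)[OF that, unfolded \<rho>_def] cb(1)[OF that]]
      show "\<bar>\<epsilon> a c\<bar> \<le> 2 * a" "3/4 * (- (2 * \<epsilon> a c / 3))\<^sup>2 + (17 * (2 * K + 6) + 1) * a^3 \<le> a\<^sup>2"
        unfolding M2 .
    qed
    have "\<exists>C>0. \<forall>c\<in>{1/2 - \<rho> a<..<1/2 + \<rho> a}. \<forall>v\<in>H2_per_zero (2 * pi * real N).
             L2_inner (2 * pi * real N) (deriv (U a)) v = 0 \<longrightarrow>
             second_variation c (\<gamma> a) (I a) (U a) (2 * pi * real N) v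
               \<ge> C * (H2_norm (2 * pi * real N) v)\<^sup>2" if N: "1 \<le> N" for N :: nat
      by (rule coercive_on_speed_set[OF wave N a0 a_le K Ka(2) D_pos[unfolded D_def] \<phi>, folded m_def, folded \<epsilon>_def,
            OF gap cb(2-6)[unfolded h_def D_def r_def]])
    then show ?thesis using \<rho>_pos by auto
  qed
  have O: "(\<lambda>a. x * a\<^sup>2) \<in> O[at_right 0](\<lambda>a. a^2)" for x :: real
    by simp
  have "(\<lambda>a. (1/2 - \<rho> a) - (1/2 - sqrt 3 * a / 2)) \<in> O[at_right 0](\<lambda>a. a^2)"
    "(\<lambda>a. (1/2 + \<rho> a) - (1/2 + sqrt 3 * a / 2)) \<in> O[at_right 0](\<lambda>a. a^2)"
    using O[of "(M + K) / 2"] O[of "- ((M + K) / 2)"] by (simp_all add: \<rho>_def)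
  then show ?thesis
    using \<gamma>0 main by (intro exI[of _ \<gamma>0] exI[of _ "\<lambda>a. 1/2 - \<rho> a"] exI[of _ "\<lambda>a. 1/2 + \<rho> a"]) blast
qed

end
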